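(* Let $m \geq 2$ be an integer with $6\nmid m$ and set $r:=\lfloor (m-1)/6\rfloor$. Let $(R_n)_{n\ge 0}$ be the composition vectors of the cyclic urn with $m$ types started with one ball of type $0$. Then there exist complex valued random variables $\Xi_1,\ldots,\Xi_r$ (on the probability space of the urn process) such that, as $n \to \infty$, $$\frac{1}{\sqrt{n}}\left(R_n- \mathbb{E}[R_n] - \sum_{k=1}^r 2\,\Re\left(n^{\omega^k}\Xi_k v_k\right)\right) \stackrel{d}{\longrightarrow}\mathcal{N}\left(0,\Sigma^{(m)}\right),$$ where the covariance matrix $\Sigma^{(m)}$ has rank $m-1$ and is given by $$\Sigma^{(m)}= \sum_{k=1}^{m-1}\frac{1}{|2\lambda_k-1|}\, v_k v_k^*.$$
   Context: Cyclic urn: balls have types $0,\ldots,m-1$. At time $0$ there is one ball, of type $0$. In each step a ball is drawn uniformly at random from the balls in the urn, independently of the past; if its type is $j$, it is returned to the urn together with a new ball of type $j+1 \bmod m$. $R_n=(R_{n,0},\ldots,R_{n,m-1})^t\in\mathbb{R}^m$ is the column vector of the numbers of balls of each type after $n$ steps. Notation: $\omega:=\exp(2\pi \mathrm{i}/m)$, $\lambda_k:=\Re(\omega^k)=\cos(2\pi k/m)$, and $v_k:=\frac1m(1,\omega^{-k},\omega^{-2k},\ldots,\omega^{-(m-1)k})^t\in\mathbb{C}^m$ for $0\le k\le m-1$. $v^*$ denotes the conjugate transpose of $v$; $\Re$ of a vector is taken componentwise; $n^{z}=\exp(z\log n)$ for complex $z$. $\stackrel{d}{\longrightarrow}$ is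 convergence in distribution and $\mathcal{N}(0,M)$ is the centered (possibly degenerate) normal distribution with covariance matrix $M$. Empty sums are $0$. *)

theory Defs
  imports "HOL-Probability.Probability"
begin

section \<open>The cyclic urn\<close>

text \<open>
  The urn after \<open>n\<close> steps is the list of the types of its \<open>n + 1\<close> balls, in the order in which they
  were added; \<open>u n\<close> is the position of the ball drawn in step \<open>n + 1\<close>. Only values \<open>u n \<le> n\<close>
  are meaningful.
\<close>

primrec urn :: "nat \<Rightarrow> (nat \<Rightarrow> nat) \<Rightarrow> nat \<Rightarrow> nat list" where
  "urn m u 0 = [0]"
| "urn m u (Suc n) = urn m u n @ [(urn m u n ! u n + 1) mod m]"

definition uniform_draws :: "'a measure \<Rightarrow> (nat \<Rightarrow> 'a \<Rightarrow> nat) \<Rightarrow> bool" where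
  "uniform_draws M U \<longleftrightarrow>
     prob_space.indep_vars M (\<lambda>_. count_space UNIV) U UNIV \<and>
     (\<forall>n. distr M (count_space UNIV) (U n) = measure_pmf (pmf_of_set {..n}))"

text \<open>
  Coordinates of \<open>m\<close>-dimensional vectors are indexed by a finite type \<open>'m\<close> with \<open>CARD('m) = m\<close>;
  a bijection \<open>idx\<close> from \<open>'m\<close> to \<open>{0..<m}\<close> tells which ball type a coordinate stands for.
\<close>

definition composition ::
  "('m::finite \<Rightarrow> nat) \<Rightarrow> (nat \<Rightarrow> 'a \<Rightarrow> nat) \<Rightarrow> nat \<Rightarrow> 'a \<Rightarrow> real^'m" where
  "composition idx U n x =
     (\<chi> j. real (count_list (urn CARD('m) (\<lambda>i. U i x) n) (idx j)))"

section \<open>Roots of unity and the vectors \<open>v\<^sub>k\<close>\<close>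

definition omega :: "nat \<Rightarrow> complex" where
  "omega m = exp (2 * of_real pi * \<i> / of_nat m)"

definition lam :: "nat \<Rightarrow> nat \<Rightarrow> real" where
  "lam m k = Re (omega m ^ k)"

definition vvec :: "('m::finite \<Rightarrow> nat) \<Rightarrow> nat \<Rightarrow> complex^'m" where
  "vvec idx k = (\<chi> j. 1 / of_nat CARD('m) * omega CARD('m) powi (- (int (idx j) * int k)))"

definition Re_vec :: "complex^'m \<Rightarrow> real^'m" where
  "Re_vec z = (\<chi> j. Re (z $ j))"

definition outer_cnj :: "complex^'m \<Rightarrow> complex^'m \<Rightarrow> complex^'m^'m" where
  "outer_cnj v w = (\<chi> i j. v $ i * cnj (w $ j))"

definition Sigma_mat :: "('m::finite \<Rightarrow> nat) \<Rightarrow> complex^'m^'m" where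
  "Sigma_mat idx =
     (\<Sum>k = 1..CARD('m) - 1.
        (1 / \<bar>2 * lam CARD('m) k - 1\<bar>) *\<^sub>R outer_cnj (vvec idx k) (vvec idx k))"

section \<open>Normal distributions and convergence in distribution\<close>

definition normal_real :: "real \<Rightarrow> real \<Rightarrow> real measure" where
  "normal_real \<mu> \<sigma> =
     (if \<sigma> = 0 then return borel \<mu> else density lborel (normal_density \<mu> \<sigma>))"

definition gaussian :: "'b::euclidean_space measure \<Rightarrow> bool" where
  "gaussian N \<longleftrightarrow> sets N = sets borel \<and>
     (\<forall>u. \<exists>\<mu> \<sigma>. 0 \<le> \<sigma> \<and> distr N borel (\<lambda>x. u \<bullet> x) = normal_real \<mu> \<sigma>)"

definition centered_normal :: "(real^'m) measure \<Rightarrow> real^'m^'m \<Rightarrow> bool" where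
  "centered_normal N S \<longleftrightarrow> gaussian N \<and>
     (\<forall>i. (\<integral>x. x $ i \<partial>N) = 0) \<and>
     (\<forall>i j. (\<integral>x. x $ i * x $ j \<partial>N) = S $ i $ j)"

definition weakly_converges ::
  "(nat \<Rightarrow> 'b::topological_space measure) \<Rightarrow> 'b measure \<Rightarrow> bool" where
  "weakly_converges P N \<longleftrightarrow>
     (\<forall>f :: 'b \<Rightarrow> real. continuous_on UNIV f \<longrightarrow> bounded (range f) \<longrightarrow>
        (\<lambda>n. \<integral>x. f x \<partial>P n) \<longlonglongrightarrow> (\<integral>x. f x \<partial>N))"

end

theory Submission
  imports Defs "HOL-Real_Asymp.Real_Asymp"
begin

text \<open>
  Why the theorem holds. The urn is decomposed into Fourier modes: for each \<open>k\<close> let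
  \<open>u\<^sub>k(n)\<close> be the sum of \<open>\<omega>\<^sup>k\<^sup>a\<close> over the types \<open>a\<close> of the balls present at time \<open>n\<close>. A new ball has the type
  of a uniformly chosen old one plus 1, so the conditional mean of \<open>u\<^sub>k(n + 1)\<close> is
  \<open>(1 + \<omega>\<^sup>k / (n + 1)) u\<^sub>k(n)\<close>. Hence \<open>u\<^sub>k(n)\<close> divided by the product \<open>P\<^sub>k(n)\<close> of these factors is a martingale, and
  \<open>P\<^sub>k(n)\<close> behaves like a constant times the complex power of \<open>n\<close> with exponent \<open>\<omega>\<^sup>k\<close>. Its increments are
  \<open>\<Delta>\<^sub>k(i) / P\<^sub>k(i + 1)\<close>, where the jump \<open>\<Delta>\<^sub>k(i)\<close> is bounded by 2 and has conditional mean zero.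

  If \<open>Re \<omega>\<^sup>k < 1/2\<close>, then \<open>u\<^sub>k(n) - E u\<^sub>k(n)\<close> is the weighted sum of the past jumps \<open>\<Delta>\<^sub>k(i)\<close>, \<open>i < n\<close>, with weights
  \<open>P\<^sub>k(n) / P\<^sub>k(i + 1)\<close>; the squares of the weights add up to about \<open>n / (1 - 2 Re \<omega>\<^sup>k)\<close>. If \<open>Re \<omega>\<^sup>k > 1/2\<close>, the
  martingale converges in \<open>L\<^sup>1\<close>; its limit gives the random variable \<open>\<Xi>\<^sub>k\<close>, and what remains after
  subtracting it is minus the weighted sum of the future jumps, \<open>i \<ge> n\<close>, whose squared weights add up to about
  \<open>n / (2 Re \<omega>\<^sup>k - 1)\<close>. The boundary value \<open>1/2\<close> would need \<open>k / m = 1/6\<close> or \<open>5/6\<close>, which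
  is excluded because 6 does not divide \<open>m\<close>.

  So every linear functional of the normalised residual is, up to an error that vanishes in \<open>L\<^sup>1\<close>, a
  sum of martingale increments with deterministic weights. The conditional covariance of \<open>\<Delta>\<^sub>k(i)\<close>
  and \<open>\<Delta>\<^sub>q(i)\<close> is 1 if \<open>k = q\<close> and 0 otherwise, up to an error controlled by the imbalance
  \<open>|u\<^sub>j(i)| / (i + 1)\<close> of the nontrivial modes \<open>j\<close>. This error tends to zero in mean
  (\<open>expectation_imbalance_tendsto_0\<close>), by a recursion for the second moment of \<open>u\<^sub>j\<close>. Different modes
  therefore become uncorrelated, and each mode contributes its own term to \<open>\<Sigma>\<close>.

  Since the conditional variances are asymptotically deterministic, the characteristic function of the
  sum can be computed one increment at a time (\<open>char_martingale_sum\<close>), which gives convergence of the characteristic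
  function of every linear functional (\<open>CLT_weighted_sums\<close>). Together with bounded first
  moments this yields convergence in distribution in \<open>\<real>\<^sup>m\<close> (\<open>weakly_converges_if_char_converges\<close>). The kernel of the covariance
  matrix consists of the constant vectors, as these are the vectors on which all Fourier
  coefficients of index \<open>1, \<dots>, m - 1\<close> vanish; hence the rank is \<open>m - 1\<close>.
\<close>

section \<open>Characteristic functions determine weak convergence\<close>

text \<open>
  Convergence of characteristic functions says that the expectations of these functions converge; the
  proof shows that they are dense enough to handle every bounded continuous function.
\<close>

inductive trig_polynomial :: "('b::euclidean_space \<Rightarrow> complex) \<Rightarrow> bool" where
  trig_monom: "trig_polynomial (\<lambda>x. c * iexp (t \<bullet> x))"
| trig_add: "trig_polynomial F \<Longrightarrow> trig_polynomial G \<Longrightarrow> trig_polynomial (\<lambda>x. F x + G x)"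

lemma trig_polynomial_const: "trig_polynomial (\<lambda>x. c)"
  using trig_monom[of c 0] by simp

lemma trig_polynomial_mult:
  assumes "trig_polynomial F" "trig_polynomial G"
  shows "trig_polynomial (\<lambda>x. F x * G x)"
  using assms
proof (induction arbitrary: G)
  case (trig_monom c t)
  from trig_monom show ?case
  proof induction
    case (trig_monom d s)
    have "(\<lambda>x. c * iexp (t \<bullet> x) * (d * iexp (s \<bullet> x))) = (\<lambda>x. (c * d) * iexp ((t + s) \<bullet> x))"
      by (auto simp: inner_add_left exp_add ring_distribs fun_eq_iff)
    then show ?case
      using trig_polynomial.trig_monom by metis
  next
    case (trig_add F G)
    then show ?case
      using trig_polynomial.trig_add by (fastforce simp: ring_distribs)
  qed
next
  case (trig_add F H)
  then have "trig_polynomial (\<lambda>x. F x * G x + H x * G x)"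
    by (intro trig_polynomial.trig_add)
  then show ?case
    by (simp add: ring_distribs)
qed

lemma trig_polynomial_sum:
  assumes "finite A" "\<And>a. a \<in> A \<Longrightarrow> trig_polynomial (F a)"
  shows "trig_polynomial (\<lambda>x. \<Sum>a\<in>A. F a x)"
  using assms
  by (induction rule: finite_induct) (auto intro: trig_polynomial_const trig_polynomial.trig_add)

lemma trig_polynomial_sin: "trig_polynomial (\<lambda>x. c * complex_of_real (sin (t \<bullet> x)))"
proof -
  have *: "complex_of_real (sin y) = - \<i> / 2 * iexp y + \<i> / 2 * iexp (- y)" for y
    by (simp add: sin_of_real[symmetric] sin_exp_eq field_simps)
  have "trig_polynomial (\<lambda>x. (c * (- \<i> / 2)) * iexp (t \<bullet> x) + (c * (\<i> / 2)) * iexp ((- t) \<bullet> x))"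
    by (intro trig_polynomial.intros)
  then show ?thesis
    by (simp add: * ring_distribs mult.assoc)
qed

text \<open>
  For large \<open>L\<close> this map is close to the identity on bounded sets, its range is bounded, and its
  coordinates are trigonometric polynomials. Composing a polynomial with it therefore gives a
  trigonometric polynomial that is bounded on the whole space.
\<close>

definition sine_map :: "real \<Rightarrow> 'b::euclidean_space \<Rightarrow> 'b" where
  "sine_map L x = (\<Sum>b\<in>Basis. (L * sin (x \<bullet> b / L)) *\<^sub>R b)"

lemma trig_polynomial_sine_map:
  fixes g :: "'b::euclidean_space \<Rightarrow> real"
  assumes "real_polynomial_function g"
  shows "trig_polynomial (\<lambda>x. complex_of_real (g (sine_map L x)))"
  using assms
proof induction
  case (linear f)
  then interpret bounded_linear f .
  have eq: "(\<lambda>x. complex_of_real (f (sine_map L x)))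
      = (\<lambda>x. \<Sum>b\<in>Basis. (complex_of_real L * of_real (f b)) * of_real (sin (((1 / L) *\<^sub>R b) \<bullet> x)))"
    by (auto simp: fun_eq_iff sine_map_def sum scale inner_commute mult_ac)
  show ?case
    unfolding eq by (intro trig_polynomial_sum trig_polynomial_sin) auto
next
  case (const c)
  show ?case by (rule trig_polynomial_const)
qed (auto intro: trig_polynomial.trig_add trig_polynomial_mult)

lemma norm_sine_map_le: "norm (sine_map L (x::'b::euclidean_space)) \<le> \<bar>L\<bar> * DIM('b)"
proof -
  have "norm (sine_map L x) \<le> (\<Sum>b\<in>(Basis::'b set). \<bar>L\<bar>)"
    unfolding sine_map_def
    by (intro order_trans[OF norm_sum] sum_mono)
       (auto simp: abs_mult intro!: mult_left_le)
  then show ?thesis by (simp add: mult.commute)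
qed

lemma norm_sine_map_diff_le:
  fixes x :: "'b::euclidean_space"
  assumes "L > 0"
  shows "norm (sine_map L x - x) \<le> DIM('b) * (norm x)\<^sup>2 / L"
proof -
  have *: "\<bar>L * sin (y / L) - y\<bar> \<le> y\<^sup>2 / L" for y
  proof -
    have "\<bar>sin (y / L) - y / L\<bar> \<le> (y / L)\<^sup>2 / 2"
      using Maclaurin_sin_bound[of "y / L" 2] by (simp add: sin_coeff_def numeral_2_eq_2)
    also have "\<dots> \<le> (y / L)\<^sup>2" by simp
    finally have "L * \<bar>sin (y / L) - y / L\<bar> \<le> L * (y / L)\<^sup>2"
      using assms by (intro mult_left_mono) auto
    moreover have "L * \<bar>sin (y / L) - y / L\<bar> = \<bar>L * sin (y / L) - y\<bar>"
    proof -
      have "L * \<bar>sin (y / L) - y / L\<bar> = \<bar>L * (sin (y / L) - y / L)\<bar>"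
        using assms by (simp add: abs_mult)
      then show ?thesis
        using assms by (simp add: right_diff_distrib)
    qed
    ultimately show ?thesis
      using assms by (simp add: power2_eq_square field_simps)
  qed
  have "sine_map L x - x = (\<Sum>b\<in>Basis. (L * sin (x \<bullet> b / L) - x \<bullet> b) *\<^sub>R b)"
    unfolding sine_map_def
    by (subst (4) euclidean_representation[symmetric])
       (simp add: sum_subtractf[symmetric] scaleR_diff_left)
  also have "norm \<dots> \<le> (\<Sum>b\<in>(Basis::'b set). (norm x)\<^sup>2 / L)"
  proof (intro order_trans[OF norm_sum] sum_mono)
    fix b :: 'b assume b: "b \<in> Basis"
    have "\<bar>x \<bullet> b\<bar>\<^sup>2 \<le> (norm x)\<^sup>2"
      using b Basis_le_norm by (intro power_mono) auto
    then show "norm ((L * sin (x \<bullet> b / L) - x \<bullet> b) *\<^sub>R b) \<le> (norm x)\<^sup>2 / L"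
      using *[of "x \<bullet> b"] b assms by (simp add: divide_right_mono order_trans[OF *])
  qed
  finally show ?thesis by simp
qed

text \<open>
  By the Stone-Weierstrass theorem \<open>f\<close> is close to a polynomial \<open>g\<close> on the bounded range of the
  sine map, so \<open>g\<close> composed with the sine map is close to \<open>f\<close> composed with it, everywhere. The latter function has
  the bounds of \<open>f\<close> and, by uniform continuity, is close to \<open>f\<close> on the given ball.
\<close>

lemma trig_polynomial_approximation:
  fixes f :: "'b::euclidean_space \<Rightarrow> real"
  assumes f: "continuous_on UNIV f" and C: "\<And>x. \<bar>f x\<bar> \<le> C" and "K > 0" "e > 0"
  obtains p where "trig_polynomial (\<lambda>x. complex_of_real (p x))"
    and "\<And>x. \<bar>p x\<bar> \<le> C + e" and "\<And>x. norm x \<le> K \<Longrightarrow> \<bar>f x - p x\<bar> \<le> e"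
proof -
  have "uniformly_continuous_on (cball 0 (K + 1)) f"
    using f by (intro compact_uniformly_continuous continuous_on_subset[OF f]) auto
  then obtain d where d: "d > 0"
    "\<And>x y. x \<in> cball 0 (K + 1) \<Longrightarrow> y \<in> cball 0 (K + 1) \<Longrightarrow> dist y x < d \<Longrightarrow> dist (f y) (f x) < e / 2"
    unfolding uniformly_continuous_on_def using \<open>e > 0\<close> half_gt_zero by metis
  \<comment> \<open>large enough that the sine map moves points of the ball of radius \<open>K\<close> by less than \<open>min 1 d\<close>\<close>
  define L where "L = DIM('b) * K\<^sup>2 * (1 + 2 / d)"
  have L: "L > 0" "DIM('b) * K\<^sup>2 / L < d" "DIM('b) * K\<^sup>2 / L \<le> 1"
    using \<open>K > 0\<close> \<open>d > 0\<close> by (auto simp: L_def field_simps add_pos_pos)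
  have "continuous_on (cball 0 (L * DIM('b))) f" by (rule continuous_on_subset[OF f]) auto
  then obtain g where g: "real_polynomial_function g"
    "\<And>y. y \<in> cball 0 (L * DIM('b)) \<Longrightarrow> \<bar>f y - g y\<bar> < e / 2"
    using Stone_Weierstrass_real_polynomial_function[of "cball 0 (L * DIM('b))" f "e / 2"] \<open>e > 0\<close>
    by auto
  define p where "p = (\<lambda>x. g (sine_map L x))"
  have gp: "\<bar>f (sine_map L x) - p x\<bar> < e / 2" for x
    unfolding p_def using norm_sine_map_le[of L x] L(1) by (intro g) auto
  show ?thesis
  proof
    show "trig_polynomial (\<lambda>x. complex_of_real (p x))"
      unfolding p_def by (intro trig_polynomial_sine_map g)
    show "\<bar>p x\<bar> \<le> C + e" for x
      using gp[of x] C[of "sine_map L x"] \<open>e > 0\<close> by linarith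
    show "\<bar>f x - p x\<bar> \<le> e" if x: "norm x \<le> K" for x
    proof -
      have "norm (sine_map L x - x) \<le> DIM('b) * (norm x)\<^sup>2 / L"
        by (rule norm_sine_map_diff_le[OF L(1)])
      also have "\<dots> \<le> DIM('b) * K\<^sup>2 / L"
        using L(1) x by (intro divide_right_mono mult_left_mono power_mono) auto
      finally have n: "norm (sine_map L x - x) \<le> DIM('b) * K\<^sup>2 / L" .
      have "norm (sine_map L x) \<le> norm x + norm (sine_map L x - x)"
        using norm_triangle_sub by blast
      then have "dist (f (sine_map L x)) (f x) < e / 2"
        using n L(2,3) x \<open>K > 0\<close> by (intro d) (auto simp: dist_norm)
      then show ?thesis
        using gp[of x] unfolding dist_real_def by linarith
    qed
  qed
qed

lemma integrable_trig_polynomial: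
  fixes N :: "'b::euclidean_space measure"
  assumes "prob_space N" and [measurable_cong]: "sets N = sets borel" and "trig_polynomial F"
  shows "integrable N F"
  using assms(3)
proof induction
  interpret prob_space N by fact
  case (trig_monom c t)
  have "integrable N (\<lambda>x. iexp (t \<bullet> x))"
    by (intro integrable_iexp) auto
  then show ?case by simp
qed auto

text \<open>
  The bound on the first moments gives tightness: by Markov's inequality the region outside a large ball,
  where a trigonometric polynomial need not be close to \<open>f\<close>, contributes little, uniformly in \<open>n\<close>.
\<close>

theorem weakly_converges_if_char_converges:
  fixes P :: "nat \<Rightarrow> 'b::euclidean_space measure"
  assumes P: "\<And>n. prob_space (P n)" and sP: "\<And>n. sets (P n) = sets borel"
    and N: "prob_space N" and sN: "sets N = sets borel"
    and mP: "\<And>n. integrable (P n) norm" "\<And>n. (\<integral>x. norm x \<partial>P n) \<le> B"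
    and mN: "integrable N norm" "(\<integral>x. norm x \<partial>N) \<le> B"
    and char: "\<And>t. (\<lambda>n. CLINT x|P n. iexp (t \<bullet> x)) \<longlonglongrightarrow> (CLINT x|N. iexp (t \<bullet> x))"
  shows "weakly_converges P N"
  unfolding weakly_converges_def
proof (intro allI impI)
  fix f :: "'b \<Rightarrow> real"
  assume f: "continuous_on UNIV f" and bf: "bounded (range f)"
  have trig: "(\<lambda>n. CLINT x|P n. F x) \<longlonglongrightarrow> (CLINT x|N. F x)" if "trig_polynomial F" for F
    using that
  proof induction
    case (trig_monom c t)
    show ?case using tendsto_mult_left[OF char[of t], of c] by simp
  next
    case (trig_add F G)
    then show ?case
      using integrable_trig_polynomial[OF P sP] integrable_trig_polynomial[OF N sN]
      by (auto intro!: tendsto_add simp: Bochner_Integration.integral_add)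
  qed
  obtain C where C: "\<And>x. \<bar>f x\<bar> \<le> C" using bf by (auto simp: bounded_iff)
  have "C \<ge> 0" using C[of 0] by linarith
  have fb: "f \<in> borel_measurable borel" by (rule borel_measurable_continuous_onI[OF f])
  have "0 \<le> (\<integral>x. norm x \<partial>N)" by simp
  with mN(2) have "B \<ge> 0" by linarith
  show "(\<lambda>n. \<integral>x. f x \<partial>P n) \<longlonglongrightarrow> (\<integral>x. f x \<partial>N)"
  proof (rule tendstoI)
    fix e0 :: real assume "e0 > 0"
    define e where "e = e0 / 6"
    \<comment> \<open>chosen so that the contribution from outside the ball of radius \<open>K\<close> is at most \<open>e\<close>\<close>
    define K where "K = (2 * C + e) * (B + 1) / e"
    have "e > 0" using \<open>e0 > 0\<close> by (simp add: e_def)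
    have "K > 0" unfolding K_def using \<open>e > 0\<close> \<open>C \<ge> 0\<close> \<open>B \<ge> 0\<close> by (simp add: add_nonneg_pos)
    obtain p where p: "trig_polynomial (\<lambda>x. complex_of_real (p x))"
      "\<And>x. \<bar>p x\<bar> \<le> C + e" "\<And>x. norm x \<le> K \<Longrightarrow> \<bar>f x - p x\<bar> \<le> e"
      using trig_polynomial_approximation[OF f C \<open>K > 0\<close> \<open>e > 0\<close>] by metis
    have close: "\<bar>(\<integral>x. f x \<partial>Q) - (\<integral>x. p x \<partial>Q)\<bar> \<le> 2 * e"
      if Q: "prob_space Q" and sQ: "sets Q = sets borel"
        and mQ: "integrable Q norm" "(\<integral>x. norm x \<partial>Q) \<le> B" for Q
    proof -
      interpret prob_space Q by fact
      have [measurable_cong]: "sets Q = sets borel" by fact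
      have ip: "integrable Q p"
        using integrable_trig_polynomial[OF Q sQ p(1)] by (simp add: complex_of_real_integrable_eq)
      have "f \<in> borel_measurable Q" using fb sQ by (simp cong: measurable_cong_sets)
      then have if': "integrable Q f" using C by (intro integrable_const_bound[of _ C]) auto
      have pt: "\<bar>f x - p x\<bar> \<le> e + (2 * C + e) / K * norm x" for x
      proof (cases "norm x \<le> K")
        case True
        then show ?thesis using p(3)[OF True] \<open>K > 0\<close> \<open>e > 0\<close> \<open>C \<ge> 0\<close>
          by (smt (verit) divide_nonneg_pos mult_nonneg_nonneg norm_ge_zero)
      next
        case False
        have "2 * C + e \<le> (2 * C + e) / K * norm x"
          using False \<open>K > 0\<close> \<open>e > 0\<close> \<open>C \<ge> 0\<close> by (simp add: pos_le_divide_eq mult_left_mono)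
        then show ?thesis using C[of x] p(2)[of x] \<open>e > 0\<close> by linarith
      qed
      have "\<bar>(\<integral>x. f x \<partial>Q) - (\<integral>x. p x \<partial>Q)\<bar> = \<bar>\<integral>x. f x - p x \<partial>Q\<bar>"
        using ip if' by simp
      also have "\<dots> \<le> (\<integral>x. \<bar>f x - p x\<bar> \<partial>Q)" by (rule integral_abs_bound)
      also have "\<dots> \<le> (\<integral>x. e + (2 * C + e) / K * norm x \<partial>Q)"
        using ip if' mQ pt by (intro integral_mono) auto
      also have "\<dots> = e + (2 * C + e) / K * (\<integral>x. norm x \<partial>Q)"
        using mQ by (simp add: prob_space)
      also have "\<dots> \<le> e + (2 * C + e) / K * (B + 1)"
        using mQ \<open>K > 0\<close> \<open>e > 0\<close> \<open>C \<ge> 0\<close> by (intro add_left_mono mult_left_mono) auto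
      also have "(2 * C + e) / K * (B + 1) = e"
        unfolding K_def using \<open>e > 0\<close> \<open>C \<ge> 0\<close> \<open>B \<ge> 0\<close>
        by (simp add: divide_simps)
      finally show ?thesis by simp
    qed
    have "(\<lambda>n. \<integral>x. p x \<partial>P n) \<longlonglongrightarrow> (\<integral>x. p x \<partial>N)"
      using trig[OF p(1)] by (simp add: tendsto_of_real_iff)
    then have "\<forall>\<^sub>F n in sequentially. dist (\<integral>x. p x \<partial>P n) (\<integral>x. p x \<partial>N) < e"
      using \<open>e > 0\<close> by (rule tendstoD)
    then show "\<forall>\<^sub>F n in sequentially. dist (\<integral>x. f x \<partial>P n) (\<integral>x. f x \<partial>N) < e0"
    proof eventually_elim
      case (elim n)
      show ?case
        using elim close[OF P sP mP, of n] close[OF N sN mN] \<open>e > 0\<close>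
        unfolding dist_real_def e_def by linarith
    qed
  qed
qed

section \<open>Normal laws with prescribed covariance\<close>

lemma char_normal_real:
  assumes "0 \<le> s"
  shows "(CLINT x|normal_real 0 s. iexp (t * x)) = exp (- (s * t)\<^sup>2 / 2)"
proof (cases "s = 0")
  case True
  then show ?thesis by (simp add: normal_real_def integral_return)
next
  case False
  with assms have s: "s > 0" by simp
  have "(CLINT x|normal_real 0 s. iexp (t * x)) =
      (CLINT x|lborel. normal_density 0 s x *\<^sub>R iexp (t * x))"
    unfolding normal_real_def using False by (simp add: integral_density)
  also have "\<dots> = s *\<^sub>R (CLINT x|lborel. normal_density 0 s (0 + s * x) *\<^sub>R iexp (t * (0 + s * x)))"
    using s by (subst lborel_integral_real_affine[of s _ 0]) auto
  also have "\<dots> = (CLINT x|lborel. s *\<^sub>R (normal_density 0 s (0 + s * x) *\<^sub>R iexp (t * (0 + s * x))))"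
    by (rule integral_scaleR_right[symmetric])
  also have "\<dots> = (CLINT x|lborel. std_normal_density x *\<^sub>R iexp ((s * t) * x))"
    using s by (intro Bochner_Integration.integral_cong refl)
       (simp add: normal_density_def real_sqrt_mult power_mult_distrib mult_ac)
  also have "\<dots> = char std_normal_distribution (s * t)"
    unfolding char_def by (simp add: integral_density)
  also have "\<dots> = exp (- (s * t)\<^sup>2 / 2)"
    by (simp add: char_std_normal_distribution)
  finally show ?thesis .
qed

lemma real_distribution_normal_real: "0 \<le> s \<Longrightarrow> real_distribution (normal_real m s)"
  unfolding normal_real_def real_distribution_def real_distribution_axioms_def
  by (auto intro!: prob_space_return prob_space_normal_density)

lemma normal_real_moments:
  assumes "0 \<le> s"
  shows "integrable (normal_real 0 s) (\<lambda>x. x)" "(\<integral>x. x \<partial>normal_real 0 s) = 0"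
    "integrable (normal_real 0 s) (\<lambda>x. x\<^sup>2)" "(\<integral>x. x\<^sup>2 \<partial>normal_real 0 s) = s\<^sup>2"
proof -
  have "integrable (normal_real 0 s) (\<lambda>x. x) \<and> (\<integral>x. x \<partial>normal_real 0 s) = 0 \<and>
    integrable (normal_real 0 s) (\<lambda>x. x\<^sup>2) \<and> (\<integral>x. x\<^sup>2 \<partial>normal_real 0 s) = s\<^sup>2"
  proof (cases "s = 0")
    case True
    then show ?thesis 
      by (simp add: normal_real_def integral_return integrable_iff_bounded nn_integral_return)
  next
    case False
    with assms have s: "s > 0" by simp
    show ?thesis
      using s False integrable_normal_moment[OF s, of 0 1] integral_normal_moment_odd[OF s, of 0 0]
        integrable_normal_moment[OF s, of 0 2] integral_normal_moment_even[OF s, of 0 1]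
      by (simp add: normal_real_def integrable_density integral_density fact_numeral numeral_2_eq_2
          power2_eq_square)
  qed
  then show "integrable (normal_real 0 s) (\<lambda>x. x)" "(\<integral>x. x \<partial>normal_real 0 s) = 0"
    "integrable (normal_real 0 s) (\<lambda>x. x\<^sup>2)" "(\<integral>x. x\<^sup>2 \<partial>normal_real 0 s) = s\<^sup>2"
    by auto
qed

text \<open>
  The law of \<open>\<Sum>k\<in>I. g\<^sub>k w\<^sub>k\<close> for independent standard normal \<open>g\<^sub>k\<close>. The vectors \<open>w\<^sub>k\<close> may be linearly
  dependent, so degenerate laws are covered.
\<close>

lemma exists_gaussian_char:
  fixes w :: "'i \<Rightarrow> 'b::euclidean_space"
  assumes I: "finite I"
  obtains N :: "'b measure" where "prob_space N" "sets N = sets borel"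
    "\<And>u. (CLINT x|N. iexp (u \<bullet> x)) = exp (- (\<Sum>k\<in>I. (u \<bullet> w k)\<^sup>2) / 2)"
proof -
  define G where "G = (\<lambda>_::'i. std_normal_distribution)"
  interpret G: product_prob_space G I
    unfolding G_def by (intro product_prob_spaceI prob_space_normal_density) auto
  define T where "T = (\<lambda>g. \<Sum>k\<in>I. g k *\<^sub>R w k)"
  have T[measurable]: "T \<in> Pi\<^sub>M I G \<rightarrow>\<^sub>M borel"
  proof -
    have "(\<lambda>g. g k) \<in> borel_measurable (Pi\<^sub>M I G)" if "k \<in> I" for k
      using measurable_component_singleton[OF that, of G] by (simp add: G_def cong: measurable_cong_sets)
    then show ?thesis
      unfolding T_def by (intro borel_measurable_sum borel_measurable_scaleR) auto
  qed
  define N where "N = distr (Pi\<^sub>M I G) borel T"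
  have "prob_space N" unfolding N_def by (rule G.prob_space_distr) auto
  moreover have "sets N = sets borel" by (simp add: N_def)
  moreover have "(CLINT x|N. iexp (u \<bullet> x)) = exp (- (\<Sum>k\<in>I. (u \<bullet> w k)\<^sup>2) / 2)" for u
  proof -
    have "(CLINT x|N. iexp (u \<bullet> x)) = (CLINT g|Pi\<^sub>M I G. (\<Prod>k\<in>I. iexp ((u \<bullet> w k) * g k)))"
      unfolding N_def
      by (subst integral_distr[OF T])
         (auto simp: T_def inner_sum_right sum_distrib_left exp_sum[OF I] mult_ac)
    also have "\<dots> = (\<Prod>k\<in>I. char std_normal_distribution (u \<bullet> w k))"
      unfolding char_def using I
      by (subst G.product_integral_prod)
         (auto simp: G_def intro!: prob_space.integrable_iexp prob_space_normal_density)
    also have "\<dots> = (\<Prod>k\<in>I. complex_of_real (exp (- (u \<bullet> w k)\<^sup>2 / 2)))"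
      by (simp add: char_std_normal_distribution)
    also have "\<dots> = complex_of_real (exp (\<Sum>k\<in>I. - (u \<bullet> w k)\<^sup>2 / 2))"
      using I by (simp add: exp_sum)
    finally show ?thesis
      by (simp add: sum_negf sum_divide_distrib exp_of_real[symmetric] del: exp_of_real)
  qed
  ultimately show thesis by (rule that)
qed

lemma inner_distr_normal_real:
  fixes N :: "'b::euclidean_space measure"
  assumes "prob_space N" "sets N = sets borel" "0 \<le> q"
    and "\<And>s. (CLINT x|N. iexp ((s *\<^sub>R u) \<bullet> x)) = exp (- (s\<^sup>2 * q) / 2)"
  shows "distr N borel (\<lambda>x. u \<bullet> x) = normal_real 0 (sqrt q)"
proof -
  interpret N: prob_space N by fact
  have [measurable_cong]: "sets N = sets borel" by fact
  have *: "real_distribution (distr N borel (\<lambda>x. u \<bullet> x))"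
    by (intro N.real_distribution_distr) simp
  show ?thesis
  proof (rule Levy_uniqueness[OF * real_distribution_normal_real])
    show "char (distr N borel (\<lambda>x. u \<bullet> x)) = char (normal_real 0 (sqrt q))"
    proof
      fix s
      have "char (distr N borel (\<lambda>x. u \<bullet> x)) s = (CLINT x|N. iexp ((s *\<^sub>R u) \<bullet> x))"
        unfolding char_def by (subst integral_distr) auto
      also have "\<dots> = exp (- (sqrt q * s)\<^sup>2 / 2)"
        using assms(3,4) by (simp add: power_mult_distrib mult.commute)
      finally show "char (distr N borel (\<lambda>x. u \<bullet> x)) s = char (normal_real 0 (sqrt q)) s"
        using char_normal_real[of "sqrt q" s] assms(3) by (simp add: char_def)
    qed
  qed (use assms(3) in auto)
qed

text \<open>
  Every one-dimensional projection is identified by its characteristic function; its first two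
  moments are those of a real normal law, and the mixed moments follow by polarisation.
\<close>

lemma exists_centered_normal:
  fixes S :: "real^'m^'m" and w :: "'i \<Rightarrow> real^'m"
  assumes I: "finite I" and S: "\<And>i j. S $ i $ j = (\<Sum>k\<in>I. w k $ i * w k $ j)"
  obtains N where "prob_space N" "centered_normal N S"
    "\<And>u. (CLINT x|N. iexp (u \<bullet> x)) = exp (- (\<Sum>k\<in>I. (u \<bullet> w k)\<^sup>2) / 2)"
    "integrable N norm"
proof -
  obtain N where N: "prob_space N" and sN: "sets N = sets borel" and
    char: "\<And>u. (CLINT x|N. iexp (u \<bullet> x)) = exp (- (\<Sum>k\<in>I. (u \<bullet> w k)\<^sup>2) / 2)"
    using exists_gaussian_char[OF I, of w] by metis
  interpret N: prob_space N by fact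
  have [measurable_cong]: "sets N = sets borel" by fact
  define q where "q u = (\<Sum>k\<in>I. (u \<bullet> w k)\<^sup>2)" for u
  have q0: "q u \<ge> 0" for u by (simp add: q_def sum_nonneg)
  have law: "distr N borel (\<lambda>x. u \<bullet> x) = normal_real 0 (sqrt (q u))" for u
    by (rule inner_distr_normal_real[OF N sN q0])
       (subst char, simp add: q_def power_mult_distrib sum_distrib_left)
  have int1: "integrable N (\<lambda>x. u \<bullet> x)" and m1: "(\<integral>x. u \<bullet> x \<partial>N) = 0"
    and int2: "integrable N (\<lambda>x. (u \<bullet> x)\<^sup>2)" and m2: "(\<integral>x. (u \<bullet> x)\<^sup>2 \<partial>N) = q u" for u
  proof -
    have "integrable (distr N borel (\<lambda>x. u \<bullet> x)) (\<lambda>y. y)"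
      "integrable (distr N borel (\<lambda>x. u \<bullet> x)) (\<lambda>y. y\<^sup>2)"
      using normal_real_moments[of "sqrt (q u)"] q0 by (simp_all add: law)
    then show "integrable N (\<lambda>x. u \<bullet> x)" "integrable N (\<lambda>x. (u \<bullet> x)\<^sup>2)"
      by (simp_all add: integrable_distr_eq)
    have "(\<integral>y. y \<partial>distr N borel (\<lambda>x. u \<bullet> x)) = 0"
      "(\<integral>y. y\<^sup>2 \<partial>distr N borel (\<lambda>x. u \<bullet> x)) = q u"
      using normal_real_moments[of "sqrt (q u)"] q0 by (simp_all add: law)
    then show "(\<integral>x. u \<bullet> x \<partial>N) = 0" "(\<integral>x. (u \<bullet> x)\<^sup>2 \<partial>N) = q u"
      by (simp_all add: integral_distr)
  qed
  have coord: "x $ i = axis i 1 \<bullet> x" for x :: "real^'m" and i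
    by (simp add: inner_axis')
  show thesis
  proof
    show "prob_space N" by fact
    show "(CLINT x|N. iexp (u \<bullet> x)) = exp (- (\<Sum>k\<in>I. (u \<bullet> w k)\<^sup>2) / 2)" for u by (rule char)
    have "integrable N (\<lambda>x. \<Sum>b\<in>Basis. \<bar>b \<bullet> x\<bar>)"
      using int1 by auto
    then show "integrable N norm"
      by (rule Bochner_Integration.integrable_bound)
         (auto intro!: AE_I2 order_trans[OF norm_le_l1] simp: inner_commute)
    show "centered_normal N S"
      unfolding centered_normal_def gaussian_def
    proof (intro conjI allI)
      show "sets N = sets borel" by fact
      show "\<exists>\<mu> \<sigma>. 0 \<le> \<sigma> \<and> distr N borel (\<lambda>x. u \<bullet> x) = normal_real \<mu> \<sigma>" for u
        using law[of u] q0[of u] by (intro exI[of _ 0] exI[of _ "sqrt (q u)"]) auto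
      show "(\<integral>x. x $ i \<partial>N) = 0" for i
        using m1[of "axis i 1"] by (simp add: coord)
      show "(\<integral>x. x $ i * x $ j \<partial>N) = S $ i $ j" for i j
      proof -
        \<comment> \<open>polarisation: \<open>4 x y = (x + y)\<^sup>2 - (x - y)\<^sup>2\<close>\<close>
        let ?a = "axis i 1 + axis j 1 :: real^'m" and ?b = "axis i 1 - axis j 1 :: real^'m"
        have "(\<integral>x. x $ i * x $ j \<partial>N) = (\<integral>x. ((?a \<bullet> x)\<^sup>2 - (?b \<bullet> x)\<^sup>2) / 4 \<partial>N)"
          by (intro Bochner_Integration.integral_cong refl)
             (simp add: coord inner_add_left inner_diff_left power2_eq_square algebra_simps)
        also have "\<dots> = (q ?a - q ?b) / 4"
          using int2 m2 by simp
        also have "\<dots> = S $ i $ j"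
          unfolding S q_def
          by (simp add: sum_subtractf[symmetric] sum_divide_distrib inner_add_left inner_diff_left
              coord[symmetric] power2_eq_square algebra_simps)
        finally show ?thesis .
      qed
    qed
  qed
qed

text \<open>
  A symmetric matrix maps into the orthogonal complement of its kernel and is injective there. Here the complement is
  the hyperplane orthogonal to the all-ones vector.
\<close>

lemma rank_eq_card_minus_1:
  fixes S :: "real^'m^'m"
  assumes sym: "\<And>i j. S $ i $ j = S $ j $ i"
    and ker: "\<And>x. S *v x = 0 \<longleftrightarrow> (\<exists>c. x = (\<chi> i. c))"
  shows "rank S = CARD('m) - 1"
proof -
  define e :: "real^'m" where "e = (\<chi> i. 1)"
  have e0: "e \<noteq> 0" by (simp add: e_def vec_eq_iff)
  define H where "H = {x. e \<bullet> x = 0}"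
  have dimH: "dim H = CARD('m) - 1"
    unfolding H_def using dim_hyperplane[OF e0] by simp
  have Se: "S *v e = 0" using ker by (auto simp: e_def)
  have "transpose S = S" by (simp add: transpose_def vec_eq_iff sym)
  then have range: "S *v x \<in> H" for x
    using Se by (simp add: H_def dot_lmul_matrix[symmetric] transpose_matrix_vector[symmetric])
  have "subspace H" unfolding H_def by (rule subspace_hyperplane)
  have "inj_on ((*v) S) H"
  proof (rule inj_onI)
    fix x y assume "x \<in> H" "y \<in> H" "S *v x = S *v y"
    then have d: "x - y \<in> H" "S *v (x - y) = 0"
      using subspace_diff[OF \<open>subspace H\<close>] by (auto simp: matrix_vector_mult_diff_distrib)
    then obtain c where "x - y = (\<chi> i. c)" using ker by auto
    then have "x - y = c *\<^sub>R e" by (simp add: e_def vec_eq_iff)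
    then show "x = y" using d(1) e0 by (simp add: H_def)
  qed
  then have "dim ((*v) S ` H) = dim H"
    using \<open>subspace H\<close> by (intro dim_image_eq) (auto simp: span_eq_iff[THEN iffD2])
  moreover have "dim ((*v) S ` H) \<le> dim (range ((*v) S))" by (intro dim_subset) auto
  moreover have "dim (range ((*v) S)) \<le> dim H" using range by (intro dim_subset) auto
  ultimately show ?thesis unfolding rank_dim_range dimH by linarith
qed

section \<open>Characteristic functions of martingale sums\<close>

lemma exp_minus_linear_bound:
  fixes y :: real assumes "0 \<le> y" shows "\<bar>exp (- y) - (1 - y)\<bar> \<le> y\<^sup>2"
proof -
  have "1 + y \<le> exp y" by (rule exp_ge_add_one_self)
  then have "exp (- y) \<le> 1 / (1 + y)"
    using assms by (simp add: exp_minus field_simps)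
  also have "\<dots> \<le> 1 - y + y\<^sup>2"
  proof -
    have "1 \<le> (1 - y + y\<^sup>2) * (1 + y)"
      using assms by (simp add: algebra_simps power2_eq_square)
    then show ?thesis using assms by (simp add: divide_le_eq)
  qed
  finally show ?thesis using exp_ge_add_one_self[of "- y"] by linarith
qed

text \<open>
  Conditioning on the past, the factor contributed by one increment is \<open>1 - v\<^sub>i / 2\<close> up to the errors on the
  right-hand side, and \<open>1 - v\<^sub>i / 2\<close> is \<open>exp (- v\<^sub>i / 2)\<close> up to an error of order \<open>v\<^sub>i\<^sup>2\<close>. The
  errors add up because all factors have modulus at most 1. The martingale property and
  the conditional variances enter only through expectations against \<open>exp (\<i> S\<^sub>i)\<close>.
\<close>

lemma (in prob_space) char_martingale_sum:
  fixes D :: "nat \<Rightarrow> 'a \<Rightarrow> real" and v e B :: "nat \<Rightarrow> real"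
  defines "S \<equiv> (\<lambda>i x. \<Sum>j<i. D j x)"
  assumes [measurable]: "\<And>i. D i \<in> borel_measurable M"
    and B: "\<And>i x. \<bar>D i x\<bar> \<le> B i" and v: "\<And>i. 0 \<le> v i"
    and mean: "\<And>i. (CLINT x|M. iexp (S i x) * D i x) = 0"
    and var: "\<And>i. cmod (CLINT x|M. iexp (S i x) * ((D i x)\<^sup>2 - v i)) \<le> e i"
  shows "cmod ((CLINT x|M. iexp (S N x)) - exp (- (\<Sum>i<N. v i) / 2))
    \<le> (\<Sum>i<N. e i / 2 + (\<integral>x. \<bar>D i x\<bar> ^ 3 \<partial>M) / 6 + (v i)\<^sup>2 / 4)"
proof (induction N)
  case 0
  then show ?case by (simp add: S_def prob_space)
next
  case (Suc N)
  have [measurable]: "S i \<in> borel_measurable M" for i unfolding S_def by measurable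
  let ?\<phi> = "\<lambda>i. CLINT x|M. iexp (S i x)"
  let ?r = "\<lambda>x. iexp (D N x) - (1 + \<i> * D N x - (D N x)\<^sup>2 / 2)"
  let ?V = "CLINT x|M. iexp (S N x) * (complex_of_real ((D N x)\<^sup>2) - v N)"
  let ?R = "CLINT x|M. iexp (S N x) * ?r x"
  have r: "cmod (?r x) \<le> \<bar>D N x\<bar> ^ 3 / 6" for x
    using iexp_approx1[of "D N x" 2]
    by (simp add: numeral_2_eq_2 numeral_3_eq_3 fact_numeral power2_eq_square algebra_simps)
  have bnd3: "\<bar>D N x\<bar> ^ 3 \<le> B N ^ 3" for x using B by (intro power_mono) auto
  have int3: "integrable M (\<lambda>x. \<bar>D N x\<bar> ^ 3)"
    using bnd3 by (intro integrable_const_bound[of _ "B N ^ 3"]) auto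
  have intD: "integrable M (\<lambda>x. iexp (S N x) * D N x)"
    using B by (intro integrable_const_bound[of _ "B N"]) (auto simp: norm_mult)
  have bnd2: "cmod (complex_of_real ((D N x)\<^sup>2) - complex_of_real (v N)) \<le> (B N)\<^sup>2 + v N" for x
  proof -
    have "\<bar>D N x\<bar>\<^sup>2 \<le> (B N)\<^sup>2" using B by (intro power_mono) auto
    then have "\<bar>(D N x)\<^sup>2 - v N\<bar> \<le> (B N)\<^sup>2 + v N"
      using v[of N] by (auto simp: abs_le_iff)
    then show ?thesis by (metis norm_of_real of_real_diff)
  qed
  have intV: "integrable M (\<lambda>x. iexp (S N x) * (complex_of_real ((D N x)\<^sup>2) - v N))"
    using bnd2 by (intro integrable_const_bound[of _ "(B N)\<^sup>2 + v N"]) (auto simp: norm_mult)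
  have intR: "integrable M (\<lambda>x. iexp (S N x) * ?r x)"
  proof (rule integrable_const_bound[of _ "B N ^ 3 / 6"])
    have "cmod (iexp (S N x) * ?r x) \<le> B N ^ 3 / 6" for x
      unfolding norm_mult using order_trans[OF r[of x] divide_right_mono[OF bnd3[of x]]] by simp
    then show "AE x in M. cmod (iexp (S N x) * ?r x) \<le> B N ^ 3 / 6" by blast
    show "(\<lambda>x. iexp (S N x) * ?r x) \<in> borel_measurable M" by simp
  qed
  have intS: "integrable M (\<lambda>x. iexp (S N x))" by (intro integrable_iexp) auto
  have "?\<phi> (Suc N) = (CLINT x|M. iexp (S N x) * iexp (D N x))"
    by (simp add: S_def ring_distribs exp_add)
  also have "\<dots> = (CLINT x|M. (1 - v N / 2) * iexp (S N x) + \<i> * (iexp (S N x) * D N x)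
     - (iexp (S N x) * (complex_of_real ((D N x)\<^sup>2) - v N)) / 2 + iexp (S N x) * ?r x)"
  proof -
    have alg: "s * z = (1 - w / 2) * s + \<i> * (s * d) - (s * (d2 - w)) / 2 + s * (z - (1 + \<i> * d - d2 / 2))"
      for s z w d d2 :: complex
      by (simp add: field_simps)
    show ?thesis
      by (intro Bochner_Integration.integral_cong refl)
        (simp only: of_real_diff of_real_divide of_real_1 of_real_numeral, rule alg)
  qed
  also have "\<dots> = (1 - v N / 2) * ?\<phi> N + \<i> * (CLINT x|M. iexp (S N x) * D N x)
     - ?V / 2 + ?R"
    using intD intV intR intS
    by (simp only: Bochner_Integration.integral_add Bochner_Integration.integral_diff
        integral_mult_right_zero integral_divide_zero
      Bochner_Integration.integrable_add Bochner_Integration.integrable_diff integrable_mult_right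
          integrable_divide)
  finally have step: "?\<phi> (Suc N) = (1 - v N / 2) * ?\<phi> N
     - ?V / 2 + ?R"
    using mean[of N] by simp
  have phi1: "cmod (?\<phi> N) \<le> 1"
    by (rule order_trans[OF integral_norm_bound]) (simp add: prob_space)
  have e1: "cmod (?V / 2) \<le> e N / 2"
    using var[of N] by (simp add: norm_divide)
  have e2: "cmod ?R \<le> (\<integral>x. \<bar>D N x\<bar> ^ 3 \<partial>M) / 6"
  proof -
    have "cmod ?R \<le> (\<integral>x. cmod (iexp (S N x) * ?r x) \<partial>M)"
      by (rule integral_norm_bound)
    also have "\<dots> \<le> (\<integral>x. \<bar>D N x\<bar> ^ 3 / 6 \<partial>M)"
    proof (rule integral_mono)
      show "integrable M (\<lambda>x. cmod (iexp (S N x) * ?r x))" by (rule integrable_norm[OF intR])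
      show "integrable M (\<lambda>x. \<bar>D N x\<bar> ^ 3 / 6)" using int3 by simp
      show "cmod (iexp (S N x) * ?r x) \<le> \<bar>D N x\<bar> ^ 3 / 6" for x
        using r[of x] by (simp only: norm_mult norm_exp_i_times mult_1)
    qed
    finally show ?thesis by simp
  qed
  have e3: "cmod (complex_of_real (1 - v N / 2 - exp (- v N / 2)) * ?\<phi> N) \<le> (v N)\<^sup>2 / 4"
  proof -
    have "\<bar>1 - v N / 2 - exp (- v N / 2)\<bar> \<le> (v N)\<^sup>2 / 4"
      using exp_minus_linear_bound[of "v N / 2"] v[of N] by (simp add: power_divide abs_minus_commute)
    then show ?thesis using phi1  using mult_mono'[OF _ phi1, of "\<bar>1 - v N / 2
        - exp (- v N / 2)\<bar>" "(v N)\<^sup>2 / 4"]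
      by (simp only: norm_mult norm_of_real) simp
  qed
  let ?E = "complex_of_real (exp (- (\<Sum>i<N. v i) / 2))"
  have e4: "cmod (complex_of_real (exp (- v N / 2)) * (?\<phi> N - ?E)) \<le> cmod (?\<phi> N - ?E)"
    unfolding norm_mult norm_of_real using v[of N] by (intro mult_left_le_one_le) auto
  have E: "complex_of_real (exp (- (\<Sum>i<Suc N. v i) / 2)) = complex_of_real (exp (- v N / 2)) * ?E"
  proof -
    have "- (\<Sum>i<Suc N. v i) / 2 = - v N / 2 + - (\<Sum>i<N. v i) / 2"
    proof -
      have "- (a + b) / 2 = - b / 2 + - a / 2" for a b :: real by (simp add: field_simps)
      then show ?thesis unfolding sum.lessThan_Suc .
    qed
    then show ?thesis unfolding of_real_mult[symmetric] exp_add[symmetric] by (rule arg_cong)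
  qed
  have dec: "?\<phi> (Suc N) - exp (- (\<Sum>i<Suc N. v i) / 2) =
     complex_of_real (1 - v N / 2 - exp (- v N / 2)) * ?\<phi> N
     + complex_of_real (exp (- v N / 2)) * (?\<phi> N - ?E)
     - ?V / 2 + ?R"
  proof -
    have alg: "a * p - V + R - w * E = (a - w) * p + w * (p - E) - V + R" for a p V R w E :: complex
      by (simp add: algebra_simps)
    show ?thesis unfolding step E of_real_diff[of "1 - v N / 2"] by (rule alg)
  qed
  have "cmod (?\<phi> (Suc N) - exp (- (\<Sum>i<Suc N. v i) / 2))
      \<le> (v N)\<^sup>2 / 4 + cmod (?\<phi> N - ?E) + e N / 2 + (\<integral>x. \<bar>D N x\<bar> ^ 3 \<partial>M) / 6"
  proof -
    have tri: "cmod (a + b - c + d) \<le> cmod a + cmod b + cmod c + cmod d" for a b c d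
      using norm_triangle_ineq[of "a + b - c" d] norm_triangle_ineq4[of "a
          + b" c] norm_triangle_ineq[of a b]
      by linarith
    show ?thesis
      unfolding dec by (rule order_trans[OF tri]) (intro add_mono e1 e2 e3 e4)
  qed
  also have "\<dots> \<le> (\<Sum>i<Suc N. e i / 2 + (\<integral>x. \<bar>D i x\<bar> ^ 3 \<partial>M) / 6 + (v i)\<^sup>2 / 4)"
    unfolding sum.lessThan_Suc using Suc by linarith
  finally show ?case .
qed

lemma (in prob_space) orthogonal_sum_second_moment:
  fixes D :: "nat \<Rightarrow> 'a \<Rightarrow> 'b::euclidean_space"
  defines "S \<equiv> (\<lambda>i x. \<Sum>j<i. D j x)"
  assumes [measurable]: "\<And>i. D i \<in> borel_measurable M"
    and B: "\<And>i x. norm (D i x) \<le> B i"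
    and orth: "\<And>i. (\<integral>x. S i x \<bullet> D i x \<partial>M) = 0"
  shows "(\<integral>x. (norm (S N x))\<^sup>2 \<partial>M) = (\<Sum>i<N. \<integral>x. (norm (D i x))\<^sup>2 \<partial>M)"
proof (induction N)
  case 0
  then show ?case by (simp add: S_def)
next
  case (Suc N)
  have [measurable]: "S i \<in> borel_measurable M" for i unfolding S_def by measurable
  have BS: "norm (S N x) \<le> (\<Sum>i<N. B i)" for x
    unfolding S_def by (intro sum_norm_le B)
  have i1: "integrable M (\<lambda>x. (norm (S N x))\<^sup>2)"
    using BS by (intro integrable_const_bound[of _ "(\<Sum>i<N. B i)\<^sup>2"]) (auto intro!: AE_I2 power_mono)
  have i2: "integrable M (\<lambda>x. (norm (D N x))\<^sup>2)"
    using B by (intro integrable_const_bound[of _ "(B N)\<^sup>2"]) (auto intro!: AE_I2 power_mono)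
  have "\<bar>S N x \<bullet> D N x\<bar> \<le> (\<Sum>i<N. B i) * B N" for x
    by (rule order_trans[OF Cauchy_Schwarz_ineq2 mult_mono'[OF BS B]]) auto
  then have i3: "integrable M (\<lambda>x. S N x \<bullet> D N x)"
    by (intro integrable_const_bound[of _ "(\<Sum>i<N. B i) * B N"]) auto
  have "(\<integral>x. (norm (S (Suc N) x))\<^sup>2 \<partial>M)
      = (\<integral>x. (norm (S N x))\<^sup>2 + 2 * (S N x \<bullet> D N x) + (norm (D N x))\<^sup>2 \<partial>M)"
    by (intro Bochner_Integration.integral_cong refl)
       (simp add: S_def power2_norm_eq_inner inner_add_left inner_add_right inner_commute)
  also have "\<dots> = (\<integral>x. (norm (S N x))\<^sup>2 \<partial>M) + (\<integral>x. (norm (D N x))\<^sup>2 \<partial>M)"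
    using i1 i2 i3 orth[of N] by simp
  finally show ?case using Suc by simp
qed

lemma (in prob_space) expectation_squared_le:
  fixes X :: "'a \<Rightarrow> real"
  assumes "integrable M X" "integrable M (\<lambda>x. (X x)\<^sup>2)"
  shows "(expectation X)\<^sup>2 \<le> expectation (\<lambda>x. (X x)\<^sup>2)"
  using variance_eq[OF assms] variance_positive[of X] by simp

lemma iexp_diff_le: "cmod (iexp a - iexp b) \<le> \<bar>a - b\<bar>"
proof -
  have "iexp a - iexp b = iexp b * (iexp (a - b) - 1)"
    by (simp add: right_diff_distrib flip: exp_add)
  then have "cmod (iexp a - iexp b) = cmod (iexp (a - b) - 1)"
    by (simp add: norm_mult)
  then show ?thesis using iexp_approx1[of "a - b" 0] by simp
qed

lemma (in prob_space) char_diff_le: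
  fixes X Y :: "'a \<Rightarrow> real"
  assumes "integrable M X" "integrable M Y"
  shows "cmod ((CLINT x|M. iexp (X x)) - (CLINT x|M. iexp (Y x))) \<le> (\<integral>x. \<bar>X x - Y x\<bar> \<partial>M)"
proof -
  have m: "X \<in> borel_measurable M" "Y \<in> borel_measurable M" using assms by auto
  have i: "integrable M (\<lambda>x. iexp (X x))" "integrable M (\<lambda>x. iexp (Y x))"
    using m by (auto intro!: integrable_iexp)
  then have "(CLINT x|M. iexp (X x)) - (CLINT x|M. iexp (Y x)) = (CLINT x|M. iexp (X x) - iexp (Y x))"
    by (rule Bochner_Integration.integral_diff[symmetric])
  then have "cmod ((CLINT x|M. iexp (X x)) - (CLINT x|M. iexp (Y x)))
      \<le> (\<integral>x. cmod (iexp (X x) - iexp (Y x)) \<partial>M)"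
    by (simp only: integral_norm_bound)
  also have "\<dots> \<le> (\<integral>x. \<bar>X x - Y x\<bar> \<partial>M)"
  proof (rule integral_mono)
    show "integrable M (\<lambda>x. cmod (iexp (X x) - iexp (Y x)))"
      by (rule integrable_norm[OF Bochner_Integration.integrable_diff[OF i]])
    show "integrable M (\<lambda>x. \<bar>X x - Y x\<bar>)"
      by (rule integrable_abs[OF Bochner_Integration.integrable_diff[OF assms]])
    show "cmod (iexp (X x) - iexp (Y x)) \<le> \<bar>X x - Y x\<bar>" for x by (rule iexp_diff_le)
  qed
  finally show ?thesis .
qed

text \<open>
  A subsequence converges almost everywhere; by Fatou's lemma its limit is also the limit of the
  whole sequence in \<open>L\<^sup>1\<close>.
\<close>

lemma L1_Cauchy_limit:
  fixes s :: "nat \<Rightarrow> 'a \<Rightarrow> complex"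
  assumes int: "\<And>n. integrable M (s n)"
    and C: "\<And>e. e > 0 \<Longrightarrow> \<exists>N. \<forall>i\<ge>N. \<forall>j\<ge>N. (\<integral>x. norm (s i x - s j x) \<partial>M) < e"
  obtains f where "integrable M f" "(\<lambda>n. \<integral>x. norm (s n x - f x) \<partial>M) \<longlonglongrightarrow> 0"
proof -
  obtain r where r: "strict_mono r" and AE: "AE x in M. Cauchy (\<lambda>i. s (r i) x)"
    using cauchy_L1_AE_cauchy_subseq[OF int C] by metis
  have [measurable]: "s n \<in> borel_measurable M" for n using int by auto
  define f where "f x = lim (\<lambda>i. s (r i) x)" for x
  have fm[measurable]: "f \<in> borel_measurable M" unfolding f_def by measurable
  have lim: "AE x in M. (\<lambda>i. s (r i) x) \<longlonglongrightarrow> f x"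
    using AE unfolding f_def by eventually_elim (simp add: Cauchy_convergent_iff convergent_LIMSEQ_iff)
  have fatou: "(\<integral>\<^sup>+x. norm (s n x - f x) \<partial>M) \<le> ennreal e"
    if N: "\<forall>i\<ge>N. \<forall>j\<ge>N. (\<integral>x. norm (s i x - s j x) \<partial>M) < e" and n: "n \<ge> N" for n N e
  proof -
    have "(\<integral>\<^sup>+x. norm (s n x - f x) \<partial>M) = (\<integral>\<^sup>+x. liminf (\<lambda>i. ennreal (norm (s n x - s (r i) x))) \<partial>M)"
    proof (rule nn_integral_cong_AE)
      show "AE x in M. ennreal (norm (s n x - f x)) = liminf (\<lambda>i. ennreal (norm (s n x - s (r i) x)))"
        using lim
      proof eventually_elim
        case (elim x)
        then have "(\<lambda>i. ennreal (norm (s n x - s (r i) x))) \<longlonglongrightarrow> ennreal (norm (s n x - f x))"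
          by (intro tendsto_ennrealI tendsto_intros)
        then show ?case by (rule lim_imp_Liminf[OF trivial_limit_sequentially, symmetric])
      qed
    qed
    also have "\<dots> \<le> liminf (\<lambda>i. \<integral>\<^sup>+x. ennreal (norm (s n x - s (r i) x)) \<partial>M)"
      by (rule nn_integral_liminf) measurable
    also have "\<dots> \<le> ennreal e"
    proof (rule Liminf_le)
      have "(\<integral>\<^sup>+x. ennreal (norm (s n x - s (r i) x)) \<partial>M) \<le> ennreal e" if "i \<ge> N" for i
      proof -
        have "r i \<ge> N" using seq_suble[OF r, of i] that by linarith
        have "(\<integral>\<^sup>+x. ennreal (norm (s n x - s (r i) x)) \<partial>M) = ennreal (\<integral>x. norm (s n x - s (r i) x) \<partial>M)"
          using int by (intro nn_integral_eq_integral) auto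
        also have "\<dots> \<le> ennreal e" using N n \<open>r i \<ge> N\<close> by (intro ennreal_leI) (auto intro: less_imp_le)
        finally show ?thesis .
      qed
      then show "\<forall>\<^sub>F i in sequentially. (\<integral>\<^sup>+x. ennreal (norm (s n x - s (r i) x)) \<partial>M) \<le> ennreal e"
        by (auto simp: eventually_sequentially)
    qed simp
    finally show ?thesis .
  qed
  have fint: "integrable M f"
  proof -
    \<comment> \<open>\<open>f\<close> differs from the integrable \<open>s N\<close> by a function whose norm has integral at most 1\<close>
    obtain N where N: "\<forall>i\<ge>N. \<forall>j\<ge>N. (\<integral>x. norm (s i x - s j x) \<partial>M) < 1" using C[of 1] by auto
    have "(\<integral>\<^sup>+x. norm (s N x - f x) \<partial>M) \<le> ennreal 1" by (rule fatou[OF N]) simp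
    then have "(\<integral>\<^sup>+x. norm (s N x - f x) \<partial>M) < \<infinity>" using ennreal_less_top le_less_trans
        by (metis infinity_ennreal_def)
    then have "integrable M (\<lambda>x. s N x - f x)" by (intro integrableI_bounded) auto
    from Bochner_Integration.integrable_diff[OF int[of N] this] show ?thesis
        by (simp only: diff_diff_eq2 add_diff_cancel_left')
  qed
  have "(\<lambda>n. \<integral>x. norm (s n x - f x) \<partial>M) \<longlonglongrightarrow> 0"
  proof (rule LIMSEQ_I)
    fix e :: real assume e: "e > 0"
    obtain N where N: "\<forall>i\<ge>N. \<forall>j\<ge>N. (\<integral>x. norm (s i x - s j x) \<partial>M) < e / 2"
      using C[of "e / 2"] e by auto
    have "(\<integral>x. norm (s n x - f x) \<partial>M) \<le> e / 2" if "n \<ge> N" for n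
    proof -
      have "ennreal (\<integral>x. norm (s n x - f x) \<partial>M) = (\<integral>\<^sup>+x. norm (s n x - f x) \<partial>M)"
        using int fint by (intro nn_integral_eq_integral[symmetric]) auto
      also have "\<dots> \<le> ennreal (e / 2)" by (rule fatou[OF N that])
      finally show ?thesis using e by (simp add: ennreal_le_iff)
    qed
    then show "\<exists>no. \<forall>n\<ge>no. norm ((\<integral>x. norm (s n x - f x) \<partial>M) - 0) < e"
      using e by (intro exI[of _ N]) (fastforce simp: abs_of_nonneg)
  qed
  with fint show thesis by (rule that)
qed

section \<open>The urn as a Markov chain of histories\<close>

lemma length_urn [simp]: "length (urn m u n) = Suc n"
  by (induction n) auto

lemma set_urn: "m > 0 \<Longrightarrow> set (urn m u n) \<subseteq> {..<m}"
  by (induction n) auto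

lemma take_urn: "i \<le> n \<Longrightarrow> take (Suc i) (urn m u n) = urn m u i"
  by (induction n) (auto simp: le_Suc_eq)

lemma urn_cong: "(\<And>i. i < n \<Longrightarrow> u i = v i) \<Longrightarrow> urn m u n = urn m v n"
  by (induction n) auto

lemma measurable_urn:
  "{..<n} \<subseteq> I \<Longrightarrow>
    (\<lambda>u. urn m u n) \<in> Pi\<^sub>M I (\<lambda>_. count_space UNIV) \<rightarrow>\<^sub>M count_space UNIV"
proof (induction n)
  case (Suc n)
  have [measurable]: "(\<lambda>u. u n) \<in> Pi\<^sub>M I (\<lambda>_. count_space (UNIV::nat set)) \<rightarrow>\<^sub>M count_space UNIV"
    using Suc.prems by (intro measurable_component_singleton) auto
  have "(\<lambda>u. l @ [(l ! u n + 1) mod m])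
      \<in> Pi\<^sub>M I (\<lambda>_. count_space (UNIV::nat set)) \<rightarrow>\<^sub>M count_space UNIV" for l
    by measurable
  moreover have "(\<lambda>u. urn m u n) \<in> Pi\<^sub>M I (\<lambda>_. count_space UNIV) \<rightarrow>\<^sub>M count_space UNIV"
    using Suc.prems by (intro Suc.IH) auto
  ultimately show ?case
    unfolding urn.simps
    by (rule measurable_compose_countable[of "\<lambda>l u. l @ [(l ! u n + 1) mod m]" _ _ "\<lambda>u. urn m u n"])
qed auto

text \<open>
  The list of ball types at time \<open>n\<close> records the whole history up to time \<open>n\<close>, since earlier lists
  are its prefixes. Every random variable that is determined by the past is therefore a function of this
  list, and the list takes only finitely many values, which makes integrability automatic.
\<close>

locale cyclic_urn = prob_space M for M :: "'a measure" +
  fixes m :: nat and U :: "nat \<Rightarrow> 'a \<Rightarrow> nat"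
  assumes m: "m \<ge> 2" and draws: "uniform_draws M U"
begin

definition hist :: "nat \<Rightarrow> 'a \<Rightarrow> nat list" where
  "hist n x = urn m (\<lambda>i. U i x) n"

abbreviation \<omega> :: complex where "\<omega> \<equiv> omega m"

definition draw :: "nat list \<Rightarrow> nat \<Rightarrow> nat list" where
  "draw l j = l @ [(l ! j + 1) mod m]"

lemma length_hist [simp]: "length (hist n x) = Suc n"
  by (simp add: hist_def)

lemma set_hist: "set (hist n x) \<subseteq> {..<m}"
  unfolding hist_def using m by (intro set_urn) auto

lemma hist_Suc: "hist (Suc n) x = draw (hist n x) (U n x)"
  by (simp add: hist_def draw_def)

lemma take_hist: "i \<le> n \<Longrightarrow> take (Suc i) (hist n x) = hist i x"
  by (simp add: hist_def take_urn)

lemma measurable_U [measurable]: "U n \<in> M \<rightarrow>\<^sub>M count_space UNIV"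
  using draws by (auto simp: uniform_draws_def indep_vars_def)

text \<open>
  Independence of two random variables presupposes a common type of values, so the history is encoded by a natural number.
\<close>

lemma indep_hist_U: "indep_var (count_space UNIV) (\<lambda>x. to_nat (hist n x)) (count_space UNIV) (U n)"
proof -
  have "indep_vars (\<lambda>_. count_space UNIV) U UNIV"
    using draws by (simp add: uniform_draws_def)
  moreover have "(\<lambda>u. to_nat (urn m u n))
      \<in> Pi\<^sub>M {..<n} (\<lambda>_. count_space UNIV) \<rightarrow>\<^sub>M count_space UNIV"
    by (rule measurable_compose[OF measurable_urn]) auto
  ultimately have "indep_var (count_space UNIV)
      ((\<lambda>u. to_nat (urn m u n)) \<circ> (\<lambda>x. restrict (\<lambda>i. U i x) {..<n}))
      (count_space UNIV) ((\<lambda>u. u n) \<circ> (\<lambda>x. restrict (\<lambda>i. U i x) {n}))"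
    by (intro indep_var_compose[OF indep_var_restrict] measurable_component_singleton) auto
  also have "(\<lambda>u. u n) \<circ> (\<lambda>x. restrict (\<lambda>i. U i x) {n}) = U n" by auto
  also have "(\<lambda>u. to_nat (urn m u n)) \<circ> (\<lambda>x. restrict (\<lambda>i. U i x) {..<n}) = (\<lambda>x. to_nat (hist n x))"
    by (auto simp: hist_def fun_eq_iff intro: arg_cong[where f = to_nat] urn_cong)
  finally show ?thesis .
qed

lemma measurable_hist [measurable]: "hist n \<in> M \<rightarrow>\<^sub>M count_space UNIV"
proof -
  have "(\<lambda>x. from_nat (to_nat (hist n x)) :: nat list) \<in> M \<rightarrow>\<^sub>M count_space UNIV"
    using indep_var_rv1[OF indep_hist_U] by (rule measurable_compose) simp
  then show ?thesis by simp
qed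

lemma finite_histories: "finite {l. set l \<subseteq> {..<m} \<and> length l = Suc n}"
  by (rule finite_lists_length_eq) simp

lemma measurable_comp_hist [measurable]: "(\<lambda>x. F (hist n x)) \<in> M \<rightarrow>\<^sub>M borel"
  by (rule measurable_compose[OF measurable_hist]) simp

lemma integrable_comp_hist:
  fixes F :: "nat list \<Rightarrow> 'b::{banach, second_countable_topology}"
  shows "integrable M (\<lambda>x. F (hist n x))"
proof -
  have "norm (F (hist n x)) \<le> Max ((\<lambda>l. norm (F l)) ` {l. set l \<subseteq> {..<m} \<and> length l = Suc n})" for x
    using set_hist by (intro Max_ge finite_imageI finite_histories) auto
  then show ?thesis by (intro integrable_const_bound) auto
qed

text \<open>
  The only place where the independence and uniformity of the draws are used: the position drawn next is
  uniform and independent of the history, so the next step can be averaged over all positions.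
\<close>

lemma expectation_step:
  fixes F :: "nat list \<Rightarrow> nat list \<Rightarrow> 'b::{banach, second_countable_topology}"
  shows "(\<integral>x. F (hist n x) (hist (Suc n) x) \<partial>M)
    = (\<integral>x. (\<Sum>j\<le>n. F (hist n x) (draw (hist n x) j)) /\<^sub>R Suc n \<partial>M)"
proof -
  let ?D = "count_space UNIV :: nat measure"
  let ?X = "\<lambda>x. to_nat (hist n x)"
  let ?G = "\<lambda>(c, j). F (from_nat c) (draw (from_nat c) j)"
  have joint: "distr M ?D ?X \<Otimes>\<^sub>M distr M ?D (U n) = distr M (?D \<Otimes>\<^sub>M ?D) (\<lambda>x. (?X x, U n x))"
    using indep_hist_U by (simp add: indep_var_distribution_eq)
  have law: "distr M ?D (U n) = measure_pmf (pmf_of_set {..n})"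
    using draws by (simp add: uniform_draws_def)
  interpret P: prob_space "distr M ?D ?X" by (rule prob_space_distr) measurable
  interpret Q: prob_space "distr M ?D (U n)" by (rule prob_space_distr) measurable
  interpret PQ: pair_sigma_finite "distr M ?D ?X" "distr M ?D (U n)" ..
  have G[measurable]: "?G \<in> ?D \<Otimes>\<^sub>M ?D \<rightarrow>\<^sub>M borel"
    by (simp add: pair_measure_countable)
  \<comment> \<open>the earlier history is a function of the later one\<close>
  have "integrable M (\<lambda>x. F (butlast (hist (Suc n) x)) (hist (Suc n) x))"
    by (rule integrable_comp_hist)
  then have int: "integrable M (\<lambda>x. ?G (?X x, U n x))"
    by (simp add: hist_Suc draw_def)
  have "(\<integral>x. F (hist n x) (hist (Suc n) x) \<partial>M) = (\<integral>x. ?G (?X x, U n x) \<partial>M)"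
    by (simp add: hist_Suc)
  also have "\<dots> = (\<integral>z. ?G z \<partial>(distr M ?D ?X \<Otimes>\<^sub>M distr M ?D (U n)))"
    unfolding joint by (subst integral_distr) auto
  also have "\<dots> = (\<integral>l. (\<integral>j. ?G (l, j) \<partial>distr M ?D (U n)) \<partial>distr M ?D ?X)"
    using int by (intro PQ.integral_fst'[symmetric]) (simp add: joint integrable_distr_eq)
  also have "\<dots> = (\<integral>l. (\<Sum>j\<le>n. F (from_nat l) (draw (from_nat l) j)) /\<^sub>R Suc n \<partial>distr M ?D ?X)"
    unfolding law
    by (subst integral_measure_pmf[of "{..n}"])
       (auto simp: set_pmf_of_set pmf_of_set indicator_def scaleR_sum_right divide_inverse intro!: sum.cong)
  also have "\<dots> = (\<integral>x. (\<Sum>j\<le>n. F (hist n x) (draw (hist n x) j)) /\<^sub>R Suc n \<partial>M)"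
    by (subst integral_distr) auto
  finally show ?thesis .
qed

end

section \<open>Fourier modes of the urn\<close>

lemma omega_power_m: "m > 0 \<Longrightarrow> omega m ^ m = 1"
  by (simp add: omega_def flip: exp_of_nat_mult)

lemma norm_omega [simp]: "cmod (omega m) = 1"
  by (simp add: omega_def norm_exp_eq_Re)

lemma omega_power_mod: "m > 0 \<Longrightarrow> omega m ^ (k * (a mod m)) = omega m ^ (k * a)"
proof -
  assume m: "m > 0"
  have "k * a = k * (m * (a div m) + a mod m)" by simp
  also have "\<dots> = m * (k * (a div m)) + k * (a mod m)" by (simp only: distrib_left mult_ac)
  finally have "omega m ^ (k * a) = (omega m ^ m) ^ (k * (a div m)) * omega m ^ (k * (a mod m))"
    by (simp only: power_add power_mult)
  with m show ?thesis by (simp add: omega_power_m)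
qed

lemma omega_power_eq_1_iff:
  assumes "m > 0" shows "omega m ^ k = 1 \<longleftrightarrow> m dvd k"
proof
  assume "omega m ^ k = 1"
  then have "exp (of_nat k * (2 * of_real pi * \<i> / of_nat m)) = 1"
    by (simp add: omega_def flip: exp_of_nat_mult)
  then obtain n :: int where n: "2 * pi * k / m = of_int (2 * n) * pi"
    by (auto simp: exp_eq_1 field_simps)
  then have "real k = of_int n * real m"
    using assms by (simp add: field_simps)
  then have "int k = n * int m" by (metis of_int_eq_iff of_int_mult of_int_of_nat_eq)
  then show "m dvd k" by (metis dvd_triv_right int_dvd_int_iff)
next
  assume "m dvd k"
  then show "omega m ^ k = 1" using assms by (auto simp: power_mult omega_power_m)
qed

lemma cnj_omega_power:
  assumes "m > 0" "k \<le> m" shows "cnj (omega m ^ k) = omega m ^ (m - k)"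
proof -
  have "omega m ^ k * omega m ^ (m - k) = 1"
    using assms by (simp add: omega_power_m flip: power_add)
  moreover have "omega m ^ k * cnj (omega m ^ k) = 1"
    by (simp only: complex_norm_square[symmetric] norm_power norm_omega) simp
  moreover have "omega m ^ k \<noteq> 0" by (simp add: omega_def)
  ultimately show ?thesis by (metis mult_left_cancel)
qed

lemma lam_le_1: "lam m k \<le> 1"
  unfolding lam_def using complex_Re_le_cmod[of "omega m ^ k"] by (simp add: norm_power)

lemma lam_less_1:
  assumes "m > 0" "\<not> m dvd k" shows "lam m k < 1"
proof (rule ccontr)
  assume "\<not> lam m k < 1"
  then have 1: "Re (omega m ^ k) = 1" using lam_le_1[of m k] by (simp add: lam_def)
  have "(Re (omega m ^ k))\<^sup>2 + (Im (omega m ^ k))\<^sup>2 = 1"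
    by (simp add: norm_power flip: cmod_power2)
  with 1 have "omega m ^ k = 1" by (simp add: complex_eq_iff)
  with assms omega_power_eq_1_iff show False by blast
qed

lemma lam_cnj: "m > 0 \<Longrightarrow> k \<le> m \<Longrightarrow> lam m (m - k) = lam m k"
  unfolding lam_def using cnj_omega_power[of m k] by (metis cnj.sel(1))

lemma powr_Bernoulli_inequality:
  fixes x r :: real
  assumes "0 \<le> x" "1 \<le> r"
  shows "1 + r * x \<le> (1 + x) powr r"
proof (cases "x = 0")
  case False
  then have x: "0 < x" using assms by simp
  have "\<exists>z>0. z < x \<and> (1 + x) powr r - (1 + 0) powr r = (x - 0) * (r * (1 + z) powr (r - 1))"
  proof (rule MVT2[OF x])
    show "((\<lambda>y. (1 + y) powr r) has_real_derivative r * (1 + y) powr (r - 1)) (at y)" if "0 \<le> y" for y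
      using DERIV_fun_powr[of "\<lambda>y. 1 + y" 1 y r] that by (auto intro!: derivative_eq_intros)
  qed
  then obtain z where z: "z > 0" "(1 + x) powr r - 1 = x * (r * (1 + z) powr (r - 1))" by auto
  have "1 \<le> (1 + z) powr (r - 1)" using z assms by (intro ge_one_powr_ge_zero) auto
  then have "x * (r * 1) \<le> x * (r * (1 + z) powr (r - 1))"
    using assms by (intro mult_left_mono) auto
  with z show ?thesis by (simp add: mult.commute)
qed simp

context cyclic_urn
begin

definition mode :: "nat \<Rightarrow> nat list \<Rightarrow> complex" where
  "mode k l = (\<Sum>a\<leftarrow>l. \<omega> ^ (k * a))"

text \<open>
  The difference between a Fourier sum and its conditional mean given the list without its last entry.
\<close>

definition jump :: "nat \<Rightarrow> nat list \<Rightarrow> complex" where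
  "jump k l = \<omega> ^ (k * last l) - \<omega> ^ k * mode k (butlast l) / of_nat (length l - 1)"

lemma m_pos: "m > 0" using m by simp

lemma mode_nth: "length l = Suc n \<Longrightarrow> mode k l = (\<Sum>j\<le>n. \<omega> ^ (k * l ! j))"
  unfolding mode_def
  by (subst sum_list_sum_nth) (auto simp: atLeast0LessThan lessThan_Suc_atMost intro!: sum.cong)

lemma mode_draw: "mode k (draw l j) = mode k l + \<omega> ^ k * \<omega> ^ (k * l ! j)"
  by (simp add: mode_def draw_def omega_power_mod m_pos algebra_simps flip: power_add)

lemma jump_draw: "jump k (draw l j) = \<omega> ^ k * (\<omega> ^ (k * l ! j) - mode k l / of_nat (length l))"
proof -
  have "jump k (draw l j) = \<omega> ^ (k * (l ! j + 1)) - \<omega> ^ k * mode k l / of_nat (length l)"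
    by (simp add: jump_def draw_def omega_power_mod m_pos del: mult_Suc_right)
  also have "\<omega> ^ (k * (l ! j + 1)) = \<omega> ^ k * \<omega> ^ (k * l ! j)"
    by (simp add: power_add)
  finally show ?thesis by (simp only: right_diff_distrib times_divide_eq_right)
qed

lemma norm_mode_le: "cmod (mode k l) \<le> length l"
  unfolding mode_def by (induction l) (auto intro!: norm_triangle_le simp: norm_power)

lemma norm_jump_le: "cmod (jump k l) \<le> 2"
proof -
  have "cmod (mode k (butlast l)) \<le> real (length l - 1)"
    using norm_mode_le[of k "butlast l"] by simp
  then have "cmod (\<omega> ^ k * mode k (butlast l) / of_nat (length l - 1)) \<le> 1"
    by (auto simp: norm_mult norm_divide norm_power divide_le_eq)
  then show ?thesis
    unfolding jump_def by (intro order_trans[OF norm_triangle_ineq4]) (simp add: norm_power)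
qed

lemma sum_jump: "length l = Suc n \<Longrightarrow> (\<Sum>j\<le>n. jump k (draw l j)) = 0"
  by (simp add: jump_draw sum_subtractf mode_nth sum_distrib_left[symmetric] del: of_nat_Suc)

lemma sum_jump_cnj_jump:
  assumes l: "length l = Suc n"
  shows "(\<Sum>j\<le>n. jump k (draw l j) * cnj (jump q (draw l j))) =
    \<omega> ^ k * cnj (\<omega> ^ q) * ((\<Sum>j\<le>n. \<omega> ^ (k * l ! j) * cnj (\<omega> ^ (q * l ! j))) -
      mode k l * cnj (mode q l) / Suc n)"
proof -
  have "(\<Sum>j\<le>n. jump k (draw l j) * cnj (jump q (draw l j))) =
    \<omega> ^ k * cnj (\<omega> ^ q) * (\<Sum>j\<le>n. (\<omega> ^ (k * l ! j) - mode k l / Suc n) * cnj (\<omega> ^ (q * l ! j)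
        - mode q l / Suc n))"
    unfolding sum_distrib_left by (intro sum.cong refl) (simp add: jump_draw l mult_ac)
  also have "(\<Sum>j\<le>n. (\<omega> ^ (k * l ! j) - mode k l / Suc n) * cnj (\<omega> ^ (q * l ! j) - mode q l / Suc n))
    = (\<Sum>j\<le>n. \<omega> ^ (k * l ! j) * cnj (\<omega> ^ (q * l ! j))) - (\<Sum>j\<le>n. \<omega> ^ (k * l ! j)) * cnj (mode q l) / Suc n
     - mode k l / Suc n * cnj (\<Sum>j\<le>n. \<omega> ^ (q * l ! j)) + mode k l * cnj (mode q l) / Suc n"
  proof -
    have *: "(\<Sum>j\<in>A. (f j - a) * cnj (g j - b)) = (\<Sum>j\<in>A. f j * cnj (g j)) - (\<Sum>j\<in>A. f j) * cnj b
        - a * cnj (\<Sum>j\<in>A. g j) + card A * (a * cnj b)" for A :: "nat set" and f g a b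
      by (simp add: ring_distribs sum_subtractf sum.distrib sum_distrib_left sum_distrib_right)
    show ?thesis unfolding * by simp
  qed
  also have "\<dots> = (\<Sum>j\<le>n. \<omega> ^ (k * l ! j) * cnj (\<omega> ^ (q * l ! j))) - mode k l * cnj (mode q l) / Suc n"
    by (simp add: mode_nth[OF l, symmetric] del: of_nat_Suc cnj_sum)
  finally show ?thesis .
qed

text \<open>
  This vanishes for an urn with equally many balls of each type; it measures how far the law of the next type is from uniform.
\<close>

definition imbalance :: "nat list \<Rightarrow> real" where
  "imbalance l = (\<Sum>k = 1..<m. cmod (mode k l)) / length l"

lemma imbalance_nonneg: "0 \<le> imbalance l"
  by (simp add: imbalance_def sum_nonneg)

lemma mode_mod: "mode (k mod m) l = mode k l"
  unfolding mode_def using omega_power_mod[OF m_pos] by (metis mult.commute)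

lemma norm_mode_le_imbalance:
  assumes "\<not> m dvd k" shows "cmod (mode k l) / length l \<le> imbalance l"
proof -
  have "k mod m \<in> {1..<m}" using assms m_pos by (auto simp: dvd_eq_mod_eq_0)
  then have "cmod (mode (k mod m) l) \<le> (\<Sum>k = 1..<m. cmod (mode k l))"
    by (intro member_le_sum) auto
  then show ?thesis by (simp add: mode_mod imbalance_def divide_right_mono)
qed

text \<open>
  Conditional covariance of two modes. The product of the characters with indices \<open>k\<close> and \<open>q\<close> is the character with index
  \<open>k - q\<close>; for \<open>k = q\<close> it is constantly 1, and otherwise its mean over the urn is bounded by the imbalance.
\<close>

lemma mean_jump_cnj_jump:
  assumes l: "length l = Suc n" and k: "k \<in> {1..<m}" and q: "q \<in> {1..<m}"
  shows "cmod ((\<Sum>j\<le>n. jump k (draw l j) * cnj (jump q (draw l j))) / Suc n - of_bool (k = q))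
    \<le> 2 * imbalance l"
proof -
  let ?A = "(\<Sum>j\<le>n. \<omega> ^ (k * l ! j) * cnj (\<omega> ^ (q * l ! j))) / Suc n"
  let ?w = "\<omega> ^ k * cnj (\<omega> ^ q)"
  have nd: "\<not> m dvd k" using k by (auto dest: dvd_imp_le)
  have B: "cmod (mode k l * cnj (mode q l) / Suc n / Suc n) \<le> imbalance l"
  proof -
    have "cmod (mode k l * cnj (mode q l) / Suc n / Suc n)
        = cmod (mode k l) / Suc n * (cmod (mode q l) / Suc n)"
      by (simp add: norm_mult norm_divide del: of_nat_Suc)
    also have "\<dots> \<le> cmod (mode k l) / Suc n * 1"
      using norm_mode_le[of q l] l by (intro mult_left_mono) auto
    finally show ?thesis using norm_mode_le_imbalance[OF nd, of l] l by simp
  qed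
  have A: "cmod (?w * ?A - of_bool (k = q)) \<le> imbalance l"
  proof (cases "k = q")
    case True
    have "\<omega> ^ i * cnj (\<omega> ^ i) = 1" for i
      by (simp only: complex_norm_square[symmetric] norm_power norm_omega) simp
    then show ?thesis using True imbalance_nonneg[of l]
      by (simp del: complex_cnj_power of_nat_Suc)
  next
    case False
    have "\<omega> ^ (k * a) * cnj (\<omega> ^ (q * a)) = \<omega> ^ ((k + (m - q)) * a)" for a
    proof -
      have "\<omega> ^ (k * a) * cnj (\<omega> ^ (q * a)) = (\<omega> ^ k * cnj (\<omega> ^ q)) ^ a"
        by (simp add: power_mult power_mult_distrib)
      also have "\<dots> = (\<omega> ^ (k + (m - q))) ^ a"
        using cnj_omega_power[OF m_pos, of q] q by (simp only: power_add) auto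
      finally show ?thesis by (simp add: power_mult)
    qed
    then have "?A = mode (k + (m - q)) l / Suc n" by (simp add: mode_nth[OF l])
    moreover have "\<not> m dvd k + (m - q)"
    proof
      assume "m dvd k + (m - q)"
      then obtain c where c: "k + (m - q) = m * c" by auto
      have "0 < m * c" "m * c < m * 2" unfolding c[symmetric] using k q by auto
      then have "c = 1" using m_pos by simp
      with c False q show False by auto
    qed
    ultimately show ?thesis
      using norm_mode_le_imbalance[of "k + (m - q)" l] False l
      by (simp add: norm_mult norm_power norm_divide del: of_nat_Suc)
  qed
  have dec: "(\<Sum>j\<le>n. jump k (draw l j) * cnj (jump q (draw l j))) / Suc n - of_bool (k = q)
     = (?w * ?A - of_bool (k = q)) - ?w * (mode k l * cnj (mode q l) / Suc n / Suc n)"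
    unfolding sum_jump_cnj_jump[OF l] by (simp add: algebra_simps diff_divide_distrib del: of_nat_Suc)
  have "cmod ((\<Sum>j\<le>n. jump k (draw l j) * cnj (jump q (draw l j))) / Suc n - of_bool (k = q))
      \<le> imbalance l + imbalance l"
    unfolding dec
  proof (rule order_trans[OF norm_triangle_ineq4], rule add_mono[OF A])
    have "cmod ?w = 1" by (simp add: norm_mult norm_power)
    then show "cmod (?w * (mode k l * cnj (mode q l) / Suc n / Suc n)) \<le> imbalance l"
      using B by (simp only: norm_mult[of ?w] mult_1)
  qed
  then show ?thesis by (simp only: mult_2)
qed

definition wjump :: "(nat \<Rightarrow> complex) \<Rightarrow> nat list \<Rightarrow> complex" where
  "wjump a l = (\<Sum>k = 1..<m. a k * jump k l)"

lemma sum_wjump: "length l = Suc n \<Longrightarrow> (\<Sum>j\<le>n. wjump a (draw l j)) = 0"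
  unfolding wjump_def by (subst sum.swap) (simp add: sum_jump sum_distrib_left[symmetric])

lemma norm_wjump_le: "cmod (wjump a l) \<le> 2 * (\<Sum>k = 1..<m. cmod (a k))"
  unfolding wjump_def sum_distrib_left
  by (intro sum_norm_le) (auto simp: norm_mult mult.commute[of "cmod (a _)"] intro!: mult_right_mono
      norm_jump_le)

lemma sum_norm_squared_le:
  "(\<Sum>k = 1..<m. cmod (a k))\<^sup>2 \<le> m * (\<Sum>k = 1..<m. (cmod (a k))\<^sup>2)"
proof -
  have "(\<Sum>k = 1..<m. cmod (a k))\<^sup>2 \<le> card {1..<m} * (\<Sum>k = 1..<m. (cmod (a k))\<^sup>2)"
    using sum_squared_le_sum_of_squares[of "\<lambda>k. cmod (a k)" "{1..<m}"] by (simp add: mult.commute)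
  also have "\<dots> \<le> m * (\<Sum>k = 1..<m. (cmod (a k))\<^sup>2)"
    by (intro mult_right_mono sum_nonneg) auto
  finally show ?thesis .
qed

text \<open>
  The conditional variance of a combination of modes is nearly deterministic: the double sum of
  conditional covariances reduces to its diagonal.
\<close>

lemma mean_norm_wjump:
  assumes l: "length l = Suc n"
  shows "\<bar>(\<Sum>j\<le>n. (cmod (wjump a (draw l j)))\<^sup>2) / Suc n - (\<Sum>k = 1..<m. (cmod (a k))\<^sup>2)\<bar>
     \<le> 2 * m * imbalance l * (\<Sum>k = 1..<m. (cmod (a k))\<^sup>2)"
proof -
  let ?c = "\<lambda>k q. (\<Sum>j\<le>n. jump k (draw l j) * cnj (jump q (draw l j))) / Suc n"
  have "complex_of_real ((\<Sum>j\<le>n. (cmod (wjump a (draw l j)))\<^sup>2) / Suc n)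
      = (\<Sum>j\<le>n. wjump a (draw l j) * cnj (wjump a (draw l j))) / Suc n"
    by (simp only: of_real_divide of_real_sum complex_norm_square of_real_of_nat_eq)
  also have "\<dots> = (\<Sum>j\<le>n. \<Sum>k = 1..<m. \<Sum>q = 1..<m.
      a k * cnj (a q) * (jump k (draw l j) * cnj (jump q (draw l j)) / Suc n))"
    by (simp add: wjump_def sum_product sum_divide_distrib mult_ac del: of_nat_Suc)
  also have "\<dots> = (\<Sum>k = 1..<m. \<Sum>q = 1..<m. a k * cnj (a q) * ?c k q)"
    by (subst sum.swap, rule sum.cong[OF refl], subst sum.swap)
       (simp add: sum_distrib_left sum_divide_distrib del: of_nat_Suc)
  finally have 1: "complex_of_real ((\<Sum>j\<le>n. (cmod (wjump a (draw l j)))\<^sup>2) / Suc n)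
    = (\<Sum>k = 1..<m. \<Sum>q = 1..<m. a k * cnj (a q) * ?c k q)" .
  have 2: "complex_of_real (\<Sum>k = 1..<m. (cmod (a k))\<^sup>2) = (\<Sum>k = 1..<m. \<Sum>q
      = 1..<m. a k * cnj (a q) * of_bool (k = q))"
    unfolding of_real_sum complex_norm_square
    by (simp add: of_bool_def if_distrib[of "\<lambda>x. _ * x"] sum.delta' cong: if_cong)
  have "\<bar>(\<Sum>j\<le>n. (cmod (wjump a (draw l j)))\<^sup>2) / Suc n - (\<Sum>k = 1..<m. (cmod (a k))\<^sup>2)\<bar>
     = cmod (\<Sum>k = 1..<m. \<Sum>q = 1..<m. a k * cnj (a q) * (?c k q - of_bool (k = q)))"
    unfolding right_diff_distrib sum_subtractf 1[symmetric] 2[symmetric]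
    by (simp only: of_real_diff[symmetric] norm_of_real)
  also have "\<dots> \<le> (\<Sum>k = 1..<m. \<Sum>q = 1..<m. (cmod (a k) * cmod (a q)) * (2 * imbalance l))"
    by (intro sum_norm_le) (unfold norm_mult complex_mod_cnj, intro mult_left_mono mean_jump_cnj_jump l,
        auto)
  also have "\<dots> = (\<Sum>k = 1..<m. cmod (a k))\<^sup>2 * (2 * imbalance l)"
    by (subst power2_eq_square, subst sum_product) (simp only: sum_distrib_right)
  also have "\<dots> \<le> (m * (\<Sum>k = 1..<m. (cmod (a k))\<^sup>2)) * (2 * imbalance l)"
    by (intro mult_right_mono sum_norm_squared_le) (simp add: imbalance_nonneg)
  finally show ?thesis by (simp add: mult_ac)
qed

lemma second_moment_mode_Suc:
  "(\<integral>x. (cmod (mode k (hist (Suc n) x)))\<^sup>2 \<partial>M)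
    = (1 + 2 * lam m k / Suc n) * (\<integral>x. (cmod (mode k (hist n x)))\<^sup>2 \<partial>M) + 1"
proof -
  have "(\<Sum>j\<le>n. (cmod (mode k (draw l j)))\<^sup>2) /\<^sub>R Suc n
      = (1 + 2 * lam m k / Suc n) * (cmod (mode k l))\<^sup>2 + 1"
    if l: "length l = Suc n" for l
  proof -
    have "(cmod (mode k (draw l j)))\<^sup>2
        = (cmod (mode k l))\<^sup>2 + 2 * Re (cnj (mode k l) * \<omega> ^ k * \<omega> ^ (k * l ! j)) + 1" for j
    proof -
      have *: "(cmod (u + w))\<^sup>2 = (cmod u)\<^sup>2 + 2 * Re (cnj u * w) + (cmod w)\<^sup>2" for u w
        by (simp add: cmod_power2) (simp add: power2_eq_square algebra_simps)
      show ?thesis unfolding mode_draw * by (simp add: norm_mult norm_power mult_ac)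
    qed
    then have "(\<Sum>j\<le>n. (cmod (mode k (draw l j)))\<^sup>2)
       = Suc n * (cmod (mode k l))\<^sup>2 + 2 * Re (cnj (mode k l) * \<omega> ^ k * mode k l) + Suc n"
      by (simp add: sum.distrib mode_nth[OF l] sum_distrib_left del: of_nat_Suc times_complex.sel)
    moreover have "cnj (mode k l) * \<omega> ^ k * mode k l = of_real ((cmod (mode k l))\<^sup>2) * \<omega> ^ k"
      by (simp only: complex_norm_square mult_ac)
    moreover have "Re (of_real c * \<omega> ^ k) = lam m k * c" for c
      by (simp add: lam_def)
    ultimately have "(\<Sum>j\<le>n. (cmod (mode k (draw l j)))\<^sup>2)
       = Suc n * (cmod (mode k l))\<^sup>2 + 2 * (lam m k * (cmod (mode k l))\<^sup>2) + Suc n"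
      by (simp only:)
    then show ?thesis by (simp add: field_simps del: of_nat_Suc)
  qed
  then have "(\<integral>x. (cmod (mode k (hist (Suc n) x)))\<^sup>2 \<partial>M)
      = (\<integral>x. (1 + 2 * lam m k / Suc n) * (cmod (mode k (hist n x)))\<^sup>2 + 1 \<partial>M)"
    by (subst expectation_step) simp
  also have "\<dots> = (1 + 2 * lam m k / Suc n) * (\<integral>x. (cmod (mode k (hist n x)))\<^sup>2 \<partial>M) + 1"
    by (simp add: integrable_comp_hist[of "\<lambda>l. (cmod (mode k l))\<^sup>2"] prob_space)
  finally show ?thesis .
qed

text \<open>
  The exact recursion \<open>e' = (1 + 2 \<lambda> / (n + 1)) e + 1\<close> has an inhomogeneous term 1; adding the linear
  term \<open>(n + 1) / (2 \<mu> - 1)\<close> to \<open>e\<close> turns it into a homogeneous inequality, which Bernoulli's inequality solves.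
\<close>

lemma second_moment_mode_le:
  assumes "lam m k \<le> \<mu>" "1 / 2 < \<mu>"
  shows "(\<integral>x. (cmod (mode k (hist n x)))\<^sup>2 \<partial>M) + Suc n / (2 * \<mu> - 1)
     \<le> (1 + 1 / (2 * \<mu> - 1)) * real (Suc n) powr (2 * \<mu>)"
proof (induction n)
  case 0
  then show ?case by (simp add: hist_def mode_def prob_space)
next
  case (Suc n)
  let ?e = "\<lambda>n. (\<integral>x. (cmod (mode k (hist n x)))\<^sup>2 \<partial>M)"
  have "?e (Suc n) \<le> (1 + 2 * \<mu> / Suc n) * ?e n + 1"
    unfolding second_moment_mode_Suc using assms
    by (intro add_mono mult_right_mono add_left_mono divide_right_mono) auto
  moreover have "2 * \<mu> / Suc n * (Suc n / (2 * \<mu> - 1)) = 1 + 1 / (2 * \<mu> - 1)"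
    using assms(2) by (simp add: divide_simps del: of_nat_Suc)
  moreover have "Suc (Suc n) / (2 * \<mu> - 1) = Suc n / (2 * \<mu> - 1) + 1 / (2 * \<mu> - 1)"
    by (simp add: add_divide_distrib)
  ultimately have "?e (Suc n) + Suc (Suc n) / (2 * \<mu> - 1)
      \<le> (1 + 2 * \<mu> / Suc n) * (?e n + Suc n / (2 * \<mu> - 1))"
    unfolding distrib_left distrib_right by linarith
  also have "\<dots> \<le> (1 + 2 * \<mu> / Suc n) * ((1 + 1 / (2 * \<mu> - 1)) * real (Suc n) powr (2 * \<mu>))"
    using assms(2) by (intro mult_left_mono Suc.IH) auto
  also have "\<dots> \<le> (1 + 1 / Suc n) powr (2 * \<mu>) * ((1 + 1 / (2 * \<mu> - 1)) * real (Suc n) powr (2 * \<mu>))"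
    using assms(2) powr_Bernoulli_inequality[of "1 / Suc n" "2 * \<mu>"]
    by (intro mult_right_mono) (simp_all del: of_nat_Suc)
  also have "\<dots> = (1 + 1 / (2 * \<mu> - 1)) * real (Suc (Suc n)) powr (2 * \<mu>)"
  proof -
    have "(1 + 1 / Suc n) * real (Suc n) = real (Suc (Suc n))"
      by (simp add: field_simps)
    then have "real (Suc (Suc n)) powr (2 * \<mu>) = (1 + 1 / Suc n) powr (2 * \<mu>) * real (Suc n) powr (2 * \<mu>)"
      by (metis powr_mult of_nat_0_le_iff add_nonneg_nonneg divide_nonneg_nonneg zero_le_one)
    then show ?thesis by (simp only: mult_ac)
  qed
  finally show ?case .
qed

text \<open>
  All nontrivial modes have \<open>\<lambda> < 1\<close>, so their second moments grow more slowly than \<open>n\<^sup>2\<close>.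
\<close>

lemma expectation_imbalance_tendsto_0: "(\<lambda>n. \<integral>x. imbalance (hist n x) \<partial>M) \<longlonglongrightarrow> 0"
proof -
  let ?e = "\<lambda>k n. \<integral>x. cmod (mode k (hist n x)) \<partial>M"
  have "(\<lambda>n. ?e k n / Suc n) \<longlonglongrightarrow> 0" if k: "k \<in> {1..<m}" for k
  proof -
    have "lam m k < 1" using k m_pos by (intro lam_less_1) (auto dest: dvd_imp_le)
    \<comment> \<open>any exponent between \<open>max \<lambda> (1/2)\<close> and 1 would do\<close>
    define \<mu> where "\<mu> = max (lam m k) (3 / 4)"
    have \<mu>: "lam m k \<le> \<mu>" "1 / 2 < \<mu>" "\<mu> < 1" using \<open>lam m k < 1\<close> by (auto simp: \<mu>_def)
    define C where "C = sqrt (1 + 1 / (2 * \<mu> - 1))"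
    have bound: "norm (?e k n / Suc n) \<le> C * real (Suc n) powr (\<mu> - 1)" for n
    proof -
      have "(?e k n)\<^sup>2 \<le> (\<integral>x. (cmod (mode k (hist n x)))\<^sup>2 \<partial>M)"
        by (rule expectation_squared_le[OF integrable_comp_hist[of "\<lambda>l. cmod (mode k l)" n]
              integrable_comp_hist[of "\<lambda>l. (cmod (mode k l))\<^sup>2" n]])
      also have "\<dots> \<le> (1 + 1 / (2 * \<mu> - 1)) * real (Suc n) powr (2 * \<mu>)"
      proof -
        have "0 \<le> Suc n / (2 * \<mu> - 1)" using \<mu> by simp
        then show ?thesis using second_moment_mode_le[OF \<mu>(1,2), of n] by linarith
      qed
      also have "\<dots> = (C * real (Suc n) powr \<mu>)\<^sup>2"
      proof -
        have "(real (Suc n) powr \<mu>)\<^sup>2 = real (Suc n) powr (2 * \<mu>)"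
          by (simp only: power2_eq_square powr_add[symmetric] mult_2)
        moreover have "C\<^sup>2 = 1 + 1 / (2 * \<mu> - 1)" using \<mu> by (simp add: C_def)
        ultimately show ?thesis by (simp only: power_mult_distrib)
      qed
      finally have "?e k n \<le> C * real (Suc n) powr \<mu>"
        by (rule power2_le_imp_le) (use \<mu> in \<open>auto simp: C_def\<close>)
      then have "?e k n / Suc n \<le> C * real (Suc n) powr \<mu> / Suc n"
        by (intro divide_right_mono) auto
      moreover have "C * real (Suc n) powr \<mu> / Suc n = C * real (Suc n) powr (\<mu> - 1)"
        by (simp add: powr_diff)
      moreover have "norm (?e k n / Suc n) = ?e k n / Suc n"
        by (simp add: Bochner_Integration.integral_nonneg del: of_nat_Suc)
      ultimately show ?thesis by linarith
    qed
    have "(\<lambda>n. C * real (Suc n) powr (\<mu> - 1)) \<longlonglongrightarrow> C * 0"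
    proof (rule tendsto_mult_left, rule tendsto_neg_powr)
      show "\<mu> - 1 < 0" using \<mu> by simp
      show "filterlim (\<lambda>n. real (Suc n)) at_top sequentially"
        by (rule filterlim_compose[OF filterlim_real_sequentially filterlim_Suc])
    qed
    then show ?thesis
      unfolding mult_zero_right
      by (rule Lim_null_comparison[rotated]) (intro always_eventually allI bound)
  qed
  then have "(\<lambda>n. \<Sum>k = 1..<m. ?e k n / Suc n) \<longlonglongrightarrow> 0"
    by (intro tendsto_null_sum) auto
  moreover have "(\<integral>x. imbalance (hist n x) \<partial>M) = (\<Sum>k = 1..<m. ?e k n / Suc n)" for n
  proof -
    have "integrable M (\<lambda>x. cmod (mode k (hist n x)))" for k
      by (rule integrable_comp_hist[of "\<lambda>l. cmod (mode k l)" n])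
    then show ?thesis
      unfolding imbalance_def length_hist integral_divide_zero
      by (subst Bochner_Integration.integral_sum) (auto simp only: sum_divide_distrib)
  qed
  ultimately show ?thesis by simp
qed

end

section \<open>Asymptotics of power-weighted sums\<close>

text \<open>
  The quotient is the reciprocal of a difference quotient of \<open>h \<mapsto> (1 + h) powr (1 - \<rho>)\<close> at 0.
\<close>

lemma powr_increment_ratio:
  fixes \<rho> :: real
  assumes "\<rho> \<noteq> 1"
  shows "(\<lambda>i. real (Suc i) powr - \<rho> / (real (Suc i) powr (1 - \<rho>) - real i powr (1 - \<rho>))) \<longlonglongrightarrow> 1 / (1 - \<rho>)"
proof -
  have "((\<lambda>h. (1 + h) powr (1 - \<rho>)) has_real_derivative (1 - \<rho>)) (at 0)"
    using DERIV_fun_powr[of "\<lambda>h. 1 + h" 1 0 "1 - \<rho>"] by (auto intro!: derivative_eq_intros)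
  then have D: "((\<lambda>h. ((1 + h) powr (1 - \<rho>) - 1) / h) \<longlongrightarrow> 1 - \<rho>) (at 0)"
    by (simp add: DERIV_def)
  have F: "filterlim (\<lambda>i. - inverse (real (Suc i))) (at 0) sequentially"
    unfolding filterlim_at
    using tendsto_minus[OF LIMSEQ_inverse_real_of_nat] by auto
  have "(\<lambda>i. inverse (((1 + - inverse (real (Suc i))) powr (1 - \<rho>) - 1) / - inverse (real (Suc i))))
      \<longlonglongrightarrow> inverse (1 - \<rho>)"
    using assms by (intro tendsto_inverse filterlim_compose[OF D F]) auto
  moreover have "inverse (((1 + - inverse (real (Suc i))) powr (1 - \<rho>) - 1) / - inverse (real (Suc i)))
      = real (Suc i) powr - \<rho> / (real (Suc i) powr (1 - \<rho>) - real i powr (1 - \<rho>))" for i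
  proof -
    have "1 + - inverse (real (Suc i)) = real i / real (Suc i)" by (simp add: field_simps)
    then have "(1 + - inverse (real (Suc i))) powr (1 - \<rho>)
        = real i powr (1 - \<rho>) / real (Suc i) powr (1 - \<rho>)"
      by (simp add: powr_divide del: of_nat_Suc)
    moreover have "real (Suc i) powr - \<rho> = real (Suc i) powr (1 - \<rho>) / real (Suc i)"
      by (simp add: powr_diff powr_minus divide_inverse del: of_nat_Suc)
    moreover have "inverse ((b / a - 1) / - inverse N)
        = a / N / (a - b)" if "a > 0" "N > 0" for a b N :: real
    proof -
      have "(b / a - 1) / - inverse N = (a - b) * N / a" using that by (simp add: field_simps)
      then show ?thesis using that by (simp only: inverse_divide divide_divide_eq_left mult.commute)
    qed
    ultimately show ?thesis by simp
  qed
  ultimately show ?thesis by (simp only: inverse_eq_divide)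
qed

lemma weighted_Cesaro_null:
  fixes w y :: "nat \<Rightarrow> real"
  assumes w: "\<And>i. 0 \<le> w i" and div: "filterlim (\<lambda>n. \<Sum>i<n. w i) at_top sequentially" and y: "y \<longlonglongrightarrow> 0"
  shows "(\<lambda>n. (\<Sum>i<n. w i * y i) / (\<Sum>i<n. w i)) \<longlonglongrightarrow> 0"
proof (rule tendstoI)
  fix e :: real assume "e > 0"
  then have "\<forall>\<^sub>F i in sequentially. \<bar>y i\<bar> < e / 2"
    using tendstoD[OF y, of "e / 2"] by (simp add: dist_real_def)
  then obtain N where N: "\<And>i. i \<ge> N \<Longrightarrow> \<bar>y i\<bar> < e / 2" by (auto simp: eventually_sequentially)
  define K where "K = (\<Sum>i<N. w i * \<bar>y i\<bar>)"
  have "\<forall>\<^sub>F n in sequentially. (\<Sum>i<n. w i) > max 0 (2 * K / e)"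
    by (rule div[unfolded filterlim_at_top_dense, rule_format])
  then show "\<forall>\<^sub>F n in sequentially. dist ((\<Sum>i<n. w i * y i) / (\<Sum>i<n. w i)) 0 < e"
    using eventually_ge_at_top[of N]
  proof eventually_elim
    case (elim n)
    have "\<bar>\<Sum>i<n. w i * y i\<bar> \<le> (\<Sum>i<n. w i * \<bar>y i\<bar>)"
      using w by (intro order_trans[OF sum_abs] sum_mono) (simp add: abs_mult)
    also have "\<dots> \<le> K + (\<Sum>i<n. w i * (e / 2))"
    proof -
      have "(\<Sum>i<n. w i * \<bar>y i\<bar>) = K + (\<Sum>i\<in>{N..<n}. w i * \<bar>y i\<bar>)"
        using elim(2) by (simp add: K_def sum.atLeastLessThan_concat atLeast0LessThan[symmetric])
      also have "\<dots> \<le> K + (\<Sum>i\<in>{N..<n}. w i * (e / 2))"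
        using N w by (intro add_left_mono sum_mono mult_left_mono) (auto intro: less_imp_le)
      also have "(\<Sum>i\<in>{N..<n}. w i * (e / 2)) \<le> (\<Sum>i<n. w i * (e / 2))"
        using w \<open>e > 0\<close> by (intro sum_mono2) auto
      finally show ?thesis by simp
    qed
    also have "\<dots> = K + (\<Sum>i<n. w i) * (e / 2)" by (simp add: sum_distrib_right)
    also have "\<dots> < (\<Sum>i<n. w i) * e"
      using elim(1) \<open>e > 0\<close> by (auto simp: field_simps)
    finally show ?case using elim(1) by (simp add: dist_real_def divide_less_eq mult.commute)
  qed
qed

text \<open>
  The power \<open>n powr (1 - \<rho>)\<close> is a telescoping sum whose terms are asymptotic to \<open>(1 - \<rho>) n powr (- \<rho>)\<close>, so the
  claim is a weighted Cesaro mean.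
\<close>

lemma powr_sum_head:
  fixes \<rho> :: real and c :: "nat \<Rightarrow> real"
  assumes \<rho>: "\<rho> < 1" and c: "c \<longlonglongrightarrow> c0"
  shows "(\<lambda>n. (\<Sum>i<n. real (Suc i) powr - \<rho> * c i) / real n powr (1 - \<rho>)) \<longlonglongrightarrow> c0 / (1 - \<rho>)"
proof -
  define w where "w i = real (Suc i) powr (1 - \<rho>) - real i powr (1 - \<rho>)" for i
  define x where "x i = real (Suc i) powr - \<rho> / w i * c i" for i
  have w: "w i > 0" for i using \<rho> unfolding w_def by (simp add: powr_less_mono2)
  have sw: "(\<Sum>i<n. w i) = real n powr (1 - \<rho>)" for n
    by (induction n) (auto simp: w_def)
  have x: "x \<longlonglongrightarrow> c0 / (1 - \<rho>)"
    using tendsto_mult[OF powr_increment_ratio c, of \<rho>] \<rho> unfolding x_def w_def by simp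
  have "(\<lambda>n. (\<Sum>i<n. w i * (x i - c0 / (1 - \<rho>))) / (\<Sum>i<n. w i)) \<longlonglongrightarrow> 0"
  proof (rule weighted_Cesaro_null)
    show "filterlim (\<lambda>n. \<Sum>i<n. w i) at_top sequentially"
      unfolding sw using \<rho> by real_asymp
    show "(\<lambda>i. x i - c0 / (1 - \<rho>)) \<longlonglongrightarrow> 0"
      using x by (simp add: LIM_zero_iff)
  qed (simp add: w less_imp_le)
  then have "(\<lambda>n. (\<Sum>i<n. w i * (x i - c0 / (1 - \<rho>))) / (\<Sum>i<n. w i) + c0 / (1 - \<rho>)) \<longlonglongrightarrow> 0 + c0 / (1 - \<rho>)"
    by (intro tendsto_add tendsto_const)
  moreover have "\<forall>\<^sub>F n in sequentially. (\<Sum>i<n. w i * (x i - c0 / (1 - \<rho>))) / (\<Sum>i<n. w i) + c0 / (1 - \<rho>)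
    = (\<Sum>i<n. real (Suc i) powr - \<rho> * c i) / real n powr (1 - \<rho>)"
    using eventually_gt_at_top[of 0]
  proof eventually_elim
    case (elim n)
    have "(\<Sum>i<n. w i * (x i - c0 / (1 - \<rho>))) = (\<Sum>i<n. w i * x i) - (\<Sum>i<n. w i) * (c0 / (1 - \<rho>))"
      by (simp only: right_diff_distrib sum_subtractf sum_distrib_right)
    moreover have "w i * x i = real (Suc i) powr - \<rho> * c i" for i
      using w[of i] by (simp add: x_def)
    moreover have "real n powr (1 - \<rho>) > 0" using elim by simp
    ultimately show ?case by (simp add: sw diff_divide_distrib)
  qed
  ultimately show ?thesis by (auto elim: Lim_transform_eventually)
qed

text \<open>
  As for the partial sums, but \<open>n powr (1 - \<rho>)\<close> now decreases to zero and is compared with tails.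
\<close>

lemma powr_sum_tail:
  fixes \<rho> :: real and c :: "nat \<Rightarrow> real"
  assumes \<rho>: "\<rho> > 1" and c: "c \<longlonglongrightarrow> c0"
  shows "summable (\<lambda>i. real (Suc i) powr - \<rho> * c i)"
    and "(\<lambda>n. (\<Sum>i. real (Suc (i + n)) powr - \<rho> * c (i + n)) / real n powr (1 - \<rho>)) \<longlonglongrightarrow> c0 / (\<rho> - 1)"
proof -
  define f where "f i = real (Suc i) powr - \<rho> * c i" for i
  define w where "w i = real i powr (1 - \<rho>) - real (Suc i) powr (1 - \<rho>)" for i
  define x where "x i = real (Suc i) powr - \<rho> / w i * c i" for i
  define L where "L = c0 / (\<rho> - 1)"
  have w: "w i > 0" if "i > 0" for i using \<rho> that unfolding w_def by (simp add: powr_less_mono2_neg)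
  have B0: "(\<lambda>n. real n powr (1 - \<rho>)) \<longlonglongrightarrow> 0"
    using \<rho> by (intro tendsto_neg_powr filterlim_real_sequentially) auto
  have sw: "(\<lambda>i. w (i + n)) sums real n powr (1 - \<rho>)" for n
    using telescope_sums'[of "\<lambda>i. real (i + n) powr (1 - \<rho>)" 0] LIMSEQ_ignore_initial_segment[OF B0, of n]
    by (simp add: w_def del: of_nat_add)
  have x: "x \<longlonglongrightarrow> L"
  proof -
    have "w i = - (real (Suc i) powr (1 - \<rho>) - real i powr (1 - \<rho>))" for i
      by (simp add: w_def)
    then have xi: "x i = - (real (Suc i) powr - \<rho> / (real (Suc i) powr (1 - \<rho>) - real i powr (1
        - \<rho>)) * c i)" for i
      unfolding x_def by (simp only: divide_minus_right mult_minus_left)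
    have L: "L = - (1 / (1 - \<rho>) * c0)" using \<rho> by (simp add: L_def field_simps)
    show ?thesis
      unfolding xi L using \<rho> by (intro tendsto_minus tendsto_mult powr_increment_ratio c) simp
  qed
  have fwx: "f i = w i * x i" if "i > 0" for i using w[OF that] by (simp add: x_def f_def)
  have close: "summable (\<lambda>i. f (i + n)) \<and> \<bar>(\<Sum>i. f (i + n)) - L * real n powr (1 - \<rho>)\<bar>
      \<le> e * real n powr (1 - \<rho>)"
    if n: "n > 0" and e: "\<And>i. i \<ge> n \<Longrightarrow> \<bar>x i - L\<bar> \<le> e" for n e
  proof -
    have bnd: "norm (f (i + n) - L * w (i + n)) \<le> e * w (i + n)" for i
    proof -
      have "f (i + n) - L * w (i + n) = w (i + n) * (x (i + n) - L)"
        using n by (simp add: fwx algebra_simps)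
      then show ?thesis
        using e[of "i + n"] w[of "i + n"] n by (simp add: abs_mult mult.commute mult_right_mono)
    qed
    have sew: "summable (\<lambda>i. e * w (i + n))" using sw[of n]
        by (intro summable_mult) (auto dest: sums_summable)
    have sd: "summable (\<lambda>i. f (i + n) - L * w (i + n))"
      by (rule summable_comparison_test[OF _ sew]) (use bnd in auto)
    have sLw: "(\<lambda>i. L * w (i + n)) sums (L * real n powr (1 - \<rho>))" by (intro sums_mult sw)
    have s: "summable (\<lambda>i. f (i + n))"
      using summable_add[OF sd sums_summable[OF sLw]] by simp
    have "(\<Sum>i. f (i + n)) - L * real n powr (1 - \<rho>) = (\<Sum>i. f (i + n) - L * w (i + n))"
      using suminf_diff[OF s sums_summable[OF sLw]] sums_unique[OF sLw] by simp
    also have "norm \<dots> \<le> (\<Sum>i. e * w (i + n))"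
      by (rule norm_suminf_le[OF bnd sew])
    also have "\<dots> = e * real n powr (1 - \<rho>)"
      using sums_mult[OF sw[of n], of e] by (simp add: sums_iff)
    finally show ?thesis using s by simp
  qed
  have ev: "\<exists>N>0. \<forall>i\<ge>N. \<bar>x i - L\<bar> \<le> e" if "e > 0" for e
  proof -
    have "\<forall>\<^sub>F i in sequentially. \<bar>x i - L\<bar> < e"
      using tendstoD[OF x that] by (simp add: dist_real_def)
    then obtain N where "\<And>i. i \<ge> N \<Longrightarrow> \<bar>x i - L\<bar> < e" by (auto simp: eventually_sequentially)
    then show ?thesis by (intro exI[of _ "Suc N"]) (auto intro: less_imp_le)
  qed
  obtain N where "N > 0" "\<And>i. i \<ge> N \<Longrightarrow> \<bar>x i - L\<bar> \<le> 1" using ev[of 1] by auto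
  then have "summable (\<lambda>i. f (i + N))" using close[of N 1] by auto
  then show "summable (\<lambda>i. real (Suc i) powr - \<rho> * c i)" unfolding f_def[symmetric]
      by (simp add: summable_iff_shift)
  show "(\<lambda>n. (\<Sum>i. real (Suc (i + n)) powr - \<rho> * c (i + n)) / real n powr (1 - \<rho>)) \<longlonglongrightarrow> c0 / (\<rho> - 1)"
    unfolding L_def[symmetric] f_def[symmetric]
  proof (rule tendstoI)
    fix e :: real assume "e > 0"
    then obtain N where N: "N > 0" "\<And>i. i \<ge> N \<Longrightarrow> \<bar>x i - L\<bar> \<le> e / 2" using ev[of "e / 2"] by auto
    show "\<forall>\<^sub>F n in sequentially. dist ((\<Sum>i. f (i + n)) / real n powr (1 - \<rho>)) L < e"
      using eventually_ge_at_top[of N]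
    proof eventually_elim
      case (elim n)
      define B where "B = real n powr (1 - \<rho>)"
      have B: "B > 0" using elim N(1) by (simp add: B_def)
      have "\<bar>(\<Sum>i. f (i + n)) - L * B\<bar> \<le> e / 2 * B"
        using close[of n "e / 2"] elim N by (auto simp: B_def)
      also have "\<dots> < e * B" using B \<open>e > 0\<close> by simp
      finally have "\<bar>(\<Sum>i. f (i + n)) - L * B\<bar> / B < e" using B by (simp add: divide_less_eq)
      also have "\<bar>(\<Sum>i. f (i + n)) - L * B\<bar> / B = \<bar>(\<Sum>i. f (i + n)) / B - L\<bar>"
      proof -
        have "(\<Sum>i. f (i + n)) / B - L = ((\<Sum>i. f (i + n)) - L * B) / B"
          using B by (simp add: diff_divide_distrib)
        then show ?thesis using B by (simp add: abs_divide)
      qed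
      finally show ?case by (simp add: dist_real_def B_def)
    qed
  qed
qed

section \<open>The deterministic growth of a mode\<close>

text \<open>
  The product starts at \<open>l = 1\<close>: the factor \<open>1 + z\<close> belonging to the first step vanishes for \<open>z = -1\<close>, which is
  a mode of the urn whenever \<open>m\<close> is even; the martingale is therefore started at time 1.
\<close>

definition growth :: "complex \<Rightarrow> nat \<Rightarrow> complex" where
  "growth z n = (\<Prod>l = 1..<n. 1 + z / of_nat (Suc l))"

lemma norm_div_Suc_le:
  assumes "cmod z \<le> 1" "l \<ge> 1" shows "cmod (z / of_nat (Suc l)) \<le> 1 / 2"
proof -
  have "cmod (z / of_nat (Suc l)) = cmod z / real (Suc l)" by (simp add: norm_divide del: of_nat_Suc)
  also have "\<dots> \<le> 1 / 2" using assms by (intro frac_le) auto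
  finally show ?thesis .
qed

lemma growth_factor_nonzero:
  assumes "cmod z \<le> 1" "l \<ge> 1" shows "1 + z / of_nat (Suc l) \<noteq> 0"
proof
  assume "1 + z / of_nat (Suc l) = 0"
  then have "z / of_nat (Suc l) = - 1" by (simp add: eq_neg_iff_add_eq_0 add.commute)
  then show False using norm_div_Suc_le[OF assms] by simp
qed

lemma growth_nonzero: "cmod z \<le> 1 \<Longrightarrow> growth z n \<noteq> 0"
  unfolding growth_def using growth_factor_nonzero by auto

lemma growth_Suc: "n \<ge> 1 \<Longrightarrow> growth z (Suc n) = growth z n * (1 + z / of_nat (Suc n))"
  unfolding growth_def by (subst prod.atLeastLessThan_Suc) auto

lemma growth_1 [simp]: "growth z 1 = 1" "growth z (Suc 0) = 1"
  by (simp_all add: growth_def)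

lemma growth_cnj: "growth (cnj z) n = cnj (growth z n)"
  by (simp add: growth_def)

lemma growth_log_increment:
  assumes z: "cmod z \<le> 1" and l: "l \<ge> 1"
  shows "cmod (Ln (1 + z / of_nat (Suc l)) - z * of_real (ln (Suc l) - ln l)) \<le> 3 * (1 / l - 1 / Suc l)"
proof -
  let ?w = "z / of_nat (Suc l)"
  have w: "cmod ?w \<le> 1 / 2" by (rule norm_div_Suc_le[OF z l])
  have wS: "cmod ?w \<le> 1 / Suc l"
    using z by (simp add: norm_divide divide_right_mono del: of_nat_Suc)
  have "cmod (Ln (1 + ?w) - ?w) \<le> (cmod ?w)\<^sup>2 / (1 - cmod ?w)"
    using w by (intro Ln_approx_linear) linarith
  also have "\<dots> \<le> (cmod ?w)\<^sup>2 / (1 / 2)"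
    using w by (intro divide_left_mono) auto
  also have "\<dots> \<le> 2 * (1 / Suc l)\<^sup>2"
    using power_mono[OF wS, of 2] by simp
  also have "\<dots> \<le> 2 * (1 / l - 1 / Suc l)"
  proof -
    have "(1 / real (Suc l))\<^sup>2 = 1 / (real (Suc l) * real (Suc l))" by (simp add: power2_eq_square)
    also have "\<dots> \<le> 1 / (real l * real (Suc l))" using l by (intro frac_le mult_right_mono) auto
    also have "\<dots> = 1 / l - 1 / Suc l" using l by (simp add: field_simps)
    finally show ?thesis by simp
  qed
  finally have 1: "cmod (Ln (1 + ?w) - ?w) \<le> 2 * (1 / l - 1 / Suc l)" .
  have ub: "ln (Suc l) - ln l \<le> 1 / l"
  proof -
    have "ln (Suc l) - ln l = ln (1 + 1 / l)"
    proof -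
      have "1 + 1 / real l = real (Suc l) / real l" using l by (simp add: field_simps)
      then show ?thesis using l ln_div[of "real (Suc l)" "real l"] by simp
    qed
    also have "\<dots> \<le> 1 / l" by (rule ln_add_one_self_le_self) simp
    finally show ?thesis .
  qed
  have lb: "1 / Suc l \<le> ln (Suc l) - ln l"
  proof -
    have "ln l - ln (Suc l) = ln (l / Suc l)"
      using l by (subst ln_div) auto
    also have "\<dots> \<le> l / Suc l - 1"
      using l by (intro ln_le_minus_one) simp
    also have "\<dots> = - (1 / Suc l)" by (simp add: field_simps)
    finally show ?thesis by linarith
  qed
  have "?w - z * of_real (ln (Suc l) - ln l) = z * of_real (1 / Suc l - (ln (Suc l) - ln l))"
    by (simp add: algebra_simps)
  then have "cmod (?w - z * of_real (ln (Suc l) - ln l)) = cmod z * \<bar>1 / Suc l - (ln (Suc l) - ln l)\<bar>"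
    by (simp only: norm_mult norm_of_real)
  also have "\<dots> \<le> 1 * (1 / l - 1 / Suc l)"
    using z lb ub by (intro mult_mono) auto
  finally have 2: "cmod (?w - z * of_real (ln (Suc l) - ln l)) \<le> 1 / l - 1 / Suc l" by simp
  show ?thesis
    using norm_triangle_ineq[of "Ln (1 + ?w) - ?w" "?w - z * of_real (ln (Suc l) - ln l)"] 1 2 by simp
qed

text \<open>
  Taking logarithms, each factor differs from the ratio of consecutive powers of \<open>n\<close> by a term of order
  \<open>1 / l\<^sup>2\<close>, written as a telescoping bound. The rate matters later, since the error has to be
  compared with \<open>sqrt n\<close>.
\<close>

lemma growth_exp_form:
  assumes z: "cmod z \<le> 1"
  obtains G :: "nat \<Rightarrow> complex" and g where "\<And>n. n \<ge> 1 \<Longrightarrow> growth z n = of_nat n powr z * exp (G n)"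
    and "\<And>n. n \<ge> 1 \<Longrightarrow> cmod (G n - g) \<le> 3 / n"
proof -
  define h where "h l = Ln (1 + z / of_nat (Suc l)) - z * of_real (ln (Suc l) - ln l)" for l :: nat
  define G where "G n = (\<Sum>l = 1..<n. h l)" for n
  have form: "growth z n = of_nat n powr z * exp (G n)" if "n \<ge> 1" for n
    using that
  proof (induction n rule: nat_induct_at_least)
    case base
    then show ?case by (simp add: G_def)
  next
    case (Suc n)
    have pw: "of_nat k powr z = exp (z * of_real (ln k))" if "k \<ge> 1" for k :: nat
      using that by (simp add: powr_def Ln_of_nat)
    have "exp (G (Suc n)) = exp (G n) * exp (h n)"
      using Suc.hyps by (simp add: G_def exp_add)
    also have "exp (h n) = (1 + z / of_nat (Suc n)) / exp (z * of_real (ln (Suc n) - ln n))"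
      using growth_factor_nonzero[OF z Suc.hyps] by (simp add: h_def exp_diff)
    finally have "of_nat (Suc n) powr z * exp (G (Suc n))
      = (exp (z * of_real (ln (Suc n))) / exp (z * of_real (ln (Suc n) - ln n))) * exp (G n) * (1
          + z / of_nat (Suc n))"
      by (subst pw) (simp_all add: mult_ac)
    moreover have "exp (z * of_real (ln (Suc n))) / exp (z * of_real (ln (Suc n) - ln n)) = of_nat n powr z"
      using Suc.hyps by (simp add: pw algebra_simps flip: exp_diff)
    ultimately show ?case
      using Suc by (simp only: growth_Suc)
  qed
  have diff: "cmod (G n' - G n) \<le> 3 / n" if "1 \<le> n" "n \<le> n'" for n n'
  proof -
    have "cmod (G n' - G n) \<le> 3 * (1 / n - 1 / n')"
      using that(2)
    proof (induction n' rule: dec_induct)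
      case (step k)
      have "G (Suc k) - G n = (G k - G n) + h k" using that(1) step.hyps by (simp add: G_def)
      then have "cmod (G (Suc k) - G n) \<le> cmod (G k - G n) + cmod (h k)"
        by (simp only: norm_triangle_ineq)
      also have "\<dots> \<le> 3 * (1 / n - 1 / k) + 3 * (1 / k - 1 / Suc k)"
        using step growth_log_increment[OF z, of k] that(1) unfolding h_def by (intro add_mono) auto
      finally show ?case by (simp add: algebra_simps)
    qed simp
    also have "\<dots> \<le> 3 / n" by (simp add: field_simps)
    finally show ?thesis .
  qed
  have "Cauchy G"
  proof (rule CauchyI)
    fix e :: real assume "e > 0"
    obtain N :: nat where N: "N > 6 / e" using reals_Archimedean2 by blast
    then have "N > 0" using \<open>e > 0\<close> by (metis divide_pos_pos less_trans of_nat_0_less_iff zero_less_numeral)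
    have "3 / N < e / 2" using N \<open>N > 0\<close> \<open>e > 0\<close> by (simp add: field_simps)
    show "\<exists>M. \<forall>m\<ge>M. \<forall>n\<ge>M. cmod (G m - G n) < e"
    proof (intro exI[of _ N] allI impI)
      fix i j assume "N \<le> i" "N \<le> j"
      then have "cmod (G i - G N) \<le> 3 / N" "cmod (G j - G N) \<le> 3 / N"
        using diff[of N] \<open>N > 0\<close> by auto
      then show "cmod (G i - G j) < e"
        using norm_triangle_ineq4[of "G i - G N" "G j - G N"] \<open>3 / N < e / 2\<close> by simp
    qed
  qed
  then obtain g where g: "G \<longlonglongrightarrow> g" using Cauchy_convergent_iff convergentD by blast
  have "cmod (G n - g) \<le> 3 / n" if "n \<ge> 1" for n
  proof -
    have "(\<lambda>k. cmod (G k - G n)) \<longlonglongrightarrow> cmod (g - G n)" by (intro tendsto_intros g)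
    then have "cmod (g - G n) \<le> 3 / n"
      by (rule tendsto_upperbound) (use diff that in \<open>auto simp: eventually_sequentially\<close>)
    then show ?thesis by (simp add: norm_minus_commute)
  qed
  with form show thesis by (rule that)
qed

lemma norm_of_nat_powr: "n \<ge> 1 \<Longrightarrow> cmod (of_nat n powr z) = real n powr Re z"
  by (subst norm_powr_real_powr) auto

lemma growth_norm_asymptotics:
  assumes z: "cmod z \<le> 1"
  obtains E :: "nat \<Rightarrow> real" and E0 where "E0 > 0" "\<And>n. E n > 0" "E \<longlonglongrightarrow> E0"
    "\<And>n. n \<ge> 1 \<Longrightarrow> (cmod (growth z n))\<^sup>2 = real n powr (2 * Re z) * E n"
proof -
  obtain G :: "nat \<Rightarrow> complex" and g where form: "\<And>n. n \<ge> 1 \<Longrightarrow> growth z n = of_nat n powr z * exp (G n)"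
    and G: "\<And>n. n \<ge> 1 \<Longrightarrow> cmod (G n - g) \<le> 3 / n"
    using growth_exp_form[OF z] by metis
  have "(\<lambda>n. 3 / real n) \<longlonglongrightarrow> 0" by real_asymp
  then have "G \<longlonglongrightarrow> g"
    by (intro LIM_zero_cancel[of G g]) (rule Lim_null_comparison, auto simp: eventually_sequentially
        intro!: exI[of _ 1] G)
  then have "(\<lambda>n. exp (2 * Re (G n))) \<longlonglongrightarrow> exp (2 * Re g)" by (intro tendsto_intros)
  moreover have "(cmod (growth z n))\<^sup>2 = real n powr (2 * Re z) * exp (2 * Re (G n))" if "n \<ge> 1" for n
  proof -
    have "(real n powr Re z)\<^sup>2 = real n powr (2 * Re z)" "(exp (Re (G n)))\<^sup>2 = exp (2 * Re (G n))"
      by (simp_all only: power2_eq_square mult_2 powr_add exp_add)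
    then show ?thesis
      unfolding form[OF that] norm_mult norm_of_nat_powr[OF that] norm_exp_eq_Re power_mult_distrib by simp
  qed
  ultimately show thesis by (intro that[of "exp (2 * Re g)" "\<lambda>n. exp (2 * Re (G n))"]) auto
qed

text \<open>
  The relative error is of order \<open>1 / n\<close> and the power is at most \<open>n\<close>, so the absolute error is even bounded.
\<close>

lemma growth_asymp_powr:
  assumes z: "cmod z \<le> 1"
  obtains a where "(\<lambda>n. cmod (growth z n - a * of_nat n powr z) / sqrt n) \<longlonglongrightarrow> 0"
proof -
  obtain G :: "nat \<Rightarrow> complex" and g where form: "\<And>n. n \<ge> 1 \<Longrightarrow> growth z n = of_nat n powr z * exp (G n)"
    and G: "\<And>n. n \<ge> 1 \<Longrightarrow> cmod (G n - g) \<le> 3 / n"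
    using growth_exp_form[OF z] by metis
  define K where "K = exp (Re g) * exp 3 * 3"
  have bound: "cmod (growth z n - exp g * of_nat n powr z) / sqrt n \<le> K / sqrt n" if "n \<ge> 1" for n
  proof (rule divide_right_mono)
    have "3 / real n \<le> 3 / 1" using that by (intro divide_left_mono) auto
    then have "\<bar>Re (G n - g)\<bar> \<le> 3" using G[OF that] abs_Re_le_cmod[of "G n - g"] by linarith
    have "cmod (exp (G n - g) - 1) \<le> exp \<bar>Re (G n - g)\<bar> * cmod (G n - g)"
      using Taylor_exp[of "G n - g" 0] by simp
    also have "\<dots> \<le> exp 3 * (3 / n)"
      using \<open>\<bar>Re (G n - g)\<bar> \<le> 3\<close> G[OF that] by (intro mult_mono) auto
    finally have e: "cmod (exp (G n - g) - 1) \<le> exp 3 * (3 / n)" .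
    have "real n powr Re z \<le> real n powr 1"
      using complex_Re_le_cmod[of z] z that by (intro powr_mono) auto
    then have p: "real n powr Re z \<le> real n" using that by simp
    have "growth z n - exp g * of_nat n powr z = of_nat n powr z * exp g * (exp (G n - g) - 1)"
      unfolding form[OF that] by (simp add: exp_diff algebra_simps)
    then have "cmod (growth z n - exp g * of_nat n powr z)
        = real n powr Re z * exp (Re g) * cmod (exp (G n - g) - 1)"
      by (simp only: norm_mult norm_of_nat_powr[OF that] norm_exp_eq_Re)
    also have "\<dots> \<le> real n * exp (Re g) * (exp 3 * (3 / n))"
      using e p by (intro mult_mono) auto
    also have "\<dots> = K" using that by (simp add: K_def)
    finally show "cmod (growth z n - exp g * of_nat n powr z) \<le> K" .
  qed simp
  have "(\<lambda>n. K / sqrt (real n)) \<longlonglongrightarrow> 0" by real_asymp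
  then have "(\<lambda>n. cmod (growth z n - exp g * of_nat n powr z) / sqrt n) \<longlonglongrightarrow> 0"
    by (rule Lim_null_comparison[rotated])
       (use bound in \<open>auto simp: eventually_sequentially intro!: exI[of _ 1]\<close>)
  then show thesis by (rule that)
qed

text \<open>
  Weight of the jump at time \<open>i\<close> in the residual at time \<open>n\<close>: past jumps for a small mode; for a large
  mode, whose limit is subtracted, future jumps with a minus sign.
\<close>

definition coef :: "complex \<Rightarrow> nat \<Rightarrow> nat \<Rightarrow> complex" where
  "coef z n i = (if Re z < 1 / 2 then if i < n then growth z n / growth z (Suc i) else 0
     else if i < n then 0 else - (growth z n / growth z (Suc i)))"

text \<open>
  With \<open>\<eta> = 1\<close> this is the limiting variance of a mode; with \<open>\<eta>\<close> tending to zero it shows that the errors made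
  in approximating the conditional variances are negligible.
\<close>

lemma coef_sums:
  assumes z: "cmod z \<le> 1" "Re z \<noteq> 1 / 2" and \<eta>: "\<eta> \<longlonglongrightarrow> (h::real)"
  obtains s :: "nat \<Rightarrow> real" where "\<And>n. n \<ge> 1 \<Longrightarrow> (\<lambda>i. (cmod (coef z n i))\<^sup>2 / n * \<eta> i) sums s n"
    and "s \<longlonglongrightarrow> h / \<bar>2 * Re z - 1\<bar>"
proof -
  obtain E E0 where E: "E0 > 0" "\<And>n. E n > 0" "E \<longlonglongrightarrow> E0"
    "\<And>n. n \<ge> 1 \<Longrightarrow> (cmod (growth z n))\<^sup>2 = real n powr (2 * Re z) * E n"
    using growth_norm_asymptotics[OF z(1)] by metis
  define \<rho> where "\<rho> = 2 * Re z"
  define c where "c i = \<eta> i / E (Suc i)" for i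
  have c: "c \<longlonglongrightarrow> h / E0"
    unfolding c_def using E by (intro tendsto_divide \<eta> filterlim_compose[OF E(3) filterlim_Suc]) auto
  have sq: "(cmod (growth z n / growth z (Suc i)))\<^sup>2 / n * \<eta> i
      = E n / real n powr (1 - \<rho>) * (real (Suc i) powr - \<rho> * c i)" if "n \<ge> 1" for n i
  proof -
    have "(cmod (growth z n / growth z (Suc i)))\<^sup>2 / n
        = (real n powr \<rho> * E n) / (real (Suc i) powr \<rho> * E (Suc i)) / n"
      unfolding norm_divide power_divide using that by (simp add: E(4) \<rho>_def del: of_nat_Suc)
    moreover have "real n powr \<rho> / n = 1 / real n powr (1 - \<rho>)"
      using that by (simp add: powr_diff)
    ultimately show ?thesis
      using that by (simp add: c_def powr_minus divide_inverse del: of_nat_Suc)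
  qed
  show thesis
  proof (cases "Re z < 1 / 2")
    case True
    then have \<rho>: "\<rho> < 1" by (simp add: \<rho>_def)
    define s where "s n = E n * ((\<Sum>i<n. real (Suc i) powr - \<rho> * c i) / real n powr (1 - \<rho>))" for n
    have "(\<lambda>i. (cmod (coef z n i))\<^sup>2 / n * \<eta> i) sums s n" if n: "n \<ge> 1" for n
    proof -
      have "(\<lambda>i. (cmod (coef z n i))\<^sup>2 / n * \<eta> i) sums (\<Sum>i<n. (cmod (coef z n i))\<^sup>2 / n * \<eta> i)"
        using True by (intro sums_finite) (auto simp: coef_def)
      also have "(\<Sum>i<n. (cmod (coef z n i))\<^sup>2 / n * \<eta> i)
          = (\<Sum>i<n. E n / real n powr (1 - \<rho>) * (real (Suc i) powr - \<rho> * c i))"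
        using True sq[OF n] by (intro sum.cong refl) (simp add: coef_def)
      also have "\<dots> = s n" by (simp add: s_def sum_divide_distrib sum_distrib_left)
      finally show ?thesis .
    qed
    moreover have "s \<longlonglongrightarrow> E0 * (h / E0 / (1 - \<rho>))"
      unfolding s_def by (intro tendsto_mult E powr_sum_head \<rho> c)
    moreover have "E0 * (h / E0 / (1 - \<rho>)) = h / \<bar>2 * Re z - 1\<bar>"
      using E(1) True by (simp add: \<rho>_def)
    ultimately show thesis using that by metis
  next
    case False
    then have \<rho>: "\<rho> > 1" using z(2) by (simp add: \<rho>_def)
    define s where "s n = E n * ((\<Sum>i. real (Suc (i + n)) powr - \<rho> * c (i + n)) / real n powr (1 - \<rho>))" for n
    have "(\<lambda>i. (cmod (coef z n i))\<^sup>2 / n * \<eta> i) sums s n" if n: "n \<ge> 1" for n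
    proof -
      let ?f = "\<lambda>i. (cmod (coef z n i))\<^sup>2 / n * \<eta> i"
      have "summable (\<lambda>i. real (Suc (i + n)) powr - \<rho> * c (i + n))"
        using powr_sum_tail(1)[OF \<rho> c] summable_iff_shift[of "\<lambda>i. real (Suc i) powr - \<rho> * c i" n]
        by simp
      then have "(\<lambda>i. E n / real n powr (1 - \<rho>) * (real (Suc (i + n)) powr - \<rho> * c (i + n))) sums
          (E n / real n powr (1 - \<rho>) * (\<Sum>i. real (Suc (i + n)) powr - \<rho> * c (i + n)))"
        by (intro sums_mult summable_sums)
      moreover have "?f (i + n) = E n / real n powr (1 - \<rho>) * (real (Suc (i + n)) powr - \<rho> * c (i
          + n))" for i
        using False sq[OF n, of "i + n"] by (simp add: coef_def)
      moreover have "E n / real n powr (1 - \<rho>) * (\<Sum>i. real (Suc (i + n)) powr - \<rho> * c (i + n)) = s n"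
        by (simp add: s_def)
      ultimately have "(\<lambda>i. ?f (i + n)) sums s n" by simp
      then have "?f sums (s n + (\<Sum>i<n. ?f i))" by (rule sums_iff_shift[of ?f n "s n", THEN iffD1])
      moreover have "(\<Sum>i<n. ?f i) = 0" using False by (intro sum.neutral) (auto simp: coef_def)
      ultimately show ?thesis by simp
    qed
    moreover have "s \<longlonglongrightarrow> E0 * (h / E0 / (\<rho> - 1))"
      unfolding s_def by (intro tendsto_mult E powr_sum_tail(2) \<rho> c)
    moreover have "E0 * (h / E0 / (\<rho> - 1)) = h / \<bar>2 * Re z - 1\<bar>"
      using E(1) False by (simp add: \<rho>_def)
    ultimately show thesis using that by metis
  qed
qed

text \<open>
  This replaces Lindeberg's condition: no single jump contributes noticeably.
\<close>

lemma coef_uniformly_small: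
  assumes z: "cmod z \<le> 1" "Re z \<noteq> 1 / 2"
  obtains \<delta> :: "nat \<Rightarrow> real" where "\<delta> \<longlonglongrightarrow> 0" "\<And>n i. n \<ge> 1 \<Longrightarrow> (cmod (coef z n i))\<^sup>2 / n \<le> \<delta> n"
proof -
  obtain E E0 where E: "E0 > 0" "\<And>n. E n > 0" "E \<longlonglongrightarrow> E0"
    "\<And>n. n \<ge> 1 \<Longrightarrow> (cmod (growth z n))\<^sup>2 = real n powr (2 * Re z) * E n"
    using growth_norm_asymptotics[OF z(1)] by metis
  obtain K1 where K1: "\<And>n. \<bar>E n\<bar> \<le> K1"
    using convergent_imp_Bseq[OF convergentI[OF E(3)]] by (auto simp: Bseq_def)
  have "(\<lambda>n. inverse (E n)) \<longlonglongrightarrow> inverse E0" using E by (intro tendsto_inverse) auto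
  from convergent_imp_Bseq[OF convergentI[OF this]]
  obtain K2 where K2: "\<And>n. \<bar>inverse (E n)\<bar> \<le> K2"
    by (auto simp: Bseq_def)
  define \<theta> where "\<theta> = (if Re z < 1 / 2 then max 0 (2 * Re z) else 0)"
  have \<theta>: "\<theta> < 1" "\<theta> \<ge> 0" by (auto simp: \<theta>_def)
  have "K1 > 0" using K1[of 0] E(2)[of 0] by linarith
  have "inverse (E 0) > 0" using E(2)[of 0] by simp
  then have "K2 > 0" using K2[of 0] by linarith
  have ratio: "(real n / real (Suc i)) powr (2 * Re z) \<le> real n powr \<theta>"
    if "n \<ge> 1" "(Re z < 1 / 2 \<and> i < n) \<or> (\<not> Re z < 1 / 2 \<and> n \<le> i)" for n i
  proof (cases "Re z < 1 / 2")
    case True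
    then have "i < n" using that by auto
    have "(real n / real (Suc i)) powr (2 * Re z) \<le> (real n / real (Suc i)) powr \<theta>"
      using True \<open>i < n\<close> by (intro powr_mono) (auto simp: \<theta>_def divide_simps)
    also have "\<dots> \<le> real n powr \<theta>"
      using \<theta> by (intro powr_mono2) (auto simp: divide_simps distrib_left)
    finally show ?thesis .
  next
    case False
    then have "n \<le> i" using that by auto
    then have "(real n / real (Suc i)) powr (2 * Re z) \<le> 1 powr (2 * Re z)"
      using False by (intro powr_mono2) (auto simp: divide_simps)
    then show ?thesis using False \<open>n \<ge> 1\<close> by (simp add: \<theta>_def)
  qed
  have bound: "(cmod (coef z n i))\<^sup>2 / n \<le> K1 * K2 * (real n powr \<theta> / n)" if n: "n \<ge> 1" for n i
  proof (cases "(Re z < 1 / 2 \<and> i < n) \<or> (\<not> Re z < 1 / 2 \<and> n \<le> i)")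
    case True
    then have "(cmod (coef z n i))\<^sup>2 = (cmod (growth z n))\<^sup>2 / (cmod (growth z (Suc i)))\<^sup>2"
      by (auto simp: coef_def norm_divide power_divide)
    also have "\<dots> = (real n / real (Suc i)) powr (2 * Re z) * (E n * inverse (E (Suc i)))"
    proof -
      have eq: "(p * e) / (q * f) = p / q * (e * inverse f)" for p q e f :: real
        by (simp add: divide_inverse)
      have Si: "1 \<le> Suc i" by simp
      from eq[of "real n powr (2 * Re z)" "E n" "real (Suc i) powr (2 * Re z)" "E (Suc i)"]
      show ?thesis using n by (simp only: E(4)[OF n] E(4)[OF Si] powr_divide of_nat_0_le_iff)
    qed
    also have "\<dots> \<le> real n powr \<theta> * (K1 * K2)"
      using ratio[OF n True] E(2)[of n] E(2)[of "Suc i"] K1[of n] K2[of "Suc i"] \<open>K1 > 0\<close>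
      by (intro mult_mono) auto
    finally show ?thesis by (simp add: divide_right_mono mult.commute)
  next
    case False
    then have "coef z n i = 0" by (auto simp: coef_def)
    then show ?thesis using \<open>K1 > 0\<close> \<open>K2 > 0\<close> by simp
  qed
  have "(\<lambda>n. K1 * K2 * (real n powr \<theta> / n)) \<longlonglongrightarrow> K1 * K2 * 0"
  proof (intro tendsto_mult_left)
    have "(\<lambda>n. real n powr (\<theta> - 1)) \<longlonglongrightarrow> 0"
      using \<theta> by (intro tendsto_neg_powr filterlim_real_sequentially) auto
    moreover have "real n powr (\<theta> - 1) = real n powr \<theta> / n" for n by (simp add: powr_diff)
    ultimately show "(\<lambda>n. real n powr \<theta> / n) \<longlonglongrightarrow> 0" by simp
  qed
  then have "(\<lambda>n. K1 * K2 * (real n powr \<theta> / n)) \<longlonglongrightarrow> 0" by (simp only: mult_zero_right)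
  with bound show thesis by (intro that)
qed

section \<open>Sums of martingale increments of the urn\<close>

lemma sum_reflect: "(\<Sum>k = 1..<m. f (m - k)) = (\<Sum>k = 1..<(m::nat). f k)"
  by (rule sum.reindex_bij_witness[of _ "\<lambda>k. m - k" "\<lambda>k. m - k"]) auto

context cyclic_urn
begin

lemma expectation_mult_null:
  fixes d :: "nat list \<Rightarrow> 'b::{real_normed_algebra, banach, second_countable_topology}"
  assumes "\<And>l. length l = Suc n \<Longrightarrow> (\<Sum>j\<le>n. d (draw l j)) = 0"
  shows "(\<integral>x. g (hist n x) * d (hist (Suc n) x) \<partial>M) = 0"
proof -
  have "(\<integral>x. g (hist n x) * d (hist (Suc n) x) \<partial>M)
      = (\<integral>x. (\<Sum>j\<le>n. g (hist n x) * d (draw (hist n x) j)) /\<^sub>R Suc n \<partial>M)"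
    by (rule expectation_step)
  also have "\<dots> = (\<integral>x. 0 \<partial>M)"
    using assms by (intro Bochner_Integration.integral_cong refl) (simp flip: sum_distrib_left)
  finally show ?thesis by simp
qed

lemma expectation_inner_null:
  fixes d g :: "nat list \<Rightarrow> complex"
  assumes "\<And>l. length l = Suc n \<Longrightarrow> (\<Sum>j\<le>n. d (draw l j)) = 0"
  shows "(\<integral>x. g (hist n x) \<bullet> d (hist (Suc n) x) \<partial>M) = 0"
proof -
  have "(\<integral>x. g (hist n x) \<bullet> d (hist (Suc n) x) \<partial>M)
      = (\<integral>x. (\<Sum>j\<le>n. g (hist n x) \<bullet> d (draw (hist n x) j)) /\<^sub>R Suc n \<partial>M)"
    by (rule expectation_step)
  also have "\<dots> = (\<integral>x. 0 \<partial>M)"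
    using assms by (intro Bochner_Integration.integral_cong refl) (simp flip: inner_sum_right)
  finally show ?thesis by simp
qed

text \<open>
  Puts a sum of increments into the form of a function of the last history, so that
  \<open>expectation_step\<close> applies.
\<close>

lemma history_sum:
  fixes d :: "nat \<Rightarrow> nat list \<Rightarrow> 'b::comm_monoid_add"
  shows "(\<Sum>i<n. d i (hist (Suc i) x)) = (\<Sum>i<n. d i (take (Suc (Suc i)) (hist n x)))"
  by (intro sum.cong refl arg_cong[where f = "d _"] take_hist[symmetric]) auto

lemma second_moment_history_sum:
  fixes d :: "nat \<Rightarrow> nat list \<Rightarrow> complex"
  assumes mean: "\<And>i l. length l = Suc i \<Longrightarrow> (\<Sum>j\<le>i. d i (draw l j)) = 0"
    and B: "\<And>i l. cmod (d i l) \<le> B i"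
  shows "(\<integral>x. (cmod (\<Sum>i<N. d i (hist (Suc i) x)))\<^sup>2 \<partial>M) \<le> (\<Sum>i<N. (B i)\<^sup>2)"
proof -
  have "(\<integral>x. (cmod (\<Sum>i<N. d i (hist (Suc i) x)))\<^sup>2 \<partial>M) = (\<Sum>i<N. \<integral>x. (cmod (d i (hist (Suc i) x)))\<^sup>2 \<partial>M)"
  proof (rule orthogonal_sum_second_moment)
    show "(\<lambda>x. d i (hist (Suc i) x)) \<in> borel_measurable M" for i by (rule measurable_comp_hist)
    show "cmod (d i (hist (Suc i) x)) \<le> B i" for i x by (rule B)
    show "(\<integral>x. (\<Sum>j<i. d j (hist (Suc j) x)) \<bullet> d i (hist (Suc i) x) \<partial>M) = 0" for i
      unfolding history_sum
      by (rule expectation_inner_null[of i "d i" "\<lambda>l. \<Sum>j<i. d j (take (Suc (Suc j)) l)", OF mean])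
  qed
  also have "\<dots> \<le> (\<Sum>i<N. (B i)\<^sup>2)"
  proof (rule sum_mono)
    fix i
    have "(\<integral>x. (cmod (d i (hist (Suc i) x)))\<^sup>2 \<partial>M) \<le> (\<integral>x. (B i)\<^sup>2 \<partial>M)"
    proof (rule integral_mono)
      show "integrable M (\<lambda>x. (cmod (d i (hist (Suc i) x)))\<^sup>2)"
        by (rule integrable_comp_hist[of "\<lambda>l. (cmod (d i l))\<^sup>2"])
      show "(cmod (d i (hist (Suc i) x)))\<^sup>2 \<le> (B i)\<^sup>2" for x by (intro power_mono B norm_ge_zero)
    qed simp
    then show "(\<integral>x. (cmod (d i (hist (Suc i) x)))\<^sup>2 \<partial>M) \<le> (B i)\<^sup>2" by (simp add: prob_space)
  qed
  finally show ?thesis .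
qed

lemma jump_reflect: "k \<le> m \<Longrightarrow> jump (m - k) l = cnj (jump k l)"
proof -
  assume k: "k \<le> m"
  have p: "\<omega> ^ ((m - k) * a) = cnj (\<omega> ^ (k * a))" for a
    by (simp only: power_mult cnj_omega_power[OF m_pos k, symmetric] complex_cnj_power)
  have "mode (m - k) l' = cnj (mode k l')" for l'
    unfolding mode_def p by (induction l') auto
  then show ?thesis
    unfolding jump_def p using cnj_omega_power[OF m_pos k]
    by (simp only: complex_cnj_diff complex_cnj_divide complex_cnj_mult complex_cnj_of_nat)
qed

text \<open>
  The symmetry of the coefficients under \<open>k \<mapsto> m - k\<close> makes the terms pair up into conjugates.
\<close>

lemma wjump_real:
  assumes "\<And>k. k \<in> {1..<m} \<Longrightarrow> a (m - k) = cnj (a k)"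
  shows "of_real (Re (wjump a l)) = wjump a l"
proof -
  have "cnj (wjump a l) = (\<Sum>k = 1..<m. a (m - k) * jump (m - k) l)"
    unfolding wjump_def cnj_sum using assms by (intro sum.cong refl) (simp add: jump_reflect)
  also have "\<dots> = wjump a l" unfolding wjump_def by (rule sum_reflect)
  finally show ?thesis by (metis Reals_cnj_iff of_real_Re)
qed

text \<open>
  An instance of \<open>char_martingale_sum\<close>. Since the weighted jump is real, its square is the square of its modulus, and
  only covariances between a mode and the conjugate of a mode occur; \<open>mean_norm_wjump\<close> evaluates them.
\<close>

lemma char_weighted_jumps:
  fixes a :: "nat \<Rightarrow> nat \<Rightarrow> complex" and \<delta> :: real
  defines "v \<equiv> (\<lambda>i. \<Sum>k = 1..<m. (cmod (a i k))\<^sup>2)"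
  assumes sym: "\<And>i k. k \<in> {1..<m} \<Longrightarrow> a i (m - k) = cnj (a i k)"
    and \<delta>: "\<And>i. v i \<le> \<delta>"
  shows "cmod ((CLINT x|M. iexp (\<Sum>i<N. Re (wjump (a i) (hist (Suc i) x))))
      - complex_of_real (exp (- (\<Sum>i<N. v i) / 2)))
    \<le> (\<Sum>i<N. v i * (m * (\<integral>x. imbalance (hist i x) \<partial>M) + 4 * m * sqrt (4 * m * \<delta>) / 6 + \<delta> / 4))"
proof -
  let ?err = "\<lambda>i. m * (\<integral>x. imbalance (hist i x) \<partial>M) + 4 * m * sqrt (4 * m * \<delta>) / 6 + \<delta> / 4"
  define d where "d i l = Re (wjump (a i) l)" for i l
  let ?cube = "\<lambda>i. \<integral>x. \<bar>d i (hist (Suc i) x)\<bar> ^ 3 \<partial>M"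
  define e where "e i = 2 * m * (\<integral>x. imbalance (hist i x) \<partial>M) * v i" for i
  have v0: "v i \<ge> 0" for i by (simp add: v_def sum_nonneg)
  have dsq: "(d i l)\<^sup>2 = (cmod (wjump (a i) l))\<^sup>2" for i l
  proof -
    have "complex_of_real (d i l) = wjump (a i) l"
      unfolding d_def using sym by (intro wjump_real) auto
    then show ?thesis by (metis norm_of_real power2_abs)
  qed
  have dB: "\<bar>d i l\<bar> \<le> sqrt (4 * m * v i)" for i l
  proof (rule real_le_rsqrt)
    have "\<bar>d i l\<bar>\<^sup>2 \<le> (2 * (\<Sum>k = 1..<m. cmod (a i k)))\<^sup>2"
      using norm_wjump_le[of "a i" l] unfolding power2_abs dsq by (intro power_mono) auto
    also have "\<dots> \<le> 4 * (m * v i)"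
      unfolding power_mult_distrib v_def using sum_norm_squared_le[of "a i"] by simp
    finally show "\<bar>d i l\<bar>\<^sup>2 \<le> 4 * m * v i" by simp
  qed
  have mean: "(\<Sum>j\<le>i. complex_of_real (d i (draw l j))) = 0" if "length l = Suc i" for i l
  proof -
    have "complex_of_real (d i l) = wjump (a i) l" for l
      unfolding d_def using sym by (intro wjump_real) auto
    then show ?thesis using sum_wjump[OF that] by simp
  qed
  have "cmod ((CLINT x|M. iexp (\<Sum>i<N. d i (hist (Suc i) x))) - complex_of_real (exp (- (\<Sum>i<N. v i) / 2)))
    \<le> (\<Sum>i<N. e i / 2 + ?cube i / 6 + (v i)\<^sup>2 / 4)"
  proof (rule char_martingale_sum)
    show "(\<lambda>x. d i (hist (Suc i) x)) \<in> borel_measurable M" for i by (rule measurable_comp_hist)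
    show "\<bar>d i (hist (Suc i) x)\<bar> \<le> sqrt (4 * m * v i)" for i x by (rule dB)
    show "0 \<le> v i" for i by (rule v0)
    show "(CLINT x|M. iexp (\<Sum>j<i. d j (hist (Suc j) x)) * complex_of_real (d i (hist (Suc i) x))) = 0" for i
      unfolding history_sum
      by (rule expectation_mult_null[of i "\<lambda>l. complex_of_real (d i l)" "\<lambda>l. iexp (\<Sum>j<i. d j (take (Suc
          (Suc j)) l))", OF mean])
    show "cmod (CLINT x|M. iexp (\<Sum>j<i. d j (hist (Suc j) x)) * complex_of_real ((d i (hist (Suc i) x))\<^sup>2
        - v i)) \<le> e i" for i
    proof -
      let ?g = "\<lambda>l. iexp (\<Sum>j<i. d j (take (Suc (Suc j)) l))"
      let ?V = "\<lambda>l. (\<Sum>j\<le>i. (d i (draw l j))\<^sup>2) / Suc i - v i"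
      have g1: "cmod (?g l) = 1" for l by simp
      have "(CLINT x|M. iexp (\<Sum>j<i. d j (hist (Suc j) x)) * (complex_of_real ((d i (hist (Suc i) x))\<^sup>2)
          - complex_of_real (v i)))
        = (CLINT x|M. (\<Sum>j\<le>i. ?g (hist i x) * (complex_of_real ((d i (draw (hist i x) j))\<^sup>2)
            - complex_of_real (v i))) /\<^sub>R Suc i)"
        unfolding history_sum
        by (rule expectation_step[of "\<lambda>l l'. ?g l * (complex_of_real ((d i l')\<^sup>2)
            - complex_of_real (v i))" i])
      also have "\<dots> = (CLINT x|M. ?g (hist i x) * complex_of_real (?V (hist i x)))"
      proof (rule Bochner_Integration.integral_cong[OF refl])
        fix x
        have "(\<Sum>j\<le>i. c * (complex_of_real (f j) - complex_of_real w)) /\<^sub>R Suc i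
            = c * complex_of_real ((\<Sum>j\<le>i. f j) / Suc i - w)" for c f w
        proof -
          have "(\<Sum>j\<le>i. c * (complex_of_real (f j) - complex_of_real w))
              = c * complex_of_real ((\<Sum>j\<le>i. f j) - Suc i * w)"
            by (simp add: sum_distrib_left[symmetric] sum_subtractf del: of_nat_Suc)
          then show ?thesis by (simp add: scaleR_conv_of_real field_simps del: of_nat_Suc)
        qed
        then show "(\<Sum>j\<le>i. ?g (hist i x) * (complex_of_real ((d i (draw (hist i x) j))\<^sup>2)
            - complex_of_real (v i))) /\<^sub>R Suc i
          = ?g (hist i x) * complex_of_real (?V (hist i x))" .
      qed
      finally have eq: "(CLINT x|M. iexp (\<Sum>j<i. d j (hist (Suc j) x))
          * (complex_of_real ((d i (hist (Suc i) x))\<^sup>2) - complex_of_real (v i)))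
        = (CLINT x|M. ?g (hist i x) * complex_of_real (?V (hist i x)))" .
      have "cmod (CLINT x|M. ?g (hist i x) * complex_of_real (?V (hist i x)))
          \<le> (\<integral>x. cmod (?g (hist i x) * complex_of_real (?V (hist i x))) \<partial>M)"
        by (rule integral_norm_bound)
      also have "\<dots> \<le> (\<integral>x. 2 * m * v i * imbalance (hist i x) \<partial>M)"
      proof (rule integral_mono)
        show "integrable M (\<lambda>x. cmod (?g (hist i x) * complex_of_real (?V (hist i x))))"
          by (rule integrable_comp_hist[of "\<lambda>l. cmod (?g l * complex_of_real (?V l))" i])
        show "integrable M (\<lambda>x. 2 * m * v i * imbalance (hist i x))"
          by (rule integrable_comp_hist[of "\<lambda>l. 2 * m * v i * imbalance l" i])
        show "cmod (?g (hist i x) * complex_of_real (?V (hist i x)))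
            \<le> 2 * m * v i * imbalance (hist i x)" for x
        proof -
          have "\<bar>?V (hist i x)\<bar> \<le> 2 * m * imbalance (hist i x) * v i"
            unfolding dsq v_def by (rule mean_norm_wjump) simp
          then show ?thesis unfolding norm_mult g1 norm_of_real by (simp only: mult_1 mult_ac)
        qed
      qed
      also have "\<dots> = e i" by (simp add: e_def)
      finally show ?thesis unfolding of_real_diff eq .
    qed
  qed
  also have "\<dots> \<le> (\<Sum>i<N. v i * ?err i)"
  proof (rule sum_mono)
    fix i
    have "?cube i \<le> (\<integral>x. (4 * m * v i) * sqrt (4 * m * \<delta>) \<partial>M)"
    proof (rule integral_mono)
      show "integrable M (\<lambda>x. \<bar>d i (hist (Suc i) x)\<bar> ^ 3)"
        by (rule integrable_comp_hist[of "\<lambda>l. \<bar>d i l\<bar> ^ 3" "Suc i"])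
      show "\<bar>d i (hist (Suc i) x)\<bar> ^ 3 \<le> (4 * m * v i) * sqrt (4 * m * \<delta>)" for x
      proof -
        have "\<bar>d i (hist (Suc i) x)\<bar> ^ 3 \<le> sqrt (4 * m * v i) ^ 3" by (intro power_mono dB) simp
        also have "\<dots> = (4 * m * v i) * sqrt (4 * m * v i)" using v0[of i] by (simp add: power3_eq_cube)
        also have "\<dots> \<le> (4 * m * v i) * sqrt (4 * m * \<delta>)"
          using \<delta>[of i] v0[of i] by (intro mult_left_mono real_sqrt_le_mono) (auto intro: mult_left_mono)
        finally show ?thesis .
      qed
    qed simp
    then have 3: "?cube i \<le> (4 * m * v i) * sqrt (4 * m * \<delta>)"
      by (simp add: prob_space)
    have "(v i)\<^sup>2 \<le> v i * \<delta>" unfolding power2_eq_square by (intro mult_left_mono \<delta> v0)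
    with 3 have "e i / 2 + ?cube i / 6 + (v i)\<^sup>2 / 4
       \<le> e i / 2 + (4 * m * v i) * sqrt (4 * m * \<delta>) / 6 + v i * \<delta> / 4" by simp
    also have "\<dots> = v i * ?err i"
      by (simp add: e_def algebra_simps)
    finally show "e i / 2 + ?cube i / 6 + (v i)\<^sup>2 / 4
       \<le> v i * ?err i" .
  qed
  finally show ?thesis unfolding d_def .
qed

end

section \<open>The central limit theorem for a triangular array of jumps\<close>

context cyclic_urn
begin

lemma cmod_omega_power [simp]: "cmod (\<omega> ^ k) \<le> 1"
  by (simp add: norm_power)

lemma Re_omega_power: "Re (\<omega> ^ k) = lam m k"
  by (simp add: lam_def)

text \<open>
  The weights in row \<open>n\<close> of the triangular array, for the functional with Fourier coefficients \<open>\<tau>\<close>.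
\<close>

definition row_coef :: "(nat \<Rightarrow> complex) \<Rightarrow> nat \<Rightarrow> nat \<Rightarrow> nat \<Rightarrow> complex" where
  "row_coef \<tau> n i k = \<tau> k * (coef (\<omega> ^ k) n i / sqrt n)"

definition row_var :: "(nat \<Rightarrow> complex) \<Rightarrow> nat \<Rightarrow> nat \<Rightarrow> real" where
  "row_var \<tau> n i = (\<Sum>k = 1..<m. (cmod (row_coef \<tau> n i k))\<^sup>2)"

definition row_sum :: "(nat \<Rightarrow> complex) \<Rightarrow> nat \<Rightarrow> nat \<Rightarrow> 'a \<Rightarrow> real" where
  "row_sum \<tau> n N x = (\<Sum>i<N. Re (wjump (row_coef \<tau> n i) (hist (Suc i) x)))"

lemma row_var_nonneg: "0 \<le> row_var \<tau> n i"
  by (simp add: row_var_def sum_nonneg)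

lemma row_var_eq: "row_var \<tau> n i = (\<Sum>k = 1..<m. (cmod (\<tau> k))\<^sup>2 * ((cmod (coef (\<omega> ^ k) n i))\<^sup>2 / n))"
  unfolding row_var_def row_coef_def norm_mult norm_divide power_mult_distrib power_divide
  by (simp only: norm_of_real abs_of_nonneg[OF real_sqrt_ge_zero[OF of_nat_0_le_iff]] real_sqrt_pow2[OF
      of_nat_0_le_iff])

lemma row_coef_reflect:
  assumes "k \<in> {1..<m}" "\<tau> (m - k) = cnj (\<tau> k)"
  shows "row_coef \<tau> n i (m - k) = cnj (row_coef \<tau> n i k)"
proof -
  have w: "\<omega> ^ (m - k) = cnj (\<omega> ^ k)" using assms m_pos by (intro cnj_omega_power[symmetric]) auto
  have c: "coef (cnj z) n i = cnj (coef z n i)" for z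
    by (auto simp: coef_def growth_cnj)
  show ?thesis
    unfolding row_coef_def w assms(2) c
    by (simp only: complex_cnj_mult complex_cnj_divide complex_cnj_complex_of_real)
qed

lemma row_var_sums:
  assumes lam: "\<And>k. k \<in> {1..<m} \<Longrightarrow> lam m k \<noteq> 1 / 2" and \<eta>: "\<eta> \<longlonglongrightarrow> (h::real)"
  obtains s :: "nat \<Rightarrow> real" where "\<And>n. n \<ge> 1 \<Longrightarrow> (\<lambda>i. row_var \<tau> n i * \<eta> i) sums s n"
    and "s \<longlonglongrightarrow> (\<Sum>k = 1..<m. (cmod (\<tau> k))\<^sup>2 * (h / \<bar>2 * lam m k - 1\<bar>))"
proof -
  have "\<forall>k\<in>{1..<m}. \<exists>s. (\<forall>n\<ge>1. (\<lambda>i. (cmod (coef (\<omega> ^ k) n i))\<^sup>2 / n * \<eta> i) sums s n)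
      \<and> s \<longlonglongrightarrow> h / \<bar>2 * lam m k - 1\<bar>"
  proof
    fix k assume k: "k \<in> {1..<m}"
    show "\<exists>s. (\<forall>n\<ge>1. (\<lambda>i. (cmod (coef (\<omega> ^ k) n i))\<^sup>2 / n * \<eta> i) sums s n)
      \<and> s \<longlonglongrightarrow> h / \<bar>2 * lam m k - 1\<bar>"
    proof (rule coef_sums[OF cmod_omega_power[of k] _ \<eta>])
      show "Re (\<omega> ^ k) \<noteq> 1 / 2" unfolding Re_omega_power by (rule lam[OF k])
    qed (unfold Re_omega_power, intro exI conjI allI impI)
  qed
  from bchoice[OF this]
  obtain s where s': "\<forall>k\<in>{1..<m}. (\<forall>n\<ge>1. (\<lambda>i. (cmod (coef (\<omega> ^ k) n i))\<^sup>2 / n * \<eta> i) sums s k n)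
      \<and> s k \<longlonglongrightarrow> h / \<bar>2 * lam m k - 1\<bar>"
    by (elim exE)
  have s: "\<And>k n. k \<in> {1..<m} \<Longrightarrow> n \<ge> 1 \<Longrightarrow> (\<lambda>i. (cmod (coef (\<omega> ^ k) n i))\<^sup>2 / n * \<eta> i) sums s k n"
    "\<And>k. k \<in> {1..<m} \<Longrightarrow> s k \<longlonglongrightarrow> h / \<bar>2 * lam m k - 1\<bar>"
    using s' by blast+
  show thesis
  proof (rule that[of "\<lambda>n. \<Sum>k = 1..<m. (cmod (\<tau> k))\<^sup>2 * s k n"])
    show "(\<lambda>i. row_var \<tau> n i * \<eta> i) sums (\<Sum>k = 1..<m. (cmod (\<tau> k))\<^sup>2 * s k n)" if "n \<ge> 1" for n
    proof -
      have "row_var \<tau> n i * \<eta> i = (\<Sum>k = 1..<m. (cmod (\<tau> k))\<^sup>2 * ((cmod (coef (\<omega> ^ k) n i))\<^sup>2 / n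
          * \<eta> i))" for i
        unfolding row_var_eq sum_distrib_right by (simp only: mult.assoc)
      then show ?thesis by (simp only:) (intro sums_sum sums_mult s that)
    qed
    show "(\<lambda>n. \<Sum>k = 1..<m. (cmod (\<tau> k))\<^sup>2 * s k n) \<longlonglongrightarrow> (\<Sum>k = 1..<m. (cmod (\<tau> k))\<^sup>2 * (h / \<bar>2 * lam m k - 1\<bar>))"
      by (intro tendsto_sum tendsto_mult_left s)
  qed
qed

lemma row_var_uniformly_small:
  assumes lam: "\<And>k. k \<in> {1..<m} \<Longrightarrow> lam m k \<noteq> 1 / 2"
  obtains \<delta> :: "nat \<Rightarrow> real" where "\<delta> \<longlonglongrightarrow> 0" "\<And>n i. n \<ge> 1 \<Longrightarrow> row_var \<tau> n i \<le> \<delta> n"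
proof -
  have "\<forall>k\<in>{1..<m}. \<exists>\<delta>::nat \<Rightarrow> real. \<delta> \<longlonglongrightarrow> 0
      \<and> (\<forall>n i. n \<ge> 1 \<longrightarrow> (cmod (coef (\<omega> ^ k) n i))\<^sup>2 / n \<le> \<delta> n)"
  proof
    fix k assume k: "k \<in> {1..<m}"
    show "\<exists>\<delta>::nat \<Rightarrow> real. \<delta> \<longlonglongrightarrow> 0
      \<and> (\<forall>n i. n \<ge> 1 \<longrightarrow> (cmod (coef (\<omega> ^ k) n i))\<^sup>2 / n \<le> \<delta> n)"
    proof (rule coef_uniformly_small[OF cmod_omega_power[of k]])
      show "Re (\<omega> ^ k) \<noteq> 1 / 2" unfolding Re_omega_power by (rule lam[OF k])
    qed (intro exI conjI allI impI)
  qed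
  from bchoice[OF this]
  obtain \<delta> :: "nat \<Rightarrow> nat \<Rightarrow> real" where \<delta>': "\<forall>k\<in>{1..<m}. \<delta> k \<longlonglongrightarrow> 0
      \<and> (\<forall>n i. n \<ge> 1 \<longrightarrow> (cmod (coef (\<omega> ^ k) n i))\<^sup>2 / n \<le> \<delta> k n)"
    by (elim exE)
  have \<delta>: "\<And>k. k \<in> {1..<m} \<Longrightarrow> \<delta> k \<longlonglongrightarrow> (0::real)"
    "\<And>k n i. k \<in> {1..<m} \<Longrightarrow> n \<ge> 1 \<Longrightarrow> (cmod (coef (\<omega> ^ k) n i))\<^sup>2 / n \<le> \<delta> k n"
    using \<delta>' by blast+
  show thesis
  proof (rule that[of "\<lambda>n. \<Sum>k = 1..<m. (cmod (\<tau> k))\<^sup>2 * \<delta> k n"])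
    show "row_var \<tau> n i \<le> (\<Sum>k = 1..<m. (cmod (\<tau> k))\<^sup>2 * \<delta> k n)" if "n \<ge> 1" for n i
      unfolding row_var_eq by (intro sum_mono mult_left_mono \<delta> that) auto
    have "(\<lambda>n. \<Sum>k = 1..<m. (cmod (\<tau> k))\<^sup>2 * \<delta> k n) \<longlonglongrightarrow> (\<Sum>k = 1..<m. (cmod (\<tau> k))\<^sup>2 * 0)"
      by (intro tendsto_sum tendsto_mult_left \<delta>)
    then show "(\<lambda>n. \<Sum>k = 1..<m. (cmod (\<tau> k))\<^sup>2 * \<delta> k n) \<longlonglongrightarrow> 0" by simp
  qed
qed

lemma row_sum_function_of_history:
  "row_sum \<tau> n N x = (\<Sum>i<N. Re (wjump (row_coef \<tau> n i) (take (Suc (Suc i)) (hist N x))))"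
  unfolding row_sum_def by (rule history_sum)

lemma integrable_row_sum: "integrable M (row_sum \<tau> n N)"
  unfolding row_sum_function_of_history[abs_def]
  by (rule integrable_comp_hist[of "\<lambda>l. \<Sum>i<N. Re (wjump (row_coef \<tau> n i) (take (Suc (Suc i)) l))" N])

lemma second_moment_row_sum:
  "(\<integral>x. \<bar>row_sum \<tau> n N x\<bar> \<partial>M) \<le> sqrt (4 * m * (\<Sum>i<N. row_var \<tau> n i))"
proof (rule real_le_rsqrt)
  have "(\<integral>x. \<bar>row_sum \<tau> n N x\<bar> \<partial>M)\<^sup>2 \<le> (\<integral>x. \<bar>row_sum \<tau> n N x\<bar>\<^sup>2 \<partial>M)"
  proof (rule expectation_squared_le)
    show "integrable M (\<lambda>x. \<bar>row_sum \<tau> n N x\<bar>)" by (rule integrable_abs[OF integrable_row_sum])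
    show "integrable M (\<lambda>x. \<bar>row_sum \<tau> n N x\<bar>\<^sup>2)"
      unfolding row_sum_function_of_history[abs_def]
      by (rule integrable_comp_hist[of "\<lambda>l. \<bar>\<Sum>i<N. Re (wjump (row_coef \<tau> n i) (take (Suc (Suc i)) l))\<bar>\<^sup>2"
          N])
  qed
  also have "\<dots> = (\<integral>x. (cmod (\<Sum>i<N. complex_of_real (Re (wjump (row_coef \<tau> n i) (hist (Suc i) x)))))\<^sup>2 \<partial>M)"
    unfolding row_sum_def of_real_sum[symmetric] norm_of_real ..
  also have "\<dots> \<le> (\<Sum>i<N. (2 * (\<Sum>k = 1..<m. cmod (row_coef \<tau> n i k)))\<^sup>2)"
  proof (rule second_moment_history_sum)
    show "(\<Sum>j\<le>i. complex_of_real (Re (wjump (row_coef \<tau> n i) (draw l j)))) = 0" if "length l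
        = Suc i" for i l
      unfolding of_real_sum[symmetric] Re_sum[symmetric] sum_wjump[OF that] by simp
    show "cmod (complex_of_real (Re (wjump (row_coef \<tau> n i) l))) \<le> 2 * (\<Sum>k
        = 1..<m. cmod (row_coef \<tau> n i k))" for i l
      unfolding norm_of_real by (rule order_trans[OF abs_Re_le_cmod norm_wjump_le])
  qed
  also have "\<dots> \<le> (\<Sum>i<N. 4 * m * row_var \<tau> n i)"
  proof (rule sum_mono)
    show "(2 * (\<Sum>k = 1..<m. cmod (row_coef \<tau> n i k)))\<^sup>2 \<le> 4 * m * row_var \<tau> n i" for i
      unfolding power_mult_distrib row_var_def using sum_norm_squared_le[of "row_coef \<tau> n i"] by simp
  qed
  finally show "(\<integral>x. \<bar>row_sum \<tau> n N x\<bar> \<partial>M)\<^sup>2 \<le> 4 * m * (\<Sum>i<N. row_var \<tau> n i)"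
    by (simp only: sum_distrib_left)
qed

text \<open>
  The estimate for a finite row is uniform in its length \<open>N\<close>, so \<open>N\<close> can tend to infinity for fixed \<open>n\<close>; this is
  needed because the residual of a large mode involves all future jumps. The sums \<open>s1\<close> and \<open>s2\<close> below are the total
  error of the conditional variances and the total variance of row \<open>n\<close>.
\<close>

lemma CLT_weighted_sums:
  fixes X :: "nat \<Rightarrow> 'a \<Rightarrow> real" and b :: "nat \<Rightarrow> real" and d :: "nat \<Rightarrow> nat \<Rightarrow> real"
  defines "q \<equiv> \<lambda>\<tau>. \<Sum>k = 1..<m. (cmod (\<tau> k))\<^sup>2 / \<bar>2 * lam m k - 1\<bar>"
  assumes lam: "\<And>k. k \<in> {1..<m} \<Longrightarrow> lam m k \<noteq> 1 / 2"
    and \<tau>: "\<And>k. k \<in> {1..<m} \<Longrightarrow> \<tau> (m - k) = cnj (\<tau> k)"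
    and X: "\<And>n. integrable M (X n)"
    and close: "\<And>n N. n \<ge> 1 \<Longrightarrow> n \<le> N \<Longrightarrow> (\<integral>x. \<bar>X n x - row_sum \<tau> n N x\<bar> \<partial>M) \<le> b n + d n N"
    and b: "b \<longlonglongrightarrow> 0" and d: "\<And>n. n \<ge> 1 \<Longrightarrow> d n \<longlonglongrightarrow> 0"
  shows "(\<lambda>n. CLINT x|M. iexp (X n x)) \<longlonglongrightarrow> complex_of_real (exp (- q \<tau> / 2))"
    and "\<exists>B. \<forall>n\<ge>1. (\<integral>x. \<bar>X n x\<bar> \<partial>M) \<le> B"
proof -
  define \<eta> where "\<eta> i = (\<integral>x. imbalance (hist i x) \<partial>M)" for i
  have \<eta>: "\<eta> \<longlonglongrightarrow> 0" unfolding \<eta>_def by (rule expectation_imbalance_tendsto_0)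
  have \<eta>0: "\<eta> i \<ge> 0" for i unfolding \<eta>_def by (intro Bochner_Integration.integral_nonneg imbalance_nonneg)
  obtain s1 where s1: "\<And>n. n \<ge> 1 \<Longrightarrow> (\<lambda>i. row_var \<tau> n i * \<eta> i) sums s1 n" "s1 \<longlonglongrightarrow> 0"
    using row_var_sums[OF lam \<eta>, of \<tau>] by (auto simp only: div_0 mult_zero_right sum.neutral_const)
  obtain s2 where s2: "\<And>n. n \<ge> 1 \<Longrightarrow> (\<lambda>i. row_var \<tau> n i) sums s2 n" "s2 \<longlonglongrightarrow> q \<tau>"
    using row_var_sums[OF lam tendsto_const[of 1], of \<tau>] unfolding q_def
    by (auto simp only: mult_1_right times_divide_eq_right)
  obtain \<delta> where \<delta>: "\<delta> \<longlonglongrightarrow> 0" "\<And>n i. n \<ge> 1 \<Longrightarrow> row_var \<tau> n i \<le> \<delta> n"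
    using row_var_uniformly_small[OF lam, of \<tau>] by metis
  define c where "c n = 4 * m * sqrt (4 * m * \<delta> n) / 6 + \<delta> n / 4" for n
  define \<epsilon> where "\<epsilon> n = m * s1 n + s2 n * c n" for n
  have "(\<lambda>n. real (4 * m) * \<delta> n) \<longlonglongrightarrow> real (4 * m) * 0" by (intro tendsto_mult_left \<delta>)
  then have "c \<longlonglongrightarrow> real (4 * m) * sqrt (real (4 * m) * 0) / 6 + 0 / 4"
    unfolding c_def
    by (intro tendsto_add tendsto_divide tendsto_mult_left tendsto_real_sqrt tendsto_const \<delta>) auto
  then have c: "c \<longlonglongrightarrow> 0" by simp
  have "\<epsilon> \<longlonglongrightarrow> real m * 0 + q \<tau> * 0"
    unfolding \<epsilon>_def by (intro tendsto_add tendsto_mult tendsto_const s1 s2 c)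
  then have \<epsilon>: "\<epsilon> \<longlonglongrightarrow> 0" by simp
  let ?\<phi> = "\<lambda>n. CLINT x|M. iexp (X n x)" and ?w = "\<lambda>n N. CLINT x|M. iexp (row_sum \<tau> n N x)"
  have main: "cmod (?w n N - complex_of_real (exp (- (\<Sum>i<N. row_var \<tau> n i) / 2)))
      \<le> \<epsilon> n" if n: "n \<ge> 1" for n N
  proof -
    have "\<delta> n \<ge> 0" using row_var_nonneg \<delta>(2)[OF n] order_trans by blast
    then have c0: "c n \<ge> 0" unfolding c_def by simp
    have "cmod (?w n N - complex_of_real (exp (- (\<Sum>i<N. row_var \<tau> n i) / 2)))
        \<le> (\<Sum>i<N. row_var \<tau> n i * (m * \<eta> i + 4 * m * sqrt (4 * m * \<delta> n) / 6 + \<delta> n / 4))"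
      unfolding row_sum_def row_var_def \<eta>_def
    proof (rule char_weighted_jumps)
      show "row_coef \<tau> n i (m - k) = cnj (row_coef \<tau> n i k)" if "k \<in> {1..<m}" for i k
        by (rule row_coef_reflect[OF that \<tau>[OF that]])
      show "(\<Sum>k = 1..<m. (cmod (row_coef \<tau> n i k))\<^sup>2) \<le> \<delta> n" for i
        using \<delta>(2)[OF n] unfolding row_var_def .
    qed
    also have "\<dots> = (\<Sum>i<N. m * (row_var \<tau> n i * \<eta> i) + row_var \<tau> n i * c n)"
      unfolding c_def by (intro sum.cong refl) (simp add: algebra_simps)
    also have "\<dots> \<le> \<epsilon> n"
    proof -
      have S: "(\<lambda>i. m * (row_var \<tau> n i * \<eta> i) + row_var \<tau> n i * c n) sums \<epsilon> n"
        unfolding \<epsilon>_def by (intro sums_add sums_mult sums_mult2 s1 s2 n)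
      have "(\<Sum>i<N. m * (row_var \<tau> n i * \<eta> i) + row_var \<tau> n i * c n)
          \<le> (\<Sum>i. m * (row_var \<tau> n i * \<eta> i) + row_var \<tau> n i * c n)"
        by (rule sum_le_suminf[OF sums_summable[OF S]]) (auto intro!: add_nonneg_nonneg
            mult_nonneg_nonneg row_var_nonneg \<eta>0 c0)
      then show ?thesis using sums_unique[OF S] by simp
    qed
    finally show ?thesis .
  qed
  have lim: "cmod (?\<phi> n - complex_of_real (exp (- s2 n / 2))) \<le> b n + \<epsilon> n" if n: "n \<ge> 1" for n
  proof (rule tendsto_lowerbound)
    let ?E = "\<lambda>N. complex_of_real (exp (- (\<Sum>i<N. row_var \<tau> n i) / 2))"
    have S: "(\<lambda>N. \<Sum>i<N. row_var \<tau> n i) \<longlonglongrightarrow> s2 n" using s2(1)[OF n] by (simp only: sums_def)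
    have E: "?E \<longlonglongrightarrow> complex_of_real (exp (- s2 n / 2))" by (intro tendsto_intros S) auto
    have "(\<lambda>N. b n + d n N + \<epsilon> n + cmod (?E N - complex_of_real (exp (- s2 n / 2)))) \<longlonglongrightarrow>
        b n + 0 + \<epsilon> n + cmod (complex_of_real (exp (- s2 n / 2)) - complex_of_real (exp (- s2 n / 2)))"
      by (intro tendsto_intros d n E)
    then show "(\<lambda>N. b n + d n N + \<epsilon> n + cmod (?E N - complex_of_real (exp (- s2 n / 2)))) \<longlonglongrightarrow> b n + \<epsilon> n"
      by (simp only: diff_self norm_zero add_0_right)
    show "\<forall>\<^sub>F N in sequentially. cmod (?\<phi> n - complex_of_real (exp (- s2 n / 2)))
        \<le> b n + d n N + \<epsilon> n + cmod (?E N - complex_of_real (exp (- s2 n / 2)))"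
      using eventually_ge_at_top[of n]
    proof eventually_elim
      case (elim N)
      have "cmod (?\<phi> n - ?w n N) \<le> b n + d n N"
        using char_diff_le[OF X integrable_row_sum, of n \<tau> n N] close[OF n elim] by linarith
      moreover have "cmod (A - D) \<le> cmod (A - B) + cmod (B - C) + cmod (C - D)" for A B C D
        using norm_triangle_ineq[of "A - B" "B - C"] norm_triangle_ineq[of "(A - B) + (B - C)" "C - D"]
            by simp
      ultimately show ?case using main[OF n, of N] by (meson add_mono order_trans order_refl)
    qed
  qed simp
  have "(\<lambda>n. ?\<phi> n - complex_of_real (exp (- s2 n / 2))) \<longlonglongrightarrow> 0"
  proof (rule Lim_null_comparison)
    show "\<forall>\<^sub>F n in sequentially. cmod (?\<phi> n - complex_of_real (exp (- s2 n / 2))) \<le> b n + \<epsilon> n"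
      using eventually_ge_at_top[of 1] by eventually_elim (rule lim)
    show "(\<lambda>n. b n + \<epsilon> n) \<longlonglongrightarrow> 0" using tendsto_add[OF b \<epsilon>] by simp
  qed
  moreover have "(\<lambda>n. complex_of_real (exp (- s2 n / 2))) \<longlonglongrightarrow> complex_of_real (exp (- q \<tau> / 2))"
    by (intro tendsto_intros s2) auto
  ultimately show "?\<phi> \<longlonglongrightarrow> complex_of_real (exp (- q \<tau> / 2))"
    using tendsto_add by fastforce
  have mom: "(\<integral>x. \<bar>X n x\<bar> \<partial>M) \<le> b n + sqrt (4 * m * s2 n)" if n: "n \<ge> 1" for n
  proof (rule tendsto_lowerbound)
    have "(\<lambda>N. b n + d n N + sqrt (4 * m * s2 n)) \<longlonglongrightarrow> b n + 0 + sqrt (4 * m * s2 n)"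
      by (intro tendsto_intros d n)
    then show "(\<lambda>N. b n + d n N + sqrt (4 * m * s2 n)) \<longlonglongrightarrow> b n + sqrt (4 * m * s2 n)" by simp
    show "\<forall>\<^sub>F N in sequentially. (\<integral>x. \<bar>X n x\<bar> \<partial>M) \<le> b n + d n N + sqrt (4 * m * s2 n)"
      using eventually_ge_at_top[of n]
    proof eventually_elim
      case (elim N)
      have "(\<integral>x. \<bar>X n x\<bar> \<partial>M) \<le> (\<integral>x. \<bar>X n x - row_sum \<tau> n N x\<bar> + \<bar>row_sum \<tau> n N x\<bar> \<partial>M)"
        by (intro integral_mono Bochner_Integration.integrable_add integrable_abs
            Bochner_Integration.integrable_diff X integrable_row_sum) linarith
      also have "\<dots> = (\<integral>x. \<bar>X n x - row_sum \<tau> n N x\<bar> \<partial>M) + (\<integral>x. \<bar>row_sum \<tau> n N x\<bar> \<partial>M)"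
        by (intro Bochner_Integration.integral_add integrable_abs Bochner_Integration.integrable_diff X
            integrable_row_sum)
      also have "\<dots> \<le> (b n + d n N) + sqrt (4 * m * (\<Sum>i<N. row_var \<tau> n i))"
        by (intro add_mono close n elim second_moment_row_sum)
      also have "(\<Sum>i<N. row_var \<tau> n i) \<le> s2 n"
        using sum_le_suminf[OF sums_summable[OF s2(1)[OF n]], of "{..<N}"] sums_unique[OF s2(1)[OF n]]
            row_var_nonneg by simp
      finally show ?case by (simp add: mult_left_mono)
    qed
  qed simp
  have "(\<lambda>n. b n + sqrt (4 * m * s2 n)) \<longlonglongrightarrow> 0 + sqrt (4 * m * q \<tau>)"
    by (intro tendsto_intros b s2)
  from convergent_imp_Bseq[OF convergentI[OF this]]
  obtain B where "\<And>n. \<bar>b n + sqrt (4 * m * s2 n)\<bar> \<le> B" by (auto simp: Bseq_def)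
  then have "\<forall>n\<ge>1. (\<integral>x. \<bar>X n x\<bar> \<partial>M) \<le> B" using mom by (meson abs_ge_self order_trans)
  then show "\<exists>B. \<forall>n\<ge>1. (\<integral>x. \<bar>X n x\<bar> \<partial>M) \<le> B" by blast
qed

end

section \<open>Martingale limits of the large modes\<close>

lemma lam_eq_cos: "lam m k = cos (2 * pi * k / m)"
  unfolding lam_def omega_def by (simp add: exp_of_nat_mult[symmetric] Re_exp mult_ac)

lemma lam_gt_half:
  assumes "1 \<le> k" "6 * k < m" shows "lam m k > 1 / 2"
proof -
  have "real (6 * k) < real m" using assms by (simp only: of_nat_less_iff)
  then have "2 * pi * k / m < pi / 3" using assms by (simp add: field_simps)
  then have "cos (2 * pi * k / m) > cos (pi / 3)"
    by (intro cos_monotone_0_pi) auto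
  then show ?thesis unfolding lam_eq_cos by (simp add: cos_60)
qed

lemma lam_lt_half:
  assumes "6 * k > m" "2 * k \<le> m" shows "lam m k < 1 / 2"
proof -
  have m: "m > 0" using assms by linarith
  have "real (6 * k) > real m" "real (2 * k) \<le> real m" using assms
      by (simp_all only: of_nat_less_iff of_nat_le_iff)
  then have "2 * pi * k / m > pi / 3" "2 * pi * k / m \<le> pi" using m by (simp_all add: field_simps)
  then have "cos (2 * pi * k / m) < cos (pi / 3)"
    by (intro cos_monotone_0_pi) auto
  then show ?thesis unfolding lam_eq_cos by (simp add: cos_60)
qed

text \<open>
  The threshold is the angle \<open>\<pi> / 3\<close>, that is \<open>k / m = 1/6\<close>; indices above \<open>m / 2\<close> reduce to \<open>m - k\<close>.
\<close>

lemma lam_gt_half_iff: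
  assumes "\<not> 6 dvd m" "k \<in> {1..<m}"
  shows "lam m k > 1 / 2 \<longleftrightarrow> k \<le> (m - 1) div 6 \<or> m - k \<le> (m - 1) div 6" and "lam m k \<noteq> 1 / 2"
proof -
  have m: "m > 0" using assms by auto
  have iff: "j \<le> (m - 1) div 6 \<longleftrightarrow> 6 * j < m" for j using m by linarith
  have ne: "6 * j \<noteq> m" for j using assms(1) by auto
  have base: "(lam m j > 1 / 2 \<longleftrightarrow> 6 * j < m) \<and> lam m j \<noteq> 1 / 2" if "1 \<le> j" "2 * j \<le> m" for j
  proof (cases "6 * j < m")
    case True
    then show ?thesis using lam_gt_half[OF that(1) True] by auto
  next
    case False
    then have "6 * j > m" using ne[of j] by linarith
    then show ?thesis using lam_lt_half[OF _ that(2)] by fastforce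
  qed
  have "(lam m k > 1 / 2 \<longleftrightarrow> 6 * k < m \<or> 6 * (m - k) < m) \<and> lam m k \<noteq> 1 / 2"
  proof (cases "2 * k \<le> m")
    case True
    then have "\<not> 6 * (m - k) < m" using m by linarith
    then show ?thesis using base[of k] True assms by auto
  next
    case False
    then have "\<not> 6 * k < m" by linarith
    then show ?thesis using base[of "m - k"] False assms lam_cnj[OF m, of k] by auto
  qed
  then show "lam m k > 1 / 2 \<longleftrightarrow> k \<le> (m - 1) div 6 \<or> m - k \<le> (m - 1) div 6" "lam m k \<noteq> 1 / 2"
    unfolding iff by blast+
qed

context cyclic_urn
begin

text \<open>
  Up to the additive constant \<open>1 + \<omega>\<^sup>k\<close>, the martingale \<open>u\<^sub>k(n) / P\<^sub>k(n)\<close> (see \<open>mode_eq_mart\<close>).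
\<close>

definition mart :: "nat \<Rightarrow> nat \<Rightarrow> 'a \<Rightarrow> complex" where
  "mart k N x = (\<Sum>i<N. jump k (hist (Suc i) x) / growth (\<omega> ^ k) (Suc i))"

lemma mode_hist_Suc:
  "mode k (hist (Suc n) x) = (1 + \<omega> ^ k / of_nat (Suc n)) * mode k (hist n x) + jump k (hist (Suc n) x)"
proof -
  have "mode k (draw l j) = (1 + \<omega> ^ k / of_nat (length l)) * mode k l + jump k (draw l j)" for l j
    unfolding mode_draw jump_draw by (simp add: algebra_simps)
  then show ?thesis unfolding hist_Suc using length_hist[of n x] by metis
qed

lemma mode_eq_mart:
  "n \<ge> 1 \<Longrightarrow> mode k (hist n x) = growth (\<omega> ^ k) n * (1 + \<omega> ^ k + mart k n x)"
proof (induction n rule: nat_induct_at_least)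
  case base
  have "mode k (hist 0 x) = 1" by (simp add: hist_def mode_def)
  then show ?case using mode_hist_Suc[of k 0 x] by (simp add: mart_def)
next
  case (Suc n)
  let ?z = "\<omega> ^ k"
  have nz: "growth ?z (Suc n) \<noteq> 0" by (rule growth_nonzero) simp
  have "mode k (hist (Suc n) x) = (1 + ?z / of_nat (Suc n)) * (growth ?z n * (1 + ?z + mart k n x))
      + jump k (hist (Suc n) x)"
    using Suc.IH mode_hist_Suc by simp
  also have "\<dots> = growth ?z (Suc n) * (1 + ?z + mart k n x)
      + growth ?z (Suc n) * (jump k (hist (Suc n) x) / growth ?z (Suc n))"
    using nz by (simp add: growth_Suc[OF Suc.hyps] mult_ac del: of_nat_Suc)
  finally show ?case by (simp only: mart_def sum.lessThan_Suc distrib_left add.assoc)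
qed

lemma mart_function_of_history:
  "mart k N x = (\<Sum>i<N. jump k (take (Suc (Suc i)) (hist N x)) / growth (\<omega> ^ k) (Suc i))"
  unfolding mart_def by (rule history_sum[of "\<lambda>i l. jump k l / growth (\<omega> ^ k) (Suc i)"])

lemma integrable_mart: "integrable M (mart k N)"
  unfolding mart_function_of_history[abs_def]
  by (rule integrable_comp_hist[of "\<lambda>l. \<Sum>i<N. jump k (take (Suc (Suc i)) l) / growth (\<omega> ^ k) (Suc i)" N])

lemma expectation_mart: "(\<integral>x. mart k N x \<partial>M) = 0"
proof -
  have i: "integrable M (\<lambda>x. jump k (hist (Suc i) x) / growth (\<omega> ^ k) (Suc i))" for i
    by (rule integrable_comp_hist[of "\<lambda>l. jump k l / growth (\<omega> ^ k) (Suc i)"])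
  have "(\<integral>x. 1 * jump k (hist (Suc i) x) \<partial>M) = 0" for i
    by (rule expectation_mult_null[of i "jump k" "\<lambda>_. 1"]) (rule sum_jump)
  then have "(\<integral>x. jump k (hist (Suc i) x) / growth (\<omega> ^ k) (Suc i) \<partial>M) = 0" for i
    by (simp only: integral_divide_zero mult_1 div_0)
  then show ?thesis
    unfolding mart_def by (subst Bochner_Integration.integral_sum[OF i]) (simp only: sum.neutral_const)
qed

lemma mode_minus_expectation:
  assumes "n \<ge> 1"
  shows "mode k (hist n x) - (\<integral>y. mode k (hist n y) \<partial>M) = growth (\<omega> ^ k) n * mart k n x"
proof -
  have "(\<integral>y. mode k (hist n y) \<partial>M) = (\<integral>y. growth (\<omega> ^ k) n * (1 + \<omega> ^ k)
      + growth (\<omega> ^ k) n * mart k n y \<partial>M)"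
    by (intro Bochner_Integration.integral_cong refl) (simp only: mode_eq_mart[OF assms] distrib_left)
  also have "\<dots> = growth (\<omega> ^ k) n * (1 + \<omega> ^ k) + growth (\<omega> ^ k) n * (\<integral>y. mart k n y \<partial>M)"
    using integrable_mart by (subst Bochner_Integration.integral_add) (auto simp: prob_space)
  finally show ?thesis
    unfolding mode_eq_mart[OF assms] expectation_mart by (simp add: algebra_simps)
qed

lemma mart_reflect:
  assumes "k \<le> m" shows "mart (m - k) N x = cnj (mart k N x)"
proof -
  have "growth (\<omega> ^ (m - k)) n = cnj (growth (\<omega> ^ k) n)" for n
    by (simp only: cnj_omega_power[OF m_pos assms, symmetric] growth_cnj)
  then show ?thesis
    unfolding mart_def cnj_sum by (simp add: jump_reflect[OF assms])
qed

lemma mart_L1_diff: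
  assumes "i \<le> i'"
  shows "(\<integral>x. cmod (mart k i' x - mart k i x) \<partial>M)
      \<le> sqrt (\<Sum>j\<in>{i..<i'}. 4 / (cmod (growth (\<omega> ^ k) (Suc j)))\<^sup>2)"
proof (rule real_le_rsqrt)
  define d where "d j l = (if j < i then 0 else jump k l / growth (\<omega> ^ k) (Suc j))" for j l
  define B where "B j = (if j < i then 0 else 2 / cmod (growth (\<omega> ^ k) (Suc j)))" for j
  have Zd: "mart k i' x - mart k i x = (\<Sum>j<i'. d j (hist (Suc j) x))" for x
  proof -
    have "(\<Sum>j<i'. d j (hist (Suc j) x)) = (\<Sum>j\<in>{..<i'}
        - {..<i}. jump k (hist (Suc j) x) / growth (\<omega> ^ k) (Suc j))"
      unfolding d_def by (intro sum.mono_neutral_cong_right) auto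
    also have "\<dots> = mart k i' x - mart k i x"
      unfolding mart_def using assms by (subst sum_diff) auto
    finally show ?thesis ..
  qed
  have hist: "mart k i' x - mart k i x = (\<Sum>j<i'. d j (take (Suc (Suc j)) (hist i' x)))" for x
    unfolding Zd by (rule history_sum)
  have "(\<integral>x. cmod (mart k i' x - mart k i x) \<partial>M)\<^sup>2 \<le> (\<integral>x. (cmod (mart k i' x - mart k i x))\<^sup>2 \<partial>M)"
  proof (rule expectation_squared_le)
    show "integrable M (\<lambda>x. cmod (mart k i' x - mart k i x))"
      unfolding hist by (rule integrable_comp_hist[of "\<lambda>l. cmod (\<Sum>j<i'. d j (take (Suc (Suc j)) l))" i'])
    show "integrable M (\<lambda>x. (cmod (mart k i' x - mart k i x))\<^sup>2)"
      unfolding hist by (rule integrable_comp_hist[of "\<lambda>l. (cmod (\<Sum>j<i'. d j (take (Suc (Suc j)) l)))\<^sup>2"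
          i'])
  qed
  also have "\<dots> \<le> (\<Sum>j<i'. (B j)\<^sup>2)"
    unfolding Zd
  proof (rule second_moment_history_sum)
    show "(\<Sum>ja\<le>j. d j (draw l ja)) = 0" if "length l = Suc j" for j l
      using sum_jump[OF that, of k] by (cases "j < i") (simp_all add: d_def sum_divide_distrib[symmetric])
    show "cmod (d j l) \<le> B j" for j l
      unfolding d_def B_def using norm_jump_le[of k l] by (simp add: norm_divide divide_right_mono)
  qed
  also have "\<dots> = (\<Sum>j\<in>{i..<i'}. 4 / (cmod (growth (\<omega> ^ k) (Suc j)))\<^sup>2)"
    unfolding B_def by (intro sum.mono_neutral_cong_right) (auto simp: power_divide)
  finally show "(\<integral>x. cmod (mart k i' x - mart k i x) \<partial>M)\<^sup>2
      \<le> (\<Sum>j\<in>{i..<i'}. 4 / (cmod (growth (\<omega> ^ k) (Suc j)))\<^sup>2)" .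
qed

text \<open>
  By orthogonality of the increments the martingale is Cauchy in \<open>L\<^sup>2\<close>, as the squares of
  \<open>1 / P\<^sub>k(j)\<close> are summable for \<open>\<lambda> > 1/2\<close>.
\<close>

lemma mart_limit:
  assumes lam: "lam m k > 1 / 2"
  obtains Z where "integrable M Z" "(\<lambda>N. \<integral>x. cmod (mart k N x - Z x) \<partial>M) \<longlonglongrightarrow> 0"
proof (rule L1_Cauchy_limit[OF integrable_mart[of k]])
  let ?f = "\<lambda>j. 4 / (cmod (growth (\<omega> ^ k) (Suc j)))\<^sup>2"
  have "summable (\<lambda>j. (cmod (coef (\<omega> ^ k) 1 j))\<^sup>2 / real 1 * 1)"
  proof (rule coef_sums[OF cmod_omega_power[of k] _ tendsto_const[of 1]])
    show "Re (\<omega> ^ k) \<noteq> 1 / 2" using lam by (simp only: Re_omega_power)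
    show "summable (\<lambda>j. (cmod (coef (\<omega> ^ k) 1 j))\<^sup>2 / real 1 * 1)"
      if "\<And>n. n \<ge> 1 \<Longrightarrow> (\<lambda>i. (cmod (coef (\<omega> ^ k) n i))\<^sup>2 / real n * 1) sums s n" for s
      using that[of 1] by (intro sums_summable) simp
  qed
  then have "summable (\<lambda>j. 4 * ((cmod (coef (\<omega> ^ k) 1 (j + 1)))\<^sup>2))"
    by (intro summable_mult) (simp only: summable_iff_shift[of "\<lambda>j. (cmod (coef (\<omega> ^ k) 1 j))\<^sup>2"], simp)
  moreover have "4 * ((cmod (coef (\<omega> ^ k) 1 (j + 1)))\<^sup>2) = ?f (j + 1)" for j
    using lam by (simp add: coef_def lam_def norm_divide power_divide)
  ultimately have "summable (\<lambda>j. ?f (j + 1))" by (simp only:)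
  then have sf: "summable ?f" by (simp only: summable_iff_shift[of ?f 1])
  fix e :: real assume e: "e > 0"
  then have "e\<^sup>2 > 0" by simp
  from sf[unfolded summable_Cauchy, rule_format, OF this]
  obtain N where N: "\<And>i j. i \<ge> N \<Longrightarrow> norm (sum ?f {i..<j}) < e\<^sup>2" by blast
  have small: "(\<integral>x. cmod (mart k j x - mart k i x) \<partial>M) < e" if "N \<le> i" "i \<le> j" for i j
  proof -
    have "sum ?f {i..<j} < e\<^sup>2" using N[OF that(1), of j] by simp
    then have "sqrt (sum ?f {i..<j}) < e" using e by (intro real_less_lsqrt) auto
    with mart_L1_diff[OF that(2), of k] show ?thesis by linarith
  qed
  show "\<exists>N. \<forall>i\<ge>N. \<forall>j\<ge>N. (\<integral>x. cmod (mart k i x - mart k j x) \<partial>M) < e"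
  proof (intro exI[of _ N] allI impI)
    fix i j assume ij: "N \<le> i" "N \<le> j"
    show "(\<integral>x. cmod (mart k i x - mart k j x) \<partial>M) < e"
    proof (cases "i \<le> j")
      case True
      have "(\<integral>x. cmod (mart k i x - mart k j x) \<partial>M) = (\<integral>x. cmod (mart k j x - mart k i x) \<partial>M)"
        by (simp only: norm_minus_commute)
      with small[OF ij(1) True] show ?thesis by simp
    next
      case False
      then show ?thesis using small[OF ij(2), of i] by simp
    qed
  qed
qed

text \<open>
  In the row sum a large mode contributes \<open>- (Z(N) - Z(n))\<close> where a small one contributes \<open>Z(n)\<close>, with \<open>Z\<close> the
  jump martingale. So all modes together give the centred composition at time \<open>n\<close>, minus the large modes at time
  \<open>N\<close>; these come in conjugate pairs \<open>k\<close>, \<open>m - k\<close> with \<open>k \<le> (m - 1) div 6\<close>.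
\<close>

lemma row_sum_eq:
  assumes n: "n \<ge> 1" and nN: "n \<le> N"
    and \<tau>: "\<And>k. k \<in> {1..<m} \<Longrightarrow> \<tau> (m - k) = cnj (\<tau> k)"
    and m6: "\<not> 6 dvd m"
  shows "row_sum \<tau> n N x = (Re (\<Sum>k = 1..<m. \<tau> k * (growth (\<omega> ^ k) n * mart k n x))
     - (\<Sum>k = 1..(m - 1) div 6. 2 * Re (\<tau> k * (growth (\<omega> ^ k) n * mart k N x)))) / sqrt n"
proof -
  let ?g = "\<lambda>k. growth (\<omega> ^ k) n" and ?r = "(m - 1) div 6"
  define big where "big = {k \<in> {1..<m}. \<not> lam m k < 1 / 2}"
  have split: "(\<Sum>i<N. row_coef \<tau> n i k * jump k (hist (Suc i) x))
     = (\<tau> k * (?g k * mart k n x) - (if k \<in> big then \<tau> k * (?g k * mart k N x) else 0)) / sqrt n"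
    if k: "k \<in> {1..<m}" for k
  proof -
    have "(\<Sum>i<N. row_coef \<tau> n i k * jump k (hist (Suc i) x))
        = \<tau> k / sqrt n * (\<Sum>i<N. coef (\<omega> ^ k) n i * jump k (hist (Suc i) x))"
      by (simp add: row_coef_def sum_distrib_left mult_ac)
    also have "(\<Sum>i<N. coef (\<omega> ^ k) n i * jump k (hist (Suc i) x))
        = ?g k * mart k n x - (if k \<in> big then ?g k * mart k N x else 0)"
    proof (cases "k \<in> big")
      case True
      then have b: "\<not> Re (\<omega> ^ k) < 1 / 2" by (simp add: big_def lam_def)
      have "(\<Sum>i<N. coef (\<omega> ^ k) n i * jump k (hist (Suc i) x))
        = (\<Sum>i\<in>{..<N} - {..<n}. - (?g k * (jump k (hist (Suc i) x) / growth (\<omega> ^ k) (Suc i))))"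
        using b unfolding coef_def by (intro sum.mono_neutral_cong_right) auto
      also have "\<dots> = - ?g k * (mart k N x - mart k n x)"
        unfolding mart_def using nN by (subst sum_diff) (auto simp: sum_negf sum_distrib_left
            right_diff_distrib)
      finally show ?thesis using True by (simp add: algebra_simps)
    next
      case False
      then have b: "Re (\<omega> ^ k) < 1 / 2" using k by (simp add: big_def lam_def)
      have "(\<Sum>i<N. coef (\<omega> ^ k) n i * jump k (hist (Suc i) x))
        = (\<Sum>i<n. ?g k * (jump k (hist (Suc i) x) / growth (\<omega> ^ k) (Suc i)))"
        using b nN unfolding coef_def by (intro sum.mono_neutral_cong_right) auto
      also have "\<dots> = ?g k * mart k n x" by (simp only: mart_def sum_distrib_left)
      finally show ?thesis using False by simp
    qed
    finally show ?thesis
      by (cases "k \<in> big") (simp_all add: right_diff_distrib diff_divide_distrib)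
  qed
  have bigsum: "(\<Sum>k\<in>big. \<tau> k * (?g k * mart k N x)) = of_real (\<Sum>k
      = 1..?r. 2 * Re (\<tau> k * (?g k * mart k N x)))"
  proof -
    define f where "f k = \<tau> k * (?g k * mart k N x)" for k
    have refl_f: "f (m - k) = cnj (f k)" if "k \<in> {1..<m}" for k
    proof -
      have "growth (\<omega> ^ (m - k)) n = cnj (growth (\<omega> ^ k) n)"
        using that m_pos by (simp only: cnj_omega_power[symmetric] growth_cnj atLeastLessThan_iff
            less_imp_le)
      then show ?thesis unfolding f_def using \<tau>[OF that] that by (simp add: mart_reflect)
    qed
    have big: "big = {1..?r} \<union> (\<lambda>k. m - k) ` {1..?r}"
    proof -
      have "k \<in> big \<longleftrightarrow> k \<in> {1..<m} \<and> (k \<le> ?r \<or> m - k \<le> ?r)" for k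
        using lam_gt_half_iff[OF m6, of k] by (auto simp: big_def)
      moreover have "k \<in> (\<lambda>k. m - k) ` {1..?r} \<longleftrightarrow> k \<in> {1..<m} \<and> m - k \<le> ?r" for k
        using m_pos by (auto intro!: image_eqI[of _ _ "m - k"])
      moreover have "k \<in> {1..?r} \<longleftrightarrow> k \<in> {1..<m} \<and> k \<le> ?r" for k using m_pos by auto
      ultimately show ?thesis by blast
    qed
    have "sum f big = sum f {1..?r} + sum f ((\<lambda>k. m - k) ` {1..?r})"
      unfolding big by (rule sum.union_disjoint) (use m_pos in auto)
    also have "sum f ((\<lambda>k. m - k) ` {1..?r}) = (\<Sum>k = 1..?r. f (m - k))"
      by (subst sum.reindex) (auto simp: inj_on_def)
    also have "\<dots> = (\<Sum>k = 1..?r. cnj (f k))" using m_pos by (intro sum.cong refl refl_f) auto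
    finally have "sum f big = (\<Sum>k = 1..?r. f k + cnj (f k))" by (simp add: sum.distrib)
    also have "\<dots> = of_real (\<Sum>k = 1..?r. 2 * Re (f k))" by (simp add: complex_add_cnj)
    finally show ?thesis unfolding f_def .
  qed
  have "row_sum \<tau> n N x = Re (\<Sum>i<N. wjump (row_coef \<tau> n i) (hist (Suc i) x))"
    unfolding row_sum_def Re_sum ..
  also have "(\<Sum>i<N. wjump (row_coef \<tau> n i) (hist (Suc i) x)) = (\<Sum>k
      = 1..<m. \<Sum>i<N. row_coef \<tau> n i k * jump k (hist (Suc i) x))"
    unfolding wjump_def by (rule sum.swap)
  also have "\<dots> = (\<Sum>k = 1..<m. (\<tau> k * (?g k * mart k n x)
      - (if k \<in> big then \<tau> k * (?g k * mart k N x) else 0)) / sqrt n)"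
    by (intro sum.cong refl split)
  also have "\<dots> = ((\<Sum>k = 1..<m. \<tau> k * (?g k * mart k n x)) - (\<Sum>k\<in>big. \<tau> k * (?g k * mart k N x))) / sqrt n"
  proof -
    have "(\<Sum>k = 1..<m. if k \<in> big then \<tau> k * (?g k * mart k N x) else 0)
        = (\<Sum>k\<in>big. \<tau> k * (?g k * mart k N x))"
      by (intro sum.mono_neutral_cong_right) (auto simp: big_def)
    then show ?thesis by (simp only: sum_divide_distrib[symmetric] sum_subtractf)
  qed
  finally show ?thesis
    unfolding bigsum by (simp only: Re_divide_of_real minus_complex.simps Re_complex_of_real)
qed

end

section \<open>Fourier inversion and the covariance matrix\<close>

lemma omega_powi_minus: "omega m powi (- (int a * int k)) = cnj (omega m ^ (k * a))"
proof -
  have "omega m ^ (k * a) * cnj (omega m ^ (k * a)) = 1"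
    by (simp only: complex_norm_square[symmetric] norm_power norm_omega) simp
  then have "inverse (omega m ^ (k * a)) = cnj (omega m ^ (k * a))" by (rule inverse_unique)
  moreover have "int a * int k = int (k * a)" by simp
  ultimately show ?thesis by (simp only: power_int_minus power_int_of_nat)
qed

lemma omega_orthogonality:
  assumes "a < m" "b < m"
  shows "(\<Sum>k<m. omega m ^ (k * a) * cnj (omega m ^ (k * b))) = (if a = b then of_nat m else 0)"
proof -
  have m: "m > 0" using assms by auto
  let ?w = "omega m ^ (a + (m - b))"
  have c: "cnj (omega m ^ b) = omega m ^ (m - b)" using assms m by (intro cnj_omega_power) auto
  have t: "omega m ^ (k * a) * cnj (omega m ^ (k * b)) = ?w ^ k" for k
  proof -
    have "omega m ^ (k * a) * cnj (omega m ^ (k * b)) = (omega m ^ a * cnj (omega m ^ b)) ^ k"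
      by (simp only: mult.commute[of k] power_mult complex_cnj_power power_mult_distrib)
    then show ?thesis unfolding c by (simp only: power_add)
  qed
  show ?thesis
  proof (cases "a = b")
    case True
    then have "?w = 1" using assms m by (simp add: omega_power_m)
    then show ?thesis unfolding t using True by simp
  next
    case False
    have "?w \<noteq> 1"
    proof
      assume "?w = 1"
      then have "m dvd a + (m - b)" using omega_power_eq_1_iff[OF m] by simp
      then obtain c where c: "a + (m - b) = m * c" by auto
      have "0 < m * c" "m * c < m * 2" unfolding c[symmetric] using assms by auto
      then have "c = 1" using m by simp
      with c False assms show False by auto
    qed
    moreover have "?w ^ m = 1"
      by (simp only: power_mult[symmetric] mult.commute[of _ m]) (simp only: power_mult omega_power_m[OF
          m] power_one)
    ultimately show ?thesis unfolding t using False by (simp add: geometric_sum)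
  qed
qed

text \<open>
  The factor with which the \<open>k\<close>-th Fourier sum of the urn enters the inner product of \<open>t\<close> with the composition vector.
\<close>

definition coord :: "('m::finite \<Rightarrow> nat) \<Rightarrow> real^'m \<Rightarrow> nat \<Rightarrow> complex" where
  "coord idx t k = (\<Sum>j\<in>UNIV. of_real (t $ j) * vvec idx k $ j)"

context
  fixes idx :: "'m::finite \<Rightarrow> nat" and m :: nat
  assumes card: "CARD('m) = m" and bij: "bij_betw idx UNIV {0..<m}"
begin

lemma idx_less: "idx j < m"
  using bij by (auto simp: bij_betw_def)

lemma m_positive: "m > 0"
  using idx_less[of undefined] by simp

lemma idx_eq_iff: "idx i = idx j \<longleftrightarrow> i = j"
  using bij by (auto simp: bij_betw_def inj_on_def)

lemma vvec_nth: "vvec idx k $ j = cnj (omega m ^ (k * idx j)) / of_nat m"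
  unfolding vvec_def card omega_powi_minus by simp

lemma vvec_reflect: "k \<le> m \<Longrightarrow> vvec idx (m - k) $ j = cnj (vvec idx k $ j)"
  unfolding vvec_nth power_mult
  by (simp only: cnj_omega_power[OF m_positive, symmetric] complex_cnj_cnj complex_cnj_power
      complex_cnj_divide complex_cnj_of_nat)

lemma coord_reflect: "k \<le> m \<Longrightarrow> coord idx t (m - k) = cnj (coord idx t k)"
  unfolding coord_def by (simp add: vvec_reflect)

lemma coord_0: "coord idx t 0 = of_real ((\<Sum>j\<in>UNIV. t $ j) / m)"
  unfolding coord_def vvec_nth by (simp add: sum_divide_distrib)

lemma Fourier_inversion: "of_real (t $ j) = (\<Sum>k<m. coord idx t k * omega m ^ (k * idx j))"
proof -
  have "(\<Sum>k<m. coord idx t k * omega m ^ (k * idx j))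
    = (\<Sum>i\<in>UNIV. of_real (t $ i) / of_nat m * (\<Sum>k<m. omega m ^ (k * idx j) * cnj (omega m ^ (k * idx i))))"
  proof -
    have "t' * (c / n) * w = t' / n * (w * c)" for t' c n w :: complex by simp
    then show ?thesis
      unfolding coord_def vvec_nth sum_distrib_left sum_distrib_right
      by (subst sum.swap) (intro sum.cong refl)
  qed
  also have "\<dots> = (\<Sum>i\<in>UNIV. if i = j then of_real (t $ i) else 0)"
    using m_positive by (intro sum.cong refl) (subst omega_orthogonality[OF idx_less idx_less], auto
        simp: idx_eq_iff)
  finally show ?thesis by simp
qed

lemma count_list_Fourier:
  assumes "set l \<subseteq> {..<m}"
  shows "of_nat (count_list l (idx j)) = (\<Sum>k<m. (\<Sum>a\<leftarrow>l. omega m ^ (k * a)) * vvec idx k $ j)"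
  using assms
proof (induction l)
  case (Cons a l)
  then have a: "a < m" by simp
  have "(\<Sum>k<m. omega m ^ (k * a) * vvec idx k $ j) = (if a = idx j then 1 else 0)"
    unfolding vvec_nth times_divide_eq_right sum_divide_distrib[symmetric] omega_orthogonality[OF a
        idx_less]
    using m_positive by simp
  then show ?case using Cons by (simp add: ring_distribs sum.distrib)
qed simp

definition mode_weight :: "nat \<Rightarrow> real" where
  "mode_weight k = 1 / \<bar>2 * lam m k - 1\<bar>"

text \<open>
  The real and imaginary parts of the vectors \<open>v\<^sub>k\<close>, scaled so that the sum of the outer products of these real
  vectors is \<open>\<Sigma>\<close>. They serve as the directions of the independent normal variables in the limit.
\<close>

definition cov_factor :: "nat \<times> bool \<Rightarrow> real^'m" where
  "cov_factor p = sqrt (mode_weight (fst p)) *\<^sub>R (\<chi> j.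
      if snd p then Re (vvec idx (fst p) $ j) else Im (vvec idx (fst p) $ j))"

definition cov_matrix :: "real^'m^'m" where
  "cov_matrix = (\<chi> i j. \<Sum>p\<in>{1..<m} \<times> UNIV. cov_factor p $ i * cov_factor p $ j)"

lemma mode_weight_nonneg: "mode_weight k \<ge> 0"
  by (simp add: mode_weight_def)

lemma sum_pairs: "(\<Sum>p\<in>{1..<m} \<times> UNIV. f p) = (\<Sum>k = 1..<m. f (k, True) + f (k, False))"
  for f :: "nat \<times> bool \<Rightarrow> 'z::comm_monoid_add"
  by (simp add: sum.cartesian_product[symmetric, of "\<lambda>k b. f (k, b)", simplified] UNIV_bool add.commute)

text \<open>
  The terms with indices \<open>k\<close> and \<open>m - k\<close> are conjugate, so the imaginary parts cancel.
\<close>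

lemma Sigma_mat_real: "complex_of_real (cov_matrix $ i $ j) = Sigma_mat idx $ i $ j"
proof -
  let ?v = "\<lambda>k i. vvec idx k $ i"
  have S: "Sigma_mat idx $ i $ j = (\<Sum>k = 1..<m. of_real (mode_weight k) * (?v k i * cnj (?v k j)))"
  proof -
    have "{1..m - 1} = {1..<m}" using m_positive by auto
    then show ?thesis
      unfolding Sigma_mat_def card mode_weight_def outer_cnj_def
          by (simp add: scaleR_conv_of_real[where 'a = complex])
  qed
  have "cnj (Sigma_mat idx $ i $ j) = (\<Sum>k = 1..<m. of_real (mode_weight (m - k)) * (?v (m
      - k) i * cnj (?v (m - k) j)))"
    unfolding S cnj_sum
    by (intro sum.cong refl) (simp add: vvec_reflect mode_weight_def lam_cnj m_positive)
  also have "\<dots> = Sigma_mat idx $ i $ j" unfolding S by (rule sum_reflect)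
  finally have real: "of_real (Re (Sigma_mat idx $ i $ j)) = Sigma_mat idx $ i $ j"
    by (metis Reals_cnj_iff of_real_Re)
  have "Re (Sigma_mat idx $ i $ j) = (\<Sum>k = 1..<m. mode_weight k * (Re (?v k i) * Re (?v k j)
      + Im (?v k i) * Im (?v k j)))"
    unfolding S Re_sum by (intro sum.cong refl) simp
  moreover have "cov_matrix $ i $ j = (\<Sum>k = 1..<m. mode_weight k * (Re (?v k i) * Re (?v k j)
      + Im (?v k i) * Im (?v k j)))"
  proof -
    have g: "cov_factor (k, True) $ i = sqrt (mode_weight k) * Re (?v k i)" "cov_factor (k, False) $ i
        = sqrt (mode_weight k) * Im (?v k i)" for k i
      by (simp_all add: cov_factor_def)
    have "s * a * (s * b) + s * c * (s * d) = s * s * (a * b + c * d)" for s a b c d :: real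
      by (simp add: algebra_simps)
    from this[of "sqrt (mode_weight _)"] show ?thesis
      unfolding cov_matrix_def vec_lambda_beta sum_pairs g
      by (simp only: real_sqrt_mult_self abs_of_nonneg[OF mode_weight_nonneg])
  qed
  ultimately show ?thesis using real by simp
qed

lemma inner_cov_factor:
  "t \<bullet> cov_factor (k, True) = sqrt (mode_weight k) * Re (coord idx t k)"
  "t \<bullet> cov_factor (k, False) = sqrt (mode_weight k) * Im (coord idx t k)"
  by (simp_all add: cov_factor_def coord_def inner_vec_def sum_distrib_left mult_ac)

lemma sum_inner_cov_factor: "(\<Sum>p\<in>{1..<m} \<times> UNIV. (t \<bullet> cov_factor p)\<^sup>2) = (\<Sum>k
    = 1..<m. (cmod (coord idx t k))\<^sup>2 / \<bar>2 * lam m k - 1\<bar>)"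
  unfolding sum_pairs inner_cov_factor power_mult_distrib real_sqrt_pow2[OF mode_weight_nonneg] cmod_power2
  by (simp add: mode_weight_def add_divide_distrib)

lemma cov_matrix_mult: "cov_matrix *v x = (\<Sum>p\<in>{1..<m} \<times> UNIV. (x \<bullet> cov_factor p) *\<^sub>R cov_factor p)"
proof -
  have "(cov_matrix *v x) $ i = (\<Sum>p\<in>{1..<m} \<times> UNIV. (x \<bullet> cov_factor p) *\<^sub>R cov_factor p) $ i" for i
  proof -
    have "(cov_matrix *v x) $ i = (\<Sum>j\<in>UNIV. \<Sum>p\<in>{1..<m} \<times> UNIV. cov_factor p $ i * cov_factor p $ j * x $ j)"
      by (simp add: cov_matrix_def matrix_vector_mult_def sum_distrib_right)
    also have "\<dots> = (\<Sum>p\<in>{1..<m} \<times> UNIV. \<Sum>j\<in>UNIV. cov_factor p $ i * cov_factor p $ j * x $ j)"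
      by (rule sum.swap)
    also have "\<dots> = (\<Sum>p\<in>{1..<m} \<times> UNIV. (x \<bullet> cov_factor p) *\<^sub>R cov_factor p) $ i"
    proof -
      have "((x \<bullet> cov_factor p) *\<^sub>R cov_factor p) $ i
          = (\<Sum>j\<in>UNIV. cov_factor p $ i * cov_factor p $ j * x $ j)" for p
        unfolding vector_scaleR_component inner_vec_def real_scaleR_def inner_real_def sum_distrib_right
        by (simp add: mult_ac)
      then show ?thesis by simp
    qed
    finally show ?thesis .
  qed
  then show ?thesis by (simp only: vec_eq_iff) simp
qed

lemma coord_zero_iff:
  "(\<forall>k\<in>{1..<m}. coord idx x k = 0) \<longleftrightarrow> (\<exists>c. x = (\<chi> i. c))"
proof
  assume z: "\<forall>k\<in>{1..<m}. coord idx x k = 0"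
  define c where "c = (\<Sum>j\<in>UNIV. x $ j) / m"
  have "x $ j = c" for j
  proof -
    have "complex_of_real (x $ j) = (\<Sum>k\<in>{0}. coord idx x k * omega m ^ (k * idx j))"
      unfolding Fourier_inversion[of x j]
      by (intro sum.mono_neutral_right) (use z m_positive in auto)
    then have "complex_of_real (x $ j) = of_real c" by (simp add: coord_0 c_def)
    then show ?thesis by (simp only: of_real_eq_iff)
  qed
  then have "x = (\<chi> i. c)" by (simp add: vec_eq_iff)
  then show "\<exists>c. x = (\<chi> i. c)" by (rule exI)
next
  assume "\<exists>c. x = (\<chi> i. c)"
  then obtain c where x: "x = (\<chi> i. c)" by auto
  show "\<forall>k\<in>{1..<m}. coord idx x k = 0"
  proof
    fix k assume k: "k \<in> {1..<m}"
    have "coord idx x k = of_real c / of_nat m * (\<Sum>j\<in>UNIV. cnj (omega m ^ (k * idx j)))"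
      unfolding coord_def vvec_nth x sum_distrib_left by simp
    also have "(\<Sum>j\<in>UNIV. cnj (omega m ^ (k * idx j))) = (\<Sum>b\<in>{0..<m}. cnj (omega m ^ (k * b)))"
      by (rule sum.reindex_bij_betw[OF bij])
    also have "\<dots> = (\<Sum>b<m. omega m ^ (b * 0) * cnj (omega m ^ (b * k)))"
      by (simp add: atLeast0LessThan mult.commute)
    also have "\<dots> = 0" using k m_positive by (subst omega_orthogonality) auto
    finally show "coord idx x k = 0" by simp
  qed
qed

lemma rank_cov_matrix:
  assumes "\<And>k. k \<in> {1..<m} \<Longrightarrow> lam m k \<noteq> 1 / 2"
  shows "rank cov_matrix = m - 1"
proof -
  have wpos: "mode_weight k > 0" if "k \<in> {1..<m}" for k using assms[OF that] by (auto simp: mode_weight_def)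
  have ker: "cov_matrix *v x = 0 \<longleftrightarrow> (\<exists>c. x = (\<chi> i. c))" for x
  proof -
    have "cov_matrix *v x = 0 \<longleftrightarrow> (\<forall>p\<in>{1..<m} \<times> UNIV. x \<bullet> cov_factor p = 0)"
    proof
      assume "cov_matrix *v x = 0"
      then have "x \<bullet> (\<Sum>p\<in>{1..<m} \<times> UNIV. (x \<bullet> cov_factor p) *\<^sub>R cov_factor p)
          = 0" by (simp add: cov_matrix_mult)
      then have "(\<Sum>p\<in>{1..<m} \<times> UNIV. (x \<bullet> cov_factor p)\<^sup>2) = 0"
        by (simp add: inner_sum_right power2_eq_square)
      then show "\<forall>p\<in>{1..<m} \<times> UNIV. x \<bullet> cov_factor p = 0"
        by (subst (asm) sum_nonneg_eq_0_iff) auto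
    next
      assume "\<forall>p\<in>{1..<m} \<times> UNIV. x \<bullet> cov_factor p = 0"
      then show "cov_matrix *v x = 0" unfolding cov_matrix_mult by (intro sum.neutral) auto
    qed
    also have "\<dots> \<longleftrightarrow> (\<forall>k\<in>{1..<m}. coord idx x k = 0)"
    proof -
      have "(\<forall>p\<in>{1..<m} \<times> (UNIV::bool set). x \<bullet> cov_factor p = 0) \<longleftrightarrow>
         (\<forall>k\<in>{1..<m}. x \<bullet> cov_factor (k, True) = 0 \<and> x \<bullet> cov_factor (k, False) = 0)"
        by (auto simp: all_bool_eq)
      also have "\<dots> \<longleftrightarrow> (\<forall>k\<in>{1..<m}. coord idx x k = 0)"
        unfolding inner_cov_factor using wpos by (intro ball_cong refl) (fastforce simp: complex_eq_iff)
      finally show ?thesis .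
    qed
    also have "\<dots> \<longleftrightarrow> (\<exists>c. x = (\<chi> i. c))" by (rule coord_zero_iff)
    finally show ?thesis .
  qed
  have "rank cov_matrix = CARD('m) - 1"
  proof (rule rank_eq_card_minus_1)
    show "cov_matrix $ i $ j = cov_matrix $ j $ i" for i j by (simp add: cov_matrix_def mult.commute)
  qed (rule ker)
  then show ?thesis using card by simp
qed

lemma inner_Re_vec: "t \<bullet> Re_vec (c *s vvec idx k) = Re (c * coord idx t k)"
  by (simp add: Re_vec_def inner_vec_def coord_def sum_distrib_left right_diff_distrib mult_ac)

end

section \<open>The limit theorem\<close>

theorem theorem1p1:
  fixes m r :: nat
    and M :: "'a measure"
    and U :: "nat \<Rightarrow> 'a \<Rightarrow> nat"
    and idx :: "'m::finite \<Rightarrow> nat"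
    and R :: "nat \<Rightarrow> 'a \<Rightarrow> real^'m"
  assumes "CARD('m) = m" and "m \<ge> 2" and "\<not> 6 dvd m"
    and "r = (m - 1) div 6"
    and "bij_betw idx UNIV {0..<m}"
    and "prob_space M" and "uniform_draws M U"
    and "R = composition idx U"
  shows "\<exists>\<Xi> :: nat \<Rightarrow> 'a \<Rightarrow> complex. \<exists>S :: real^'m^'m. \<exists>N :: (real^'m) measure.
    (\<forall>k\<in>{1..r}. \<Xi> k \<in> borel_measurable M) \<and>
    (\<forall>i j. complex_of_real (S $ i $ j) = Sigma_mat idx $ i $ j) \<and>
    rank S = m - 1 \<and>
    centered_normal N S \<and>
    weakly_converges
      (\<lambda>n. distr M borel (\<lambda>x. (1 / sqrt (real n)) *\<^sub>R
         (R n x - (\<integral>y. R n y \<partial>M)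
          - (\<Sum>k = 1..r. 2 *\<^sub>R
               Re_vec ((of_nat n powr (omega m ^ k) * \<Xi> k x) *s vvec idx k)))))
      N"
proof -
  interpret cyclic_urn M m U
    using assms by (simp add: cyclic_urn_def cyclic_urn_axioms_def)
  note card = assms(1) and bij = assms(5)
  note mat = card bij
  have lam: "lam m k \<noteq> 1 / 2" if "k \<in> {1..<m}" for k
    by (rule lam_gt_half_iff(2)[OF assms(3) that])
  have rk: "k \<in> {1..<m}" "lam m k > 1 / 2" if "k \<in> {1..r}" for k
  proof -
    have "r < m" using assms(2,4) by linarith
    then show k: "k \<in> {1..<m}" using that by auto
    show "lam m k > 1 / 2" using lam_gt_half_iff(1)[OF assms(3) k] that assms(4) by auto
  qed
  have "\<forall>k\<in>{1..r}. \<exists>Z. integrable M Z \<and> (\<lambda>N. \<integral>x. cmod (mart k N x - Z x) \<partial>M) \<longlonglongrightarrow> 0"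
    using mart_limit[OF rk(2)] by metis
  from bchoice[OF this] obtain Z where Z': "\<forall>k\<in>{1..r}. integrable M (Z k) \<and> (\<lambda>N. \<integral>x. cmod (mart k N x
      - Z k x) \<partial>M) \<longlonglongrightarrow> 0"
    by (elim exE)
  then have Z: "integrable M (Z k)" "(\<lambda>N. \<integral>x. cmod (mart k N x - Z k x) \<partial>M) \<longlonglongrightarrow> 0" if "k \<in> {1..r}" for k
    using that by blast+
  have "\<forall>k. \<exists>a. (\<lambda>n. cmod (growth (\<omega> ^ k) n - a * of_nat n powr (\<omega> ^ k)) / sqrt n) \<longlonglongrightarrow> 0"
    using growth_asymp_powr[OF cmod_omega_power] by metis
  from choice[OF this] obtain a where a: "\<forall>k. (\<lambda>n. cmod (growth (\<omega> ^ k) n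
      - a k * of_nat n powr (\<omega> ^ k)) / sqrt n) \<longlonglongrightarrow> 0"
    by (elim exE)
  define \<Xi> where "\<Xi> k x = a k * Z k x" for k x
  define Y where "Y n x = (1 / sqrt (real n)) *\<^sub>R (R n x - (\<integral>y. R n y \<partial>M)
      - (\<Sum>k = 1..r. 2 *\<^sub>R Re_vec ((of_nat n powr (omega m ^ k) * \<Xi> k x) *s vvec idx k)))" for n x
  have R_hist: "R n x = (\<chi> j. real (count_list (hist n x) (idx j)))" for n x
    by (simp add: assms(8) composition_def hist_def card)
  have int_R: "integrable M (R n)" for n
    unfolding R_hist[abs_def] by (rule integrable_comp_hist[of "\<lambda>l. \<chi> j. real (count_list l (idx j))" n])
  have int_f: "integrable M (\<lambda>x. mode k (hist n x))" for k n
    by (rule integrable_comp_hist[of "mode k" n])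
  define X where "X t n x = t \<bullet> Y n x" for t n x
  have tR: "t \<bullet> R n x = Re (\<Sum>k<m. coord idx t k * mode k (hist n x))" for t n x
  proof -
    have "complex_of_real (t \<bullet> R n x) = (\<Sum>j\<in>UNIV. of_real (t $ j) * (\<Sum>k<m. mode k (hist n x)
        * vvec idx k $ j))"
      unfolding inner_vec_def R_hist mode_def
      by (simp add: count_list_Fourier[OF mat set_hist, symmetric])
    also have "\<dots> = (\<Sum>k<m. coord idx t k * mode k (hist n x))"
    proof -
      have "coord idx t k * mode k l = (\<Sum>j\<in>UNIV. of_real (t $ j) * (mode k l * vvec idx k $ j))" for k l
        unfolding coord_def sum_distrib_right by (simp add: mult_ac)
      then show ?thesis unfolding sum_distrib_left by (subst sum.swap) (simp only:)
    qed
    finally show ?thesis by (metis Re_complex_of_real)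
  qed
  have centred: "t \<bullet> (R n x - (\<integral>y. R n y \<partial>M)) = Re (\<Sum>k
      = 1..<m. coord idx t k * (growth (\<omega> ^ k) n * mart k n x))"
    if "n \<ge> 1" for t n x
  proof -
    have "t \<bullet> (\<integral>y. R n y \<partial>M) = (\<integral>y. t \<bullet> R n y \<partial>M)"
      by (rule integral_inner_right[symmetric]) (rule int_R)
    also have "\<dots> = Re (\<integral>y. (\<Sum>k<m. coord idx t k * mode k (hist n y)) \<partial>M)"
      unfolding tR using int_f by (intro integral_Re) auto
    also have "(\<integral>y. (\<Sum>k<m. coord idx t k * mode k (hist n y)) \<partial>M)
        = (\<Sum>k<m. coord idx t k * (\<integral>y. mode k (hist n y) \<partial>M))"
      using int_f by (subst Bochner_Integration.integral_sum) auto
    finally have "t \<bullet> (R n x - (\<integral>y. R n y \<partial>M))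
      = Re (\<Sum>k<m. coord idx t k * (mode k (hist n x) - (\<integral>y. mode k (hist n y) \<partial>M)))"
      unfolding inner_diff_right tR by (simp only: right_diff_distrib sum_subtractf minus_complex.simps)
    also have "(\<Sum>k<m. coord idx t k * (mode k (hist n x) - (\<integral>y. mode k (hist n y) \<partial>M)))
      = (\<Sum>k = 1..<m. coord idx t k * (mode k (hist n x) - (\<integral>y. mode k (hist n y) \<partial>M)))"
    \<comment> \<open>mode 0 counts all balls and is deterministic\<close>
    proof (rule sum.mono_neutral_right)
      have "mode 0 l = of_nat (length l)" for l unfolding mode_def by (induction l) auto
      then have "mode 0 (hist n y) = of_nat (Suc n)" for y by simp
      then have "mode 0 (hist n x) - (\<integral>y. mode 0 (hist n y) \<partial>M) = 0" by (simp add: prob_space)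
      moreover have "{..<m} - {1..<m} \<subseteq> {0}" by auto
      ultimately show "\<forall>k\<in>{..<m} - {1..<m}. coord idx t k * (mode k (hist n x)
          - (\<integral>y. mode k (hist n y) \<partial>M)) = 0"
        by auto
    qed auto
    finally show ?thesis using mode_minus_expectation[OF that] by simp
  qed
  have X_eq: "X t n x = (t \<bullet> (R n x - (\<integral>y. R n y \<partial>M))
      - (\<Sum>k = 1..r. 2 * Re (coord idx t k * (of_nat n powr (\<omega> ^ k) * (a k * Z k x))))) / sqrt n" for t n x
  proof -
    have "t \<bullet> (\<Sum>k = 1..r. 2 *\<^sub>R Re_vec ((of_nat n powr (omega m ^ k) * \<Xi> k x) *s vvec idx k))
      = (\<Sum>k = 1..r. 2 * Re (coord idx t k * (of_nat n powr (\<omega> ^ k) * (a k * Z k x))))"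
      unfolding inner_sum_right inner_scaleR_right inner_Re_vec[OF mat] \<Xi>_def
          by (simp only: mult.commute[of _ "coord idx t _"])
    then show ?thesis unfolding X_def Y_def inner_scaleR_right inner_diff_right by simp
  qed
  have int_X: "integrable M (X t n)" for t n
  proof -
    have "integrable M (\<lambda>x. Re (coord idx t k * (of_nat n powr (\<omega> ^ k) * (a k * Z k x))))"
        if "k \<in> {1..r}" for k
      using Z(1)[OF that] by (intro integrable_Re integrable_mult_right)
    moreover have "integrable M (\<lambda>x. t \<bullet> (R n x - (\<integral>y. R n y \<partial>M)))"
      using int_R by (intro integrable_inner_right Bochner_Integration.integrable_diff) auto
    ultimately show ?thesis
      unfolding X_eq[abs_def]
      by (intro integrable_divide Bochner_Integration.integrable_diff Bochner_Integration.integrable_sum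
          integrable_mult_right)
  qed
  \<comment> \<open>error from replacing the growth factor by a multiple of a power of \<open>n\<close>\<close>
  define b where "b t n = (\<Sum>k = 1..r. 2 * cmod (coord idx t k) * (\<integral>x. cmod (Z k x) \<partial>M)
      * (cmod (growth (\<omega> ^ k) n - a k * of_nat n powr (\<omega> ^ k)) / sqrt n))" for t and n :: nat
  \<comment> \<open>error from replacing the limit of the martingale by its value at time \<open>N\<close>\<close>
  define d where "d t n N = (\<Sum>k = 1..r. 2 * cmod (coord idx t k) * cmod (growth (\<omega> ^ k) n) / sqrt n
      * (\<integral>x. cmod (mart k N x - Z k x) \<partial>M))" for t and n N :: nat
  have close: "(\<integral>x. \<bar>X t n x - row_sum (coord idx t) n N x\<bar> \<partial>M) \<le> b t n + d t n N"
    if n: "n \<ge> 1" and nN: "n \<le> N" for t n N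
  proof -
    let ?g = "\<lambda>k. growth (\<omega> ^ k) n" and ?p = "\<lambda>k. a k * of_nat n powr (\<omega> ^ k)" and ?\<tau> = "coord idx t"
    let ?e1 = "\<lambda>k x. 2 * cmod (?\<tau> k) * (cmod (?g k - ?p k) / sqrt n) * cmod (Z k x)"
    let ?e2 = "\<lambda>k x. 2 * cmod (?\<tau> k) * cmod (?g k) / sqrt n * cmod (mart k N x - Z k x)"
    have pt: "\<bar>X t n x - row_sum ?\<tau> n N x\<bar> \<le> (\<Sum>k = 1..r. ?e1 k x) + (\<Sum>k = 1..r. ?e2 k x)" for x
    proof -
      have w: "row_sum ?\<tau> n N x = (Re (\<Sum>k = 1..<m. ?\<tau> k * (?g k * mart k n x))
         - (\<Sum>k = 1..r. 2 * Re (?\<tau> k * (?g k * mart k N x)))) / sqrt n"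
        unfolding assms(4)
        by (rule row_sum_eq[OF n nN _ assms(3)]) (use coord_reflect[OF mat] in auto)
      have "X t n x - row_sum ?\<tau> n N x
        = (\<Sum>k = 1..r. 2 * Re (?\<tau> k * (?g k * mart k N x))
            - 2 * Re (?\<tau> k * (of_nat n powr (\<omega> ^ k) * (a k * Z k x)))) / sqrt n"
        unfolding X_eq centred[OF n] w sum_subtractf by (simp add: diff_divide_distrib)
      also have "\<dots> = (\<Sum>k = 1..r. 2 * Re (?\<tau> k * (?g k * (mart k N x - Z k x) + (?g k
          - ?p k) * Z k x)) / sqrt n)"
      proof -
        have "2 * Re (c * (g * z)) - 2 * Re (c * (w * (a' * y)))
            = 2 * Re (c * (g * (z - y) + (g - a' * w) * y))"
          for c g z w a' y :: complex
        proof -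
          have "c * (g * (z - y) + (g - a' * w) * y)
              = c * (g * z) - c * (w * (a' * y))" by (simp add: algebra_simps)
          then show ?thesis by (simp only: minus_complex.simps right_diff_distrib)
        qed
        then show ?thesis by (simp only: sum_divide_distrib)
      qed
      finally have eq: "X t n x - row_sum ?\<tau> n N x
        = (\<Sum>k = 1..r. 2 * Re (?\<tau> k * (?g k * (mart k N x - Z k x) + (?g k - ?p k) * Z k x)) / sqrt n)" .
      have est: "\<bar>2 * Re (c * (g * z + h * y)) / s\<bar>
          \<le> 2 * cmod c * (cmod h / s) * cmod y + 2 * cmod c * cmod g / s * cmod z"
        if "s \<ge> 0" for c g z h y :: complex and s :: real
      proof -
        have "\<bar>Re (c * (g * z + h * y))\<bar> \<le> cmod c * (cmod g * cmod z + cmod h * cmod y)"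
          using abs_Re_le_cmod[of "c * (g * z + h * y)"] norm_triangle_ineq[of "g * z" "h * y"]
          unfolding norm_mult by (smt (verit) mult_left_mono norm_ge_zero norm_mult)
        then have "2 * \<bar>Re (c * (g * z + h * y))\<bar> / s
            \<le> 2 * (cmod c * (cmod g * cmod z + cmod h * cmod y)) / s"
          using that by (intro divide_right_mono mult_left_mono) auto
        also have "\<dots> = 2 * cmod c * (cmod h / s) * cmod y + 2 * cmod c * cmod g / s * cmod z"
          by (simp add: algebra_simps add_divide_distrib)
        finally show ?thesis using that by (simp only: abs_divide abs_mult abs_numeral abs_of_nonneg)
      qed
      show ?thesis
        unfolding eq sum.distrib[symmetric] by (rule order_trans[OF sum_abs], rule sum_mono, rule est) simp
    qed
    have i1: "integrable M (?e1 k)" and i2: "integrable M (?e2 k)" if "k \<in> {1..r}" for k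
    proof -
      show "integrable M (?e1 k)" by (rule integrable_mult_right[OF integrable_norm[OF Z(1)[OF that]]])
      show "integrable M (?e2 k)"
        by (rule integrable_mult_right[OF integrable_norm[OF Bochner_Integration.integrable_diff[OF
            integrable_mart Z(1)[OF that]]]])
    qed
    have i: "integrable M (\<lambda>x. \<Sum>k = 1..r. ?e1 k x)" "integrable M (\<lambda>x. \<Sum>k = 1..r. ?e2 k x)"
      by (rule Bochner_Integration.integrable_sum, rule i1, assumption)
        (rule Bochner_Integration.integrable_sum, rule i2, assumption)
    have "(\<integral>x. \<bar>X t n x - row_sum ?\<tau> n N x\<bar> \<partial>M) \<le> (\<integral>x. (\<Sum>k = 1..r. ?e1 k x) + (\<Sum>k = 1..r. ?e2 k x) \<partial>M)"
      by (rule integral_mono[OF integrable_abs[OF Bochner_Integration.integrable_diff[OF int_X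
          integrable_row_sum]]
            Bochner_Integration.integrable_add[OF i] pt])
    also have "\<dots> = (\<Sum>k = 1..r. \<integral>x. ?e1 k x \<partial>M) + (\<Sum>k = 1..r. \<integral>x. ?e2 k x \<partial>M)"
      unfolding Bochner_Integration.integral_add[OF i]
      by (subst Bochner_Integration.integral_sum, rule i1, assumption)
        (subst Bochner_Integration.integral_sum, rule i2, assumption, rule refl)
    also have "\<dots> = b t n + d t n N"
      unfolding b_def d_def integral_mult_right_zero by (simp only: mult_ac)
    finally show ?thesis .
  qed
  have b0: "b t \<longlonglongrightarrow> 0" for t
  proof -
    have "b t \<longlonglongrightarrow> (\<Sum>k = 1..r. 2 * cmod (coord idx t k) * (\<integral>x. cmod (Z k x) \<partial>M) * 0)"
      unfolding b_def using a by (intro tendsto_sum tendsto_mult_left) blast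
    then show ?thesis by simp
  qed
  have d0: "d t n \<longlonglongrightarrow> 0" for t n
  proof -
    have "d t n \<longlonglongrightarrow> (\<Sum>k = 1..r. 2 * cmod (coord idx t k) * cmod (growth (\<omega> ^ k) n) / sqrt n * 0)"
      unfolding d_def by (intro tendsto_sum tendsto_mult_left Z(2))
    then show ?thesis by simp
  qed
  let ?q = "\<lambda>t. \<Sum>k = 1..<m. (cmod (coord idx t k))\<^sup>2 / \<bar>2 * lam m k - 1\<bar>"
  have \<tau>: "coord idx t (m - k) = cnj (coord idx t k)" if "k \<in> {1..<m}" for t k
    using that by (intro coord_reflect[OF mat]) auto
  have char: "(\<lambda>n. CLINT x|M. iexp (X t n x)) \<longlonglongrightarrow> complex_of_real (exp (- ?q t / 2))" for t
    by (rule CLT_weighted_sums(1)[where b = "b t" and d = "d t", OF lam \<tau> int_X close b0 d0])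
  have bounded: "\<exists>B. \<forall>n\<ge>1. (\<integral>x. \<bar>X t n x\<bar> \<partial>M) \<le> B" for t
    by (rule CLT_weighted_sums(2)[where b = "b t" and d = "d t", OF lam \<tau> int_X close b0 d0])
  obtain N where N: "prob_space N" "centered_normal N (cov_matrix idx m)"
    "\<And>u. (CLINT x|N. iexp (u \<bullet> x)) = exp (- (\<Sum>p\<in>{1..<m} \<times> UNIV. (u \<bullet> cov_factor idx m p)\<^sup>2) / 2)"
    "integrable N norm"
  proof (rule exists_centered_normal[of "{1..<m} \<times> (UNIV :: bool set)" "cov_matrix idx m" "cov_factor idx
      m"])
    show "cov_matrix idx m $ i $ j = (\<Sum>p\<in>{1..<m} \<times> UNIV. cov_factor idx m p $ i
        * cov_factor idx m p $ j)" for i j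
      by (simp add: cov_matrix_def[OF mat])
  qed auto
  have Y_meas[measurable]: "Y n \<in> borel_measurable M" for n
  proof (rule borel_measurable_euclidean_space[THEN iffD2], rule ballI)
    fix e :: "real^'m"
    have "(\<lambda>x. Y n x \<bullet> e) = X e n" by (simp add: X_def fun_eq_iff inner_commute)
    then show "(\<lambda>x. Y n x \<bullet> e) \<in> borel_measurable M"
      using borel_measurable_integrable[OF int_X[of e n]] by (simp only:)
  qed
  have norm_Y: "norm (Y n x) \<le> (\<Sum>e\<in>Basis. \<bar>X e n x\<bar>)" for n x
    unfolding X_def using norm_le_l1[of "Y n x"] by (simp add: inner_commute)
  have int_Y: "integrable M (\<lambda>x. norm (Y n x))" for n
  proof (rule Bochner_Integration.integrable_bound)
    show "integrable M (\<lambda>x. \<Sum>e\<in>Basis. \<bar>X e n x\<bar>)"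
      by (intro Bochner_Integration.integrable_sum integrable_abs int_X)
    show "AE x in M. norm (norm (Y n x)) \<le> norm (\<Sum>e\<in>Basis. \<bar>X e n x\<bar>)"
      using norm_Y by (intro AE_I2) (simp add: order_trans[OF norm_Y abs_ge_self])
  qed simp
  have "\<forall>t. \<exists>B. \<forall>n\<ge>1. (\<integral>x. \<bar>X t n x\<bar> \<partial>M) \<le> B" using bounded by blast
  from choice[OF this] obtain B where B: "\<forall>t. \<forall>n\<ge>1. (\<integral>x. \<bar>X t n x\<bar> \<partial>M) \<le> B t" by (elim exE)
  define B1 where "B1 = max 0 (max (\<Sum>e\<in>Basis. B e) (\<integral>x. norm x \<partial>N))"
  have mom: "(\<integral>x. norm (Y n x) \<partial>M) \<le> B1" for n
  proof (cases "n \<ge> 1")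
    case True
    have "(\<integral>x. norm (Y n x) \<partial>M) \<le> (\<integral>x. (\<Sum>e\<in>Basis. \<bar>X e n x\<bar>) \<partial>M)"
      using int_Y norm_Y by (intro integral_mono Bochner_Integration.integrable_sum integrable_abs int_X)
          auto
    also have "\<dots> = (\<Sum>e\<in>Basis. \<integral>x. \<bar>X e n x\<bar> \<partial>M)"
      by (intro Bochner_Integration.integral_sum integrable_abs int_X)
    also have "\<dots> \<le> (\<Sum>e\<in>Basis. B e)" using B True by (intro sum_mono) blast
    also have "\<dots> \<le> B1" unfolding B1_def by simp
    finally show ?thesis .
  next
    case False
    \<comment> \<open>\<open>1 / sqrt 0 = 0\<close>\<close>
    then have "Y n x = 0" for x by (simp add: Y_def)
    then show ?thesis by (simp add: B1_def)
  qed
  have weak: "weakly_converges (\<lambda>n. distr M borel (Y n)) N"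
  proof (rule weakly_converges_if_char_converges)
    show "prob_space (distr M borel (Y n))" for n by (rule prob_space_distr) simp
    show "prob_space N" by (rule N)
    show "sets N = sets borel" using N(2) by (simp add: centered_normal_def gaussian_def)
    show "integrable (distr M borel (Y n)) norm" for n using int_Y by (simp add: integrable_distr_eq)
    show "(\<integral>x. norm x \<partial>distr M borel (Y n)) \<le> B1" for n using mom by (simp add: integral_distr)
    show "integrable N norm" by (rule N)
    show "(\<integral>x. norm x \<partial>N) \<le> B1" by (simp add: B1_def)
    show "(\<lambda>n. CLINT x|distr M borel (Y n). iexp (t \<bullet> x)) \<longlonglongrightarrow> (CLINT x|N. iexp (t \<bullet> x))" for t
    proof -
      have "(CLINT x|distr M borel (Y n). iexp (t \<bullet> x)) = (CLINT x|M. iexp (X t n x))" for n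
        unfolding X_def by (subst integral_distr) auto
      then show ?thesis using char[of t] unfolding N(3) sum_inner_cov_factor[OF mat] by simp
    qed
  qed simp
  have meas: "\<forall>k\<in>{1..r}. \<Xi> k \<in> borel_measurable M"
  proof
    fix k assume "k \<in> {1..r}"
    then have "Z k \<in> borel_measurable M" using Z(1) by auto
    then show "\<Xi> k \<in> borel_measurable M" unfolding \<Xi>_def[abs_def] by simp
  qed
  show ?thesis
    using meas Sigma_mat_real[OF mat] rank_cov_matrix[OF mat lam] N(2) weak[unfolded Y_def[abs_def]]
        by blast
qed

end
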